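(* There is an algorithm which, given $m \geq 2$ and input variables $t = (t_0, \dotsc, t_{m-1})$, computes in running time $\mathcal O(m \log_2 m)$ a circuit $C$ over the basis $\{\land, \lor\}$ computing the And-Or path $g(t)$ such that \[ \mathrm{depth}(C) \leq \log_2 m + \log_2 \log_2 m + 0.65 \qquad \text{and} \qquad \mathrm{size}(C) \leq 3.67\, m - 2 . \]
   Context: A circuit over the basis $\{\land,\lor\}$ on Boolean input variables is a finite directed acyclic graph whose sources are the input vertices (each labelled by a distinct variable, arbitrary fanout allowed) and whose other vertices are gates; each gate has exactly two predecessors and is labelled by $\land$ or $\lor$, computing the corresponding function of the values of its predecessors; a designated output vertex gives the computed function. No negations are used. The size of a circuit is its number of gates, and its depth is the maximum number of gates on a directed path. For $m\ge 1$ and variables $t=(t_0,\dots,t_{m-1})$, the And-Or path is the Boolean function $g(t) = t_0 \land \bigl(t_1 \lor \bigl(t_2 \land \bigl(t_3 \lor (\cdots)\bigr)\bigr)\bigr)$, i.e. $g(t_0)=t_0$ and the operations $\land$ and $\lor$ alternate, starting with $\land$ between $t_0$ and the rest. *)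

theory Defs
  imports Complex_Main "HOL-Library.Landau_Symbols"
begin

section \<open>And-Or paths\<close>

datatype bop = AND | OR

fun apply_bop :: "bop \<Rightarrow> bool \<Rightarrow> bool \<Rightarrow> bool" where
  "apply_bop AND a b = (a \<and> b)"
| "apply_bop OR a b = (a \<or> b)"

fun dual_bop :: "bop \<Rightarrow> bop" where
  "dual_bop AND = OR"
| "dual_bop OR = AND"

text \<open>The case of no variables is deliberately left unspecified.\<close>

fun alternating_path :: "bop \<Rightarrow> bool list \<Rightarrow> bool" where
  "alternating_path f [t] = t"
| "alternating_path f (t # u # ts) = apply_bop f t (alternating_path (dual_bop f) (u # ts))"

definition and_or_path :: "bool list \<Rightarrow> bool" where
  "and_or_path ts = alternating_path AND ts"

section \<open>Circuits\<close>

text \<open>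
  With k inputs and n gates, the vertices are the numbers below k + n. Vertex i < k is the input
  vertex labelled by the i-th element of inputs, and vertex k + j is the j-th gate, given by its
  operation and its two predecessors. The gates need not be listed in topological order.
\<close>

record 'v circuit =
  inputs :: "'v list"
  gates :: "(bop \<times> nat \<times> nat) list"
  outv :: nat

definition vertices :: "'v circuit \<Rightarrow> nat set" where
  "vertices C = {..<length (inputs C) + length (gates C)}"

definition is_gate :: "'v circuit \<Rightarrow> nat \<Rightarrow> bool" where
  "is_gate C v \<longleftrightarrow> v \<in> vertices C \<and> length (inputs C) \<le> v"

definition arcs :: "'v circuit \<Rightarrow> (nat \<times> nat) set" where
  "arcs C = {(u, length (inputs C) + j) | u j.
     j < length (gates C) \<and> (\<exists>f a b. gates C ! j = (f, a, b) \<and> (u = a \<or> u = b))}"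

definition is_circuit :: "'v circuit \<Rightarrow> bool" where
  "is_circuit C \<longleftrightarrow>
     distinct (inputs C) \<and>
     (\<forall>(f, a, b) \<in> set (gates C). a \<in> vertices C \<and> b \<in> vertices C \<and> a \<noteq> b) \<and>
     acyclic (arcs C) \<and>
     outv C \<in> vertices C"

text \<open>
  The relation vertex_val C x v b states that vertex v has value b under the assignment x of the
  variables. On acyclic graphs it is the graph of a total function on the vertices.
\<close>

inductive vertex_val :: "'v circuit \<Rightarrow> ('v \<Rightarrow> bool) \<Rightarrow> nat \<Rightarrow> bool \<Rightarrow> bool"
  for C :: "'v circuit" and x :: "'v \<Rightarrow> bool" where
  input: "i < length (inputs C) \<Longrightarrow> vertex_val C x i (x (inputs C ! i))"
| gate: "\<lbrakk>j < length (gates C); gates C ! j = (f, a, b);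
          vertex_val C x a p; vertex_val C x b q\<rbrakk>
         \<Longrightarrow> vertex_val C x (length (inputs C) + j) (apply_bop f p q)"

definition computes :: "'v circuit \<Rightarrow> (('v \<Rightarrow> bool) \<Rightarrow> bool) \<Rightarrow> bool" where
  "computes C F \<longleftrightarrow> (\<forall>x. vertex_val C x (outv C) (F x))"

definition circuit_size :: "'v circuit \<Rightarrow> nat" where
  "circuit_size C = length (gates C)"

definition directed_path :: "'v circuit \<Rightarrow> nat list \<Rightarrow> bool" where
  "directed_path C p \<longleftrightarrow>
     p \<noteq> [] \<and> set p \<subseteq> vertices C \<and> successively (\<lambda>u v. (u, v) \<in> arcs C) p"

definition circuit_depth :: "'v circuit \<Rightarrow> nat" where
  "circuit_depth C = Max {length (filter (is_gate C) p) | p. directed_path C p}"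

section \<open>The machine model\<close>

text \<open>
  Random access machines with addition, truncated subtraction and comparison under the uniform
  cost criterion (as in Cook and Reckhow), in structured form. The store consists of arrays of
  natural numbers; cell i of array a is s a i. Array names are constants of the program text, so
  that a program uses only finitely many arrays and these can be interleaved in a single memory at
  the expense of a constant factor; only the index of a cell is computed. Multiplication, division
  and bit operations are not primitive, as they are not reasonable at unit cost on unbounded
  numbers.
\<close>

type_synonym store = "nat \<Rightarrow> nat \<Rightarrow> nat"

datatype aexp = Const nat | Cell nat aexp | Plus aexp aexp | Minus aexp aexp

datatype bexp = Less aexp aexp | Not bexp | Conj bexp bexp

datatype com =
    Skip
  | Assign nat aexp aexp
  | Seq com com
  | IfElse bexp com com
  | While bexp com

fun aval :: "aexp \<Rightarrow> store \<Rightarrow> nat" where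
  "aval (Const n) s = n"
| "aval (Cell a e) s = s a (aval e s)"
| "aval (Plus e f) s = aval e s + aval f s"
| "aval (Minus e f) s = aval e s - aval f s"

fun bval :: "bexp \<Rightarrow> store \<Rightarrow> bool" where
  "bval (Less e f) s \<longleftrightarrow> aval e s < aval f s"
| "bval (Not b) s \<longleftrightarrow> \<not> bval b s"
| "bval (Conj b c) s \<longleftrightarrow> bval b s \<and> bval c s"

fun acost :: "aexp \<Rightarrow> nat" where
  "acost (Const n) = 1"
| "acost (Cell a e) = 1 + acost e"
| "acost (Plus e f) = 1 + acost e + acost f"
| "acost (Minus e f) = 1 + acost e + acost f"

fun bcost :: "bexp \<Rightarrow> nat" where
  "bcost (Less e f) = 1 + acost e + acost f"
| "bcost (Not b) = 1 + bcost b"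
| "bcost (Conj b c) = 1 + bcost b + bcost c"

text \<open>
  The relation exec c s n s' states that c, started in s, terminates in s' after n steps. The
  command Assign a e f stores the value of f in the cell of array a with index e.
\<close>

inductive exec :: "com \<Rightarrow> store \<Rightarrow> nat \<Rightarrow> store \<Rightarrow> bool" where
  Skip: "exec Skip s 1 s"
| Assign: "exec (Assign a e f) s (1 + acost e + acost f)
             (s(a := (s a)(aval e s := aval f s)))"
| Seq: "\<lbrakk>exec c s n s'; exec d s' n' s''\<rbrakk> \<Longrightarrow> exec (Seq c d) s (n + n') s''"
| IfTrue: "\<lbrakk>bval b s; exec c s n s'\<rbrakk> \<Longrightarrow> exec (IfElse b c d) s (1 + bcost b + n) s'"
| IfFalse: "\<lbrakk>\<not> bval b s; exec d s n s'\<rbrakk> \<Longrightarrow> exec (IfElse b c d) s (1 + bcost b + n) s'"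
| WhileFalse: "\<not> bval b s \<Longrightarrow> exec (While b c) s (1 + bcost b) s"
| WhileTrue: "\<lbrakk>bval b s; exec c s n s'; exec (While b c) s' n' s''\<rbrakk>
              \<Longrightarrow> exec (While b c) s (1 + bcost b + n + n') s''"

text \<open>
  Variables are named by natural numbers. On input, cell 0 of array 0 holds the number of variables
  and array 1 their names; all other cells are 0. On output, array 0 holds the number of inputs,
  the number of gates and the output vertex of the circuit, array 1 the labels of its input
  vertices, and arrays 2, 3 and 4 hold the operations (0 for AND, other values for OR) and the two
  predecessors of the gates. All other cells may be used as work space.
\<close>

definition input_store :: "nat list \<Rightarrow> store" where
  "input_store ts = (\<lambda>a i.
     if a = 0 \<and> i = 0 then length ts
     else if a = 1 \<and> i < length ts then ts ! i
     else 0)"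

definition output_circuit :: "store \<Rightarrow> nat circuit" where
  "output_circuit s =
     \<lparr>inputs = map (s 1) [0..<s 0 0],
      gates = map (\<lambda>j. (if s 2 j = 0 then AND else OR, s 3 j, s 4 j)) [0..<s 0 1],
      outv = s 0 2\<rparr>"

end

theory Submission
  imports Defs
begin

text \<open>
  A segment of the path is evaluated slot by slot: after i slots, the accumulated value has depth at
  most i, and slot i joins it with a segment of the other type that is computed at depth i. The value
  R of this segment only has to be correct if no earlier position is decisive, and has to be neutral
  for the join if one of the parity of R is. The latter is achieved by a signal, namely the
  conjunction or disjunction of the earlier positions of this parity, which is joined at one of the
  slots of the segment. A signal may reach further back than necessary. Therefore all signals can be assembled
  from the same balanced trees over aligned blocks of 2 ^ h positions of one parity; a signal for
  3 * 2 ^ (h - 1) positions has depth h + 1 and needs at most h further gates. Only the slot of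
  logarithmic index taken by the signal prevents the capacities from doubling with every level, so
  that depth i suffices for a number m of positions with m log m of order 2 ^ i. The constant 1.275
  in 1.275 * 2 ^ i \<le> m log m follows from the first hundred capacities and an estimate for the
  rate of convergence. The shared trees have at most m - 2 gates, and an amortised count shows that
  8/3 further gates per position suffice. The circuit is emitted by a stack machine that performs
  O(m) steps of cost O(log m).
\<close>

section \<open>Gate lists in topological order\<close>

text \<open>With S for \<open>slot_pre\<close>, the recurrence reads S (i + 1) = 2 * S i - r, where
  r is the length of the slot j taken by the signal. As 2 ^ j < 4 / 3 * S i, r is less than 4 / 3 *
  S i divided by the ratio 2 ^ j / S j. Since j is close to i, the ratio 2 ^ i / S i grows by at
  most 3 / 4 per slot, which would make S i * log 2 (S i) about 4 / 3 * 2 ^ i; this leaves room for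
  1.275. The estimate refers back to the ratio at j and closes only for ratios near 50, whence the
  computed start. The summand 0.65 arises because depth d - 1 does not suffice for the least
  sufficient d, and 1 - log 2 1.275 is at most 0.65. Two features of the circuit model shape the
  proof. Depth is a maximum over all directed paths, so every vertex ever built must obey the bound,
  also tree blocks that the output does not depend on. The two predecessors of a gate must differ,
  which for shared vertices is shown by comparing the functions that they compute.\<close>

definition extend_by :: "('b list \<Rightarrow> 'g \<Rightarrow> 'b) \<Rightarrow> 'b list \<Rightarrow> 'g list \<Rightarrow> 'b list" where
  "extend_by f = foldl (\<lambda>l g. l @ [f l g])"

lemma extend_by_Nil [simp]: "extend_by f l [] = l"
  by (simp add: extend_by_def)

lemma extend_by_snoc: "extend_by f l (gs @ [g]) = extend_by f l gs @ [f (extend_by f l gs) g]"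
  by (simp add: extend_by_def)

lemma length_extend_by [simp]: "length (extend_by f l gs) = length l + length gs"
  by (induction gs rule: rev_induct) (simp_all add: extend_by_snoc)

lemma extend_by_append: "\<exists>r. extend_by f l (gs @ hs) = extend_by f l gs @ r"
proof (induction hs rule: rev_induct)
  case (snoc h hs)
  then show ?case
    by (metis append.assoc extend_by_snoc)
qed simp

lemma nth_extend_by_append:
  "v < length l + length gs \<Longrightarrow> extend_by f l (gs @ hs) ! v = extend_by f l gs ! v"
  using extend_by_append[of f l gs hs] by (auto simp: nth_append)

lemma nth_extend_by_gate:
  assumes "j < length gs"
  shows "extend_by f l gs ! (length l + j) = f (extend_by f l (take j gs)) (gs ! j)"
proof -
  have gs: "gs = (take j gs @ [gs ! j]) @ drop (Suc j) gs"
    using assms by (simp add: id_take_nth_drop)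
  have "extend_by f l gs ! (length l + j) = extend_by f l (take j gs @ [gs ! j]) ! (length l + j)"
    using assms by (subst (1) gs, subst nth_extend_by_append) auto
  also have "\<dots> = f (extend_by f l (take j gs)) (gs ! j)"
    using assms by (simp add: extend_by_snoc nth_append)
  finally show ?thesis .
qed

type_synonym gate = "bop \<times> nat \<times> nat"

text \<open>Values and depths come from the same fold, which extends a list by an entry computed
  from the list so far. Stability under appending gates is thus proved once for both.\<close>

definition gate_vals :: "nat \<Rightarrow> (nat \<Rightarrow> bool) \<Rightarrow> gate list \<Rightarrow> bool list" where
  "gate_vals m x = extend_by (\<lambda>l (f, a, b). apply_bop f (l ! a) (l ! b)) (map x [0..<m])"

definition gate_depths :: "nat \<Rightarrow> gate list \<Rightarrow> nat list" where
  "gate_depths m = extend_by (\<lambda>l (f, a, b). Suc (max (l ! a) (l ! b))) (replicate m 0)"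

definition topological :: "nat \<Rightarrow> gate list \<Rightarrow> bool" where
  "topological m gs \<longleftrightarrow>
     (\<forall>j<length gs. case gs ! j of (f, a, b) \<Rightarrow> a < m + j \<and> b < m + j \<and> a \<noteq> b)"

definition realizes ::
  "nat \<Rightarrow> gate list \<Rightarrow> nat \<Rightarrow> ((nat \<Rightarrow> bool) \<Rightarrow> bool) \<Rightarrow> nat \<Rightarrow> bool" where
  "realizes m gs v F d \<longleftrightarrow>
     v < m + length gs \<and> (\<forall>x. gate_vals m x gs ! v = F x) \<and> gate_depths m gs ! v \<le> d"

text \<open>The bound ranges over all vertices and not just those below the output, because
  \<open>circuit_depth\<close> takes all directed paths into account.\<close>

definition sound :: "nat \<Rightarrow> nat \<Rightarrow> gate list \<Rightarrow> bool" where
  "sound m D gs \<longleftrightarrow> topological m gs \<and> (\<forall>v < m + length gs. gate_depths m gs ! v \<le> D)"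

lemma length_gate_vals [simp]: "length (gate_vals m x gs) = m + length gs"
  and length_gate_depths [simp]: "length (gate_depths m gs) = m + length gs"
  by (simp_all add: gate_vals_def gate_depths_def)

lemma realizes_append: "realizes m gs v F d \<Longrightarrow> realizes m (gs @ hs) v F d"
  unfolding realizes_def gate_vals_def gate_depths_def by (auto simp: nth_extend_by_append)

lemma realizes_mono: "realizes m gs v F d \<Longrightarrow> d \<le> e \<Longrightarrow> realizes m gs v F e"
  unfolding realizes_def by auto

lemma realizes_less: "realizes m gs v F d \<Longrightarrow> v < m + length gs"
  by (simp add: realizes_def)

text \<open>Used contrapositively: vertices with different functions are different, as the
  predecessors of a gate have to be.\<close>

lemma realizes_unique: "realizes m gs v F d \<Longrightarrow> realizes m gs v G e \<Longrightarrow> F = G"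
  unfolding realizes_def by (intro ext) metis

lemma realizes_input:
  assumes "v < m"
  shows "realizes m gs v (\<lambda>x. x v) d"
proof -
  have "realizes m [] v (\<lambda>x. x v) d"
    using assms by (simp add: realizes_def gate_vals_def gate_depths_def)
  from realizes_append[OF this, of gs] show ?thesis by simp
qed

lemma realizes_gate:
  assumes "realizes m gs a F d" "realizes m gs b G e"
  shows "realizes m (gs @ [(f, a, b)]) (m + length gs) (\<lambda>x. apply_bop f (F x) (G x)) (Suc (max d e))"
proof -
  have l1: "m + length gs = length (gate_vals m x gs)" for x by simp
  have l2: "m + length gs = length (gate_depths m gs)" by simp
  have "gate_vals m x (gs @ [(f, a, b)]) ! (m + length gs) =
          apply_bop f (gate_vals m x gs ! a) (gate_vals m x gs ! b)" for x
    by (subst l1[of x]) (simp only: gate_vals_def extend_by_snoc nth_append_length case_prod_conv)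
  moreover have "gate_depths m (gs @ [(f, a, b)]) ! (m + length gs) =
          Suc (max (gate_depths m gs ! a) (gate_depths m gs ! b))"
    by (subst l2) (simp only: gate_depths_def extend_by_snoc nth_append_length case_prod_conv)
  ultimately show ?thesis
    using assms unfolding realizes_def by auto
qed

lemma topological_snoc:
  "topological m (gs @ [(f, a, b)]) \<longleftrightarrow>
     topological m gs \<and> a < m + length gs \<and> b < m + length gs \<and> a \<noteq> b"
proof -
  have "(\<forall>j<Suc n. P j) \<longleftrightarrow> (\<forall>j<n. P j) \<and> P n" for n and P :: "nat \<Rightarrow> bool"
    by (auto simp: less_Suc_eq)
  then show ?thesis
    by (simp add: topological_def nth_append conj_ac)
qed

lemma sound_Nil: "sound m D []"
  by (simp add: sound_def topological_def gate_depths_def)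

lemma sound_gate:
  assumes "sound m D gs" "realizes m gs a F d" "realizes m gs b G e" "a \<noteq> b" "d < D" "e < D"
  shows "sound m D (gs @ [(f, a, b)])"
proof -
  have "gate_depths m (gs @ [(f, a, b)]) ! v \<le> D" if "v < m + length gs + 1" for v
  proof (cases "v < m + length gs")
    case True
    then show ?thesis
      using assms(1) by (auto simp: sound_def gate_depths_def nth_extend_by_append)
  next
    case False
    then have "v = m + length gs" using that by simp
    moreover have "realizes m (gs @ [(f, a, b)]) (m + length gs)
        (\<lambda>x. apply_bop f (F x) (G x)) (Suc (max d e))"
      by (rule realizes_gate) fact+
    ultimately show ?thesis
      using assms(5,6) by (auto simp: realizes_def)
  qed
  then show ?thesis
    using assms by (auto simp: sound_def topological_snoc realizes_def)
qed

section \<open>From topologically ordered gate lists to circuits\<close>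

lemma arcs_increasing:
  assumes "topological (length ts) gs"
    and "(u, v) \<in> arcs \<lparr>inputs = ts, gates = gs, outv = w\<rparr>"
  shows "u < v" "length ts \<le> v" "v < length ts + length gs"
    and "gate_depths (length ts) gs ! u < gate_depths (length ts) gs ! v"
proof -
  let ?m = "length ts"
  from assms(2) obtain j f a b where j: "v = ?m + j" "j < length gs" "gs ! j = (f, a, b)"
    and u: "u = a \<or> u = b"
    by (auto simp: arcs_def)
  have ab: "a < ?m + j" "b < ?m + j"
    using assms(1) j by (auto simp: topological_def split: prod.splits)
  show "u < v" "length ts \<le> v" "v < length ts + length gs" using j u ab by auto
  have *: "gate_depths ?m gs ! w = gate_depths ?m (take j gs) ! w" if "w < ?m + j" for w
  proof -
    have "gate_depths ?m (take j gs @ drop j gs) ! w = gate_depths ?m (take j gs) ! w"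
      using that j unfolding gate_depths_def by (subst nth_extend_by_append) auto
    then show ?thesis by simp
  qed
  have "gate_depths ?m gs ! (?m + j) =
          Suc (max (gate_depths ?m (take j gs) ! a) (gate_depths ?m (take j gs) ! b))"
    using nth_extend_by_gate[OF j(2), of _ "replicate ?m (0::nat)"] j(3)
    by (simp add: gate_depths_def)
  then show "gate_depths ?m gs ! u < gate_depths ?m gs ! v"
    using *[of a] *[of b] ab u j(1) by auto
qed

lemma is_circuit_topological:
  assumes "distinct ts" "topological (length ts) gs" "w < length ts + length gs"
  shows "is_circuit \<lparr>inputs = ts, gates = gs, outv = w\<rparr>"
proof -
  have "arcs \<lparr>inputs = ts, gates = gs, outv = w\<rparr> \<subseteq> less_than"
    using arcs_increasing(1)[OF assms(2)] by auto
  then have "acyclic (arcs \<lparr>inputs = ts, gates = gs, outv = w\<rparr>)"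
    using acyclic_subset wf_acyclic[OF wf_less_than] by blast
  moreover have "a < length ts + length gs \<and> b < length ts + length gs \<and> a \<noteq> b"
    if "(f, a, b) \<in> set gs" for f a b
  proof -
    from that obtain j where "j < length gs" "gs ! j = (f, a, b)"
      by (auto simp: in_set_conv_nth)
    then show ?thesis using assms(2) by (auto simp: topological_def split: prod.splits)
  qed
  ultimately show ?thesis
    using assms(1,3) by (auto simp: is_circuit_def vertices_def)
qed

text \<open>\<open>gate_depths\<close> increases strictly along arcs and is positive at gates, so
  its value at the end of a path bounds the number of gates on the path.\<close>

lemma circuit_depth_sound:
  assumes "sound (length ts) D gs" "ts \<noteq> []"
  shows "circuit_depth \<lparr>inputs = ts, gates = gs, outv = w\<rparr> \<le> D"
proof -
  let ?C = "\<lparr>inputs = ts, gates = gs, outv = w\<rparr>" and ?d = "\<lambda>v. gate_depths (length ts) gs ! v"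
  have top: "topological (length ts) gs" using assms(1) by (simp add: sound_def)
  have path: "length (filter (is_gate ?C) p) \<le> ?d (last p)" if "directed_path ?C p" for p
    using that
  proof (induction p rule: rev_induct)
    case Nil
    then show ?case by (simp add: directed_path_def)
  next
    case (snoc v p)
    have pos: "?d v > 0" if "is_gate ?C v"
    proof -
      have "length ts \<le> v" "v < length ts + length gs"
        using that by (auto simp: is_gate_def vertices_def)
      then obtain j where j: "v = length ts + j" "j < length gs"
        by (metis le_iff_add nat_add_left_cancel_less)
      show ?thesis
        using nth_extend_by_gate[OF j(2), of _ "replicate (length ts) (0::nat)"] j
        by (auto simp: gate_depths_def split: prod.splits)
    qed
    show ?case
    proof (cases "p = []")
      case True
      then show ?thesis using pos by (cases "is_gate ?C v") auto
    next
      case False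
      then have p: "directed_path ?C p" and arc: "(last p, v) \<in> arcs ?C"
        using snoc.prems by (auto simp: directed_path_def successively_append_iff)
      show ?thesis
        using snoc.IH[OF p] arcs_increasing(4)[OF top arc] by auto
    qed
  qed
  let ?S = "{length (filter (is_gate ?C) p) | p. directed_path ?C p}"
  have le: "n \<le> D" if "n \<in> ?S" for n
  proof -
    from that obtain p where p: "directed_path ?C p" "n = length (filter (is_gate ?C) p)" by auto
    then have "last p < length ts + length gs"
      by (auto simp: directed_path_def vertices_def dest!: last_in_set)
    then show ?thesis using path[OF p(1)] p(2) assms(1) by (fastforce simp: sound_def)
  qed
  have "directed_path ?C [0]" using assms(2) by (auto simp: directed_path_def vertices_def)
  then have "?S \<noteq> {}" by blast
  moreover have "finite ?S" using le by (meson finite_nat_set_iff_bounded_le)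
  ultimately show ?thesis unfolding circuit_depth_def using le by (subst Max_le_iff) blast+
qed

lemma computes_realizes:
  fixes ts :: "'a list"
  assumes "topological (length ts) gs" "realizes (length ts) gs w F d"
  shows "computes \<lparr>inputs = ts, gates = gs, outv = w\<rparr> (\<lambda>y. F (\<lambda>i. y (ts ! i)))"
  unfolding computes_def
proof
  fix y :: "'a \<Rightarrow> bool"
  let ?C = "\<lparr>inputs = ts, gates = gs, outv = w\<rparr>" and ?m = "length ts"
  let ?x = "\<lambda>i. y (ts ! i)"
  have val: "vertex_val ?C y v (gate_vals ?m ?x gs ! v)" if "v < ?m + length gs" for v
    using that
  proof (induction v rule: less_induct)
    case (less v)
    show ?case
    proof (cases "v < ?m")
      case True
      have "gate_vals ?m ?x gs ! v = y (ts ! v)"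
        using nth_extend_by_append[of v "map ?x [0..<?m]" "[]" _ gs] True
        by (simp add: gate_vals_def)
      then show ?thesis using vertex_val.input[of v ?C y] True by simp
    next
      case False
      then obtain j where j: "v = ?m + j" "j < length gs"
        using less.prems by (auto simp: le_iff_add not_less)
      obtain f a b where g: "gs ! j = (f, a, b)" by (cases "gs ! j")
      have ab: "a < ?m + j" "b < ?m + j"
        using assms(1) j g by (auto simp: topological_def split: prod.splits)
      have *: "gate_vals ?m ?x gs ! u = gate_vals ?m ?x (take j gs) ! u" if "u < ?m + j" for u
      proof -
        have "gate_vals ?m ?x (take j gs @ drop j gs) ! u = gate_vals ?m ?x (take j gs) ! u"
          using that j unfolding gate_vals_def by (subst nth_extend_by_append) auto
        then show ?thesis by simp
      qed
      have "gate_vals ?m ?x gs ! v =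
          apply_bop f (gate_vals ?m ?x (take j gs) ! a) (gate_vals ?m ?x (take j gs) ! b)"
        using nth_extend_by_gate[OF j(2), of _ "map ?x [0..<?m]"] g j(1)
        by (simp add: gate_vals_def)
      also have "\<dots> = apply_bop f (gate_vals ?m ?x gs ! a) (gate_vals ?m ?x gs ! b)"
        using ab by (simp add: *)
      finally have eq: "gate_vals ?m ?x gs ! v =
          apply_bop f (gate_vals ?m ?x gs ! a) (gate_vals ?m ?x gs ! b)" .
      have "vertex_val ?C y (length (inputs ?C) + j)
          (apply_bop f (gate_vals ?m ?x gs ! a) (gate_vals ?m ?x gs ! b))"
        by (rule vertex_val.gate[of j ?C f a b]) (use j g ab less.IH in auto)
      then show ?thesis using eq j by simp
    qed
  qed
  show "vertex_val ?C y (outv ?C) (F ?x)"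
    using val[of w] assms(2) by (simp add: realizes_def)
qed

section \<open>Segments of an And-Or path\<close>

definition parity_op :: "nat \<Rightarrow> bop" where
  "parity_op a = (if even a then AND else OR)"

lemma parity_op_Suc: "parity_op (Suc a) = dual_bop (parity_op a)"
  by (simp add: parity_op_def)

text \<open>The value \<open>odd a\<close> of the empty segment is neutral for the operation of the
  preceding position, so it can close a path there.\<close>

primrec segment_val :: "(nat \<Rightarrow> bool) \<Rightarrow> nat \<Rightarrow> nat \<Rightarrow> bool" where
  "segment_val x 0 a = odd a"
| "segment_val x (Suc n) a = apply_bop (parity_op a) (x a) (segment_val x n (Suc a))"

text \<open>
  The value of a path is decided by the first position at which a conjunct is false or a disjunct
  is true.
\<close>

definition decisive :: "(nat \<Rightarrow> bool) \<Rightarrow> nat \<Rightarrow> bool" where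
  "decisive x u \<longleftrightarrow> x u = odd u"

definition agg :: "nat \<Rightarrow> nat set \<Rightarrow> (nat \<Rightarrow> bool) \<Rightarrow> bool" where
  "agg p X x = (if even p then \<forall>u\<in>X. x u else \<exists>u\<in>X. x u)"

lemma and_or_path_segment:
  assumes "ts \<noteq> []"
  shows "and_or_path (map y ts) = segment_val (\<lambda>i. y (ts ! i)) (length ts) 0"
proof -
  have *: "alternating_path (parity_op a) (map x [a..<a + Suc n]) = segment_val x (Suc n) a"
    for x :: "nat \<Rightarrow> bool" and a n
  proof (induction n arbitrary: a)
    case 0
    then show ?case by (simp add: parity_op_def)
  next
    case (Suc n)
    have l: "[a..<a + Suc (Suc n)] = a # Suc a # [Suc (Suc a)..<a + Suc (Suc n)]"
      using upt_conv_Cons[of a "a + Suc (Suc n)"] upt_conv_Cons[of "Suc a" "a + Suc (Suc n)"] by simp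
    have r: "[Suc a..<Suc a + Suc n] = Suc a # [Suc (Suc a)..<a + Suc (Suc n)]"
      using upt_conv_Cons[of "Suc a" "a + Suc (Suc n)"] by simp
    have "alternating_path (parity_op a) (map x [a..<a + Suc (Suc n)]) =
        apply_bop (parity_op a) (x a)
          (alternating_path (parity_op (Suc a)) (map x [Suc a..<Suc a + Suc n]))"
      unfolding l r by (simp only: list.map alternating_path.simps parity_op_Suc)
    then show ?case
      unfolding Suc[of "Suc a"] by (simp only: segment_val.simps(2)[of x "Suc n"])
  qed
  have "map (\<lambda>i. y (ts ! i)) [0..<length ts] = map y ts"
    by (rule nth_equalityI) simp_all
  moreover obtain n where n: "length ts = Suc n"
    using assms by (cases ts) auto
  ultimately show ?thesis
    using *[of 0 "\<lambda>i. y (ts ! i)" n] by (simp del: segment_val.simps add: and_or_path_def parity_op_def)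
qed

text \<open>An indecisive position carries the neutral value of its own operation and passes on what
  follows.\<close>

lemma segment_val_indecisive:
  "\<forall>u\<in>{a..<a + n}. \<not> decisive x u \<Longrightarrow> segment_val x (n + k) a = segment_val x k (a + n)"
proof (induction n arbitrary: a)
  case (Suc n)
  then have "segment_val x (n + k) (Suc a) = segment_val x k (Suc a + n)" by simp
  moreover have "\<not> decisive x a" using Suc.prems by simp
  ultimately show ?case by (auto simp: parity_op_def decisive_def)
qed simp

text \<open>A decisive position carries the absorbing value of its operation, so nothing behind it
  matters.\<close>

lemma segment_val_decisive:
  "u \<in> {a..<a + n} \<Longrightarrow> decisive x u \<Longrightarrow> segment_val x (n + k) a = segment_val x n a"
proof (induction n arbitrary: a)
  case (Suc n)
  show ?case
  proof (cases "u = a")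
    case True
    then have "x a = odd a" using Suc.prems(2) by (simp add: decisive_def)
    then show ?thesis by (cases "even a") (simp_all add: parity_op_def)
  next
    case False
    then show ?thesis using Suc.IH[of "Suc a"] Suc.prems by simp
  qed
qed simp

text \<open>The value of a decided path is \<open>odd w\<close> for its first decisive position
  \<open>w\<close>, and \<open>odd w = even c\<close> says that \<open>w + c\<close> is odd. The
  existence of \<open>u\<close> excludes that the value stems from the empty segment.\<close>

lemma segment_val_decided:
  "segment_val x n a = even c \<Longrightarrow> u \<in> {a..<a + n} \<Longrightarrow> decisive x u \<Longrightarrow>
     \<exists>w\<in>{a..<a + n}. odd (w + c) \<and> decisive x w"
proof (induction n arbitrary: a)
  case (Suc n)
  show ?case
  proof (cases "decisive x a")
    case True
    then have "odd (a + c)" using Suc.prems by (auto simp: parity_op_def decisive_def split: if_splits)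
    with True show ?thesis by (intro bexI[of _ a]) auto
  next
    case False
    then have "u \<in> {Suc a..<Suc a + n}" using Suc.prems by (cases "u = a") auto
    moreover have "segment_val x n (Suc a) = even c"
      using False Suc.prems(1) by (auto simp: parity_op_def decisive_def split: if_splits)
    ultimately obtain w where "w\<in>{Suc a..<Suc a + n}" "odd (w + c)" "decisive x w"
      using Suc.IH Suc.prems(3) by blast
    then show ?thesis by (intro bexI[of _ w]) auto
  qed
qed simp

text \<open>
  The recursion step: a prefix of odd length is joined with a value that is the right one if the
  prefix is undecided and is neutral if the prefix contains a decisive position of the other parity.
\<close>

lemma segment_val_join:
  assumes "odd n"
    and "\<forall>u\<in>{a..<a + n}. \<not> decisive x u \<Longrightarrow> R = segment_val x k (a + n)"
    and "\<exists>u\<in>{a..<a + n}. odd (u + a) \<and> decisive x u \<Longrightarrow> R = even a"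
  shows "apply_bop (parity_op a) (segment_val x n a) R = segment_val x (n + k) a"
proof (cases "\<forall>u\<in>{a..<a + n}. \<not> decisive x u")
  case True
  \<comment> \<open>Here the odd length enters: the undecided prefix has the value
    \<open>odd (a + n)\<close>, which is \<open>even a\<close> and hence neutral for the operation
    at \<open>a\<close>.\<close>
  have "segment_val x n a = even a"
    using segment_val_indecisive[OF True, of 0] assms(1) by auto
  moreover have "R = segment_val x (n + k) a"
    using segment_val_indecisive[OF True, of k] assms(2)[OF True] by simp
  ultimately show ?thesis by (auto simp: parity_op_def)
next
  case False
  then obtain u where u: "u \<in> {a..<a + n}" "decisive x u" by auto
  have eq: "segment_val x (n + k) a = segment_val x n a" by (rule segment_val_decisive[OF u])
  show ?thesis
  \<comment> \<open>A decided prefix with the neutral value owes it to a decisive position of the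
    other parity, so \<open>R\<close> is neutral as well. Any other value is absorbing and hides
    \<open>R\<close>.\<close>
  proof (cases "segment_val x n a = even a")
    case True
    then have "R = even a" using segment_val_decided[OF True u] assms(3) by blast
    then show ?thesis using True eq by (auto simp: parity_op_def)
  next
    case False
    then show ?thesis using eq by (auto simp: parity_op_def)
  qed
qed

lemma agg_Un: "apply_bop (parity_op p) (agg p X x) (agg p Y x) = agg p (X \<union> Y) x"
  by (auto simp: agg_def parity_op_def)

text \<open>Evaluation at the indicator function of a set, or of its complement for disjunctions,
  recovers the set.\<close>

lemma agg_inj: "agg p X = agg p Y \<Longrightarrow> X = Y"
proof -
  assume eq: "agg p X = agg p Y"
  show ?thesis
  proof (cases "even p")
    case True
    then show ?thesis
      using fun_cong[OF eq, of "\<lambda>u. u \<in> X"] fun_cong[OF eq, of "\<lambda>u. u \<in> Y"]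
      by (auto simp: agg_def)
  next
    case False
    then show ?thesis
      using fun_cong[OF eq, of "\<lambda>u. u \<notin> X"] fun_cong[OF eq, of "\<lambda>u. u \<notin> Y"]
      by (auto simp: agg_def)
  qed
qed

lemma agg_decisive:
  assumes "u \<in> X" "\<forall>u\<in>X. even u = even p" "decisive x u"
  shows "agg p X x = odd p"
  using assms by (auto simp: agg_def decisive_def)

lemma agg_indecisive:
  assumes "\<forall>u\<in>X. even u = even p \<and> \<not> decisive x u" "X \<noteq> {}"
  shows "agg p X x = even p"
  using assms by (auto simp: agg_def decisive_def)

section \<open>Slot lengths\<close>

text \<open>
  The signal of slot i covers the positions of one parity among the slot_pre i previous ones. As it
  reaches 3 * 2 ^ (h - 1) positions at depth h + 1, the level h is increased as soon as slot_pre i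
  exceeds 3 * 2 ^ h. The signal occupies slot h + 1 of the new segment, whence the recurrence for the
  length. The table contains slot_pre and the current level in its first two components.
\<close>

primrec slot_table :: "nat \<Rightarrow> nat \<times> nat \<times> (nat \<Rightarrow> nat) \<times> (nat \<Rightarrow> nat)" where
  "slot_table 0 = (12, 1, \<lambda>i. if i = 0 then 0 else if i = 4 then 6 else 2,
     \<lambda>i. if i \<le> 2 then 0 else 1)"
| "slot_table (Suc n) = (case slot_table n of (S, h, r, l) \<Rightarrow>
     let h' = (if 3 * 2 ^ h < S then Suc h else h); k = S - r (Suc h')
     in (S + k, h', r(n + 5 := k), l(n + 5 := h')))"

definition slot_len :: "nat \<Rightarrow> nat" where
  "slot_len i = fst (snd (snd (slot_table (i - 4)))) i"

definition slot_lev :: "nat \<Rightarrow> nat" where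
  "slot_lev i = snd (snd (snd (slot_table (i - 4)))) i"

definition slot_pre :: "nat \<Rightarrow> nat" where
  "slot_pre i = (\<Sum>x<i. slot_len x)"

text \<open>Slot lengths are even, which keeps the prefix before every slot odd. The slot that ends
  a segment is free of this restriction and may take one position more; in the slots 1, 2 and 4 the
  capacity is even and already exhausted by \<open>slot_len\<close>.\<close>

definition slot_cap :: "nat \<Rightarrow> nat" where
  "slot_cap i = (if i = 1 \<or> i = 2 \<or> i = 4 then slot_len i else Suc (slot_len i))"

lemma slot_pre_Suc [simp]: "slot_pre (Suc i) = slot_pre i + slot_len i"
  by (simp add: slot_pre_def)

text \<open>The recurrence starts at slot 5. It would give only 4 for slot 4, but there the last
  inner slot 3 may use its odd capacity 3, which makes 1 + 2 + 3 positions.\<close>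

lemma slot_base [simp]:
  "slot_len 0 = 0" "slot_len (Suc 0) = 2" "slot_len 2 = 2" "slot_len 3 = 2" "slot_len 4 = 6"
  "slot_lev 0 = 0" "slot_lev (Suc 0) = 0" "slot_lev 2 = 0" "slot_lev 3 = 1" "slot_lev 4 = 1"
  "slot_pre 0 = 0" "slot_pre (Suc 0) = 0" "slot_pre 2 = 2" "slot_pre 3 = 4" "slot_pre 4 = 6"
  "slot_pre 5 = 12"
  by (simp_all add: slot_len_def slot_lev_def slot_pre_def eval_nat_numeral)

lemma slot_cap_base [simp]:
  "slot_cap 0 = 1" "slot_cap (Suc 0) = 2" "slot_cap 2 = 2" "slot_cap 3 = 3" "slot_cap 4 = 6"
  by (simp_all add: slot_cap_def)

lemma nat_le_4_cases: "i \<le> 4 \<Longrightarrow> i = 0 \<or> i = Suc 0 \<or> i = 2 \<or> i = 3 \<or> i = (4::nat)"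
  by auto

text \<open>Entries are never overwritten, so a later table agrees with the value at the time of
  writing, by which \<open>slot_len\<close> and \<open>slot_lev\<close> are defined.\<close>

lemma slot_table_correct:
  "case slot_table n of (S, h, r, l) \<Rightarrow>
     S = slot_pre (n + 5) \<and> h = slot_lev (n + 4) \<and> h \<le> n + 1 \<and>
     (\<forall>x<n + 5. r x = slot_len x \<and> l x = slot_lev x)"
proof (induction n)
  case 0
  have "(if x = 0 then 0 else if x = 4 then 6 else 2) = slot_len x \<and>
      (if x \<le> 2 then 0 else 1) = slot_lev x" if "x < 5" for x
  proof -
    from that have "x \<le> 4" by simp
    from nat_le_4_cases[OF this] show ?thesis by (elim disjE) simp_all
  qed
  then show ?case by simp
next
  case (Suc n)
  obtain S h r l where t: "slot_table n = (S, h, r, l)" by (metis prod_cases4)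
  define h' where "h' = (if 3 * 2 ^ h < S then Suc h else h)"
  define k where "k = S - r (Suc h')"
  have t': "slot_table (Suc n) = (S + k, h', r(n + 5 := k), l(n + 5 := h'))"
    by (simp add: t h'_def k_def Let_def)
  have "slot_len (n + 5) = k" "slot_lev (n + 5) = h'"
    using t' by (simp_all add: slot_len_def slot_lev_def)
  then show ?case
    using Suc t t' slot_pre_Suc[of "n + 5"] by (auto simp: h'_def less_Suc_eq add.commute[of 5])
qed

lemma slot_lev_rec:
  assumes "4 \<le> i"
  shows "slot_lev (Suc i) =
    (if 3 * 2 ^ slot_lev i < slot_pre (Suc i) then Suc (slot_lev i) else slot_lev i)"
    and "slot_len (Suc i) = slot_pre (Suc i) - slot_len (Suc (slot_lev (Suc i)))"
    and "slot_lev (Suc i) \<le> i - 2"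
proof -
  define n where "n = i - 4"
  have i: "i = n + 4" using assms by (simp add: n_def)
  obtain S h r l where t: "slot_table n = (S, h, r, l)" by (metis prod_cases4)
  define h' where "h' = (if 3 * 2 ^ h < S then Suc h else h)"
  have t': "slot_table (Suc n) = (S + (S - r (Suc h')), h', r(n + 5 := S - r (Suc h')), l(n + 5 := h'))"
    by (simp add: t h'_def Let_def)
  have s: "Suc i = n + 5" "Suc i - 4 = Suc n" using i by simp_all
  have l: "slot_lev (Suc i) = h'" and r: "slot_len (Suc i) = S - r (Suc h')"
    using t' s by (simp_all add: slot_len_def slot_lev_def)
  have c: "S = slot_pre (Suc i)" "h = slot_lev i" "h \<le> n + 1"
      "\<forall>x<n + 5. r x = slot_len x \<and> l x = slot_lev x"
    using slot_table_correct[of n] t i by (simp_all add: eval_nat_numeral)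
  show 1: "slot_lev (Suc i) =
    (if 3 * 2 ^ slot_lev i < slot_pre (Suc i) then Suc (slot_lev i) else slot_lev i)"
    using l c by (simp add: h'_def)
  show 3: "slot_lev (Suc i) \<le> i - 2" using l c i by (simp add: h'_def)
  show "slot_len (Suc i) = slot_pre (Suc i) - slot_len (Suc (slot_lev (Suc i)))"
    using r c(1) c(4) l 3 i by simp
qed

lemma slot_lev_le: "4 \<le> i \<Longrightarrow> slot_lev i \<le> i - 3"
proof (cases "i = 4")
  case False
  assume "4 \<le> i"
  with False obtain k where "i = Suc k" "4 \<le> k" by (cases i) auto
  then show ?thesis using slot_lev_rec(3)[of k] by simp
qed simp

lemma slot_len_rec:
  assumes "5 \<le> i"
  shows "slot_len i = slot_pre i - slot_len (Suc (slot_lev i))" "Suc (slot_lev i) \<le> i - 2"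
proof -
  from assms obtain k where "i = Suc k" "4 \<le> k" by (cases i) auto
  then show "slot_len i = slot_pre i - slot_len (Suc (slot_lev i))" "Suc (slot_lev i) \<le> i - 2"
    using slot_lev_rec(2)[of k] slot_lev_le[of i] by auto
qed

lemma slot_lev_step: "slot_lev i \<le> slot_lev (Suc i)" "slot_lev (Suc i) \<le> Suc (slot_lev i)"
proof -
  have "slot_lev i \<le> slot_lev (Suc i) \<and> slot_lev (Suc i) \<le> Suc (slot_lev i)"
  proof (cases "4 \<le> i")
    case True
    then show ?thesis using slot_lev_rec(1)[of i] by auto
  next
    case False
    then have "i = 0 \<or> i = 1 \<or> i = 2 \<or> i = 3" by auto
    moreover have "slot_lev (Suc 0) = 0" "slot_lev (Suc 1) = 0" "slot_lev (Suc 2) = 1"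
        "slot_lev (Suc 3) = 1"
      using slot_base by (simp_all add: numeral_2_eq_2 numeral_3_eq_3 eval_nat_numeral)
    ultimately show ?thesis by auto
  qed
  then show "slot_lev i \<le> slot_lev (Suc i)" "slot_lev (Suc i) \<le> Suc (slot_lev i)" by auto
qed

lemma slot_len_le_pre: "2 \<le> i \<Longrightarrow> slot_len i \<le> slot_pre i"
proof (cases "5 \<le> i")
  case False
  assume "2 \<le> i"
  with False have "i = 2 \<or> i = 3 \<or> i = 4" by auto
  then show ?thesis by auto
qed (simp add: slot_len_rec(1))

text \<open>Raising the level by one per slot is enough because \<open>slot_pre\<close> at most
  doubles.\<close>

lemma slot_pre_le_lev: "2 \<le> i \<Longrightarrow> slot_pre i \<le> 3 * 2 ^ slot_lev i"
proof (induction i rule: dec_induct)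
  case (step i)
  show ?case
  proof (cases "4 \<le> i")
    case True
    then have "slot_pre (Suc i) \<le> 2 * (3 * 2 ^ slot_lev i)"
      using slot_len_le_pre[of i] step.IH by simp
    then show ?thesis using slot_lev_rec(1)[OF True] by auto
  next
    case False
    then have "Suc i = 3 \<or> Suc i = 4" using step.hyps by auto
    then show ?thesis by (elim disjE) (simp_all del: slot_pre_Suc)
  qed
qed simp

lemma slot_len_even: "even (slot_len i)"
proof (induction i rule: less_induct)
  case (less i)
  show ?case
  proof (cases "5 \<le> i")
    case True
    have "even (slot_pre i)"
      unfolding slot_pre_def by (rule dvd_sum) (use less in auto)
    moreover have "even (slot_len (Suc (slot_lev i)))"
      using less[of "Suc (slot_lev i)"] slot_len_rec(2)[OF True] True by simp
    ultimately show ?thesis using slot_len_rec(1)[OF True] by simp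
  next
    case False
    then show ?thesis using nat_le_4_cases[of i] by auto
  qed
qed

lemma slot_pre_mono: "i \<le> k \<Longrightarrow> slot_pre i \<le> slot_pre k"
  unfolding slot_pre_def by (rule sum_mono2) auto

text \<open>The slot lost to the signal has index at most \<open>i - 2\<close>, so its length is
  already contained in \<open>slot_pre (i - 1)\<close>.\<close>

lemma slot_len_ge_prev: "5 \<le> i \<Longrightarrow> slot_len (i - 1) \<le> slot_len i"
proof -
  assume i: "5 \<le> i"
  let ?j = "Suc (slot_lev i)"
  have "slot_pre (Suc ?j) \<le> slot_pre (i - 1)"
    by (rule slot_pre_mono) (use slot_len_rec(2)[OF i] i in auto)
  moreover have "slot_pre i = slot_pre (i - 1) + slot_len (i - 1)"
    using slot_pre_Suc[of "i - 1"] i by simp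
  ultimately show ?thesis unfolding slot_len_rec(1)[OF i] slot_pre_Suc by arith
qed

lemma slot_len_ge_6: "4 \<le> i \<Longrightarrow> 6 \<le> slot_len i"
proof (induction i rule: dec_induct)
  case (step i)
  then show ?case using slot_len_ge_prev[of "Suc i"] by simp
qed simp

lemma slot_len_pos: "0 < i \<Longrightarrow> 2 \<le> slot_len i"
  using slot_len_ge_6[of i] nat_le_4_cases[of i] by fastforce

text \<open>The level rises only when the old bound is exceeded, so \<open>slot_pre_le_lev\<close>
  is tight up to a factor of 2.\<close>

lemma slot_lev_min: "5 \<le> i \<Longrightarrow> 3 * 2 ^ slot_lev i < 2 * slot_pre i"
proof (induction i rule: dec_induct)
  case base
  show ?case using slot_lev_rec(1)[of 4] by simp
next
  case (step i)
  then show ?case using slot_lev_rec(1)[of i] by auto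
qed

lemma slot_len_pre: "5 \<le> i \<Longrightarrow> slot_len i + slot_len (Suc (slot_lev i)) = slot_pre i"
proof -
  assume i: "5 \<le> i"
  have "slot_pre (Suc (Suc (slot_lev i))) \<le> slot_pre i"
    by (rule slot_pre_mono) (use slot_len_rec(2)[OF i] i in auto)
  then show ?thesis using slot_len_rec(1)[OF i] by simp
qed

lemma slot_cap_bounds: "slot_len i \<le> slot_cap i" "slot_cap i \<le> Suc (slot_len i)"
  by (auto simp: slot_cap_def)

section \<open>Capacities\<close>

text \<open>
  The number of positions that k slots from slot i on can take; slot J is occupied by the
  pending signal, if J is positive.
\<close>

primrec room :: "nat \<Rightarrow> nat \<Rightarrow> nat \<Rightarrow> nat" where
  "room 0 i J = 0"
| "room (Suc k) i J =
     (if 0 < J \<and> i = J then room k (Suc i) 0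
      else max (slot_cap i) (slot_len i + room k (Suc i) J))"

lemma room_ge:
  "slot_pre (i + k) \<le>
     slot_pre i + room k i J + (if 0 < J \<and> i \<le> J \<and> J < i + k then slot_len J else 0)"
proof (induction k arbitrary: i J)
  case (Suc k)
  show ?case
  proof (cases "0 < J \<and> i = J")
    case True
    then show ?thesis using Suc[of "Suc i" 0] by auto
  next
    case False
    then show ?thesis using Suc[of "Suc i" J] by (auto simp: le_max_iff_disj split: if_splits)
  qed
qed simp

lemma room_step:
  "0 < k \<Longrightarrow> room k i J =
     (if 0 < J \<and> i = J then room (k - 1) (i + 1) 0
      else max (slot_cap i) (slot_len i + room (k - 1) (i + 1) J))"
  by (cases k) simp_all

lemma room_numerals [simp]:
  "room (Suc 0) 0 0 = 1" "room 2 0 0 = 2" "room 3 0 0 = 4" "room 4 0 0 = 7"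
  "room 2 0 (Suc 0) = 1" "room 3 0 2 = 2" "room 4 0 2 = 5"
  by (simp_all add: room_step numeral_2_eq_2[symmetric])

text \<open>The segment in slot \<open>i\<close> has depth \<open>i\<close>, hence the inner slots
  below \<open>i\<close>, one of which goes to the signal. Its first position is the initial
  accumulated value and takes no slot, which explains the \<open>Suc\<close>. The recurrence for
  \<open>slot_len\<close> is made for this inequality.\<close>

lemma slot_cap_le_room: "2 \<le> i \<Longrightarrow> slot_cap i \<le> Suc (room i 0 (Suc (slot_lev i)))"
proof (cases "5 \<le> i")
  case True
  then have "slot_cap i = Suc (slot_len i)" by (simp add: slot_cap_def)
  moreover have "Suc (slot_lev i) < i" using slot_len_rec(2)[OF True] True by simp
  ultimately show ?thesis
    using room_ge[of 0 i "Suc (slot_lev i)"] slot_len_pre[OF True] by simp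
next
  case False
  assume "2 \<le> i"
  with False have "i = 2 \<or> i = 3 \<or> i = 4" by auto
  then show ?thesis by (elim disjE) (simp_all add: numeral_2_eq_2[symmetric])
qed

section \<open>The number of gates outside the shared trees\<close>

text \<open>The cases mirror the moves of the construction, with \<open>n\<close> positions left,
  next slot \<open>i\<close>, and a signal pending for slot \<open>J\<close> unless
  \<open>J = 0\<close>. A slot of \<open>t\<close> positions pays for its signal, for a child whose
  first position is already placed, and for the joining gate.\<close>

function slot_cost :: "nat \<Rightarrow> nat \<Rightarrow> nat \<Rightarrow> nat" where
  "slot_cost i n J =
     (if 0 < J \<and> (n = 0 \<or> J \<le> i) then Suc (slot_cost (Suc i) n 0)
      else if n = 0 then 0
      else if i < 2 then
        (if n = 1 then Suc (slot_cost (Suc i) 0 J) else 2 + slot_cost 2 (n - 2) J)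
      else
        (let t = (if n \<le> slot_cap i then n else slot_len i)
         in slot_lev i + slot_cost 0 (t - 1) (Suc (slot_lev i)) + 1 + slot_cost (Suc i) (n - t) J))"
  by pat_completeness auto
termination
proof (relation "measure (\<lambda>(i, n, J). 2 * n + (if 0 < J then 1 else 0))", goal_cases)
  case (5 i n J t)
  then have "0 < t" "t \<le> n" using slot_len_pos[of i] slot_cap_bounds(1)[of i] by (auto split: if_splits)
  then show ?case by auto
next
  case (6 i n J t)
  then have "0 < t" "t \<le> n" using slot_len_pos[of i] slot_cap_bounds(1)[of i] by (auto split: if_splits)
  then show ?case by auto
qed auto

declare slot_cost.simps [simp del]

lemma slot_cost_0: "slot_cost i 0 J = (if 0 < J then 1 else 0)"
  by (simp add: slot_cost.simps[of i 0 J] slot_cost.simps[of "Suc i" 0 0])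

text \<open>Counted in thirds of a gate. The values for slots 2 and 3 are the exact savings. From
  slot 5 on, 8 per slot beats the growth by 6 per slot of the bounds on the two signals to be
  paid.\<close>

definition slot_gain :: "nat \<Rightarrow> nat" where
  "slot_gain i = (if i = 2 then 7 else if i = 3 then 4 else if i = 4 then 15 else 8)"

text \<open>
  A filled slot saves its gain compared with the rate of 8/3 gates per position. The gains pay for
  the signal of the last slot used, which may contain a single position only.
\<close>

lemma slot_gain_sum:
  assumes "6 \<le> i"
  shows "8 * i \<le> sum slot_gain ({2..<i - 1} - {J}) + 37"
proof -
  have "sum slot_gain {2..<i - 1} + 22 = 8 * i"
    using assms
  proof (induction i rule: dec_induct)
    case base
    have "{2..<6 - 1} = {2, 3, 4 :: nat}" by auto
    then show ?case by (simp add: slot_gain_def)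
  next
    case (step i)
    then have "{2..<Suc i - 1} = insert (i - 1) {2..<i - 1}" by auto
    moreover have "slot_gain (i - 1) = 8" using step.hyps by (auto simp: slot_gain_def)
    ultimately show ?case using step by simp
  qed
  moreover have "sum slot_gain {2..<i - 1} \<le> sum slot_gain ({2..<i - 1} - {J}) + slot_gain J"
    by (cases "J \<in> {2..<i - 1}") (simp_all add: sum.remove)
  moreover have "slot_gain J \<le> 15" by (simp add: slot_gain_def)
  ultimately show ?thesis by linarith
qed

lemma slot_lev_5 [simp]: "slot_lev 5 = 2"
  using slot_lev_rec(1)[of 4] by simp

text \<open>Three claims proved together. A is the rate itself, with 3 for joining a pending signal.
  B collects the gains of the filled slots before \<open>q\<close> and leaves the signal of slot
  \<open>q\<close> unpaid. C says that a filled slot has its gain to spare: \<open>8 * n + 5\<close>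
  is 8 for each of its \<open>n + 1\<close> positions less 3 for the joining gate.\<close>

lemma slot_cost_bounds:
  "(\<forall>i J. i < 2 \<and> (J = 0 \<or> i < J) \<and> (J \<noteq> 1 \<or> n \<le> 1) \<longrightarrow>
      3 * slot_cost i n J \<le> 8 * n + (if 0 < J then 3 else 0)) \<and>
   (\<forall>i q J. 2 \<le> i \<and> i \<le> q \<and> q \<noteq> J \<and> (J = 0 \<or> i \<le> J) \<and>
      ({i..<q} - {J} = {} \<or> sum slot_len ({i..<q} - {J}) + 2 \<le> n) \<longrightarrow>
      3 * slot_cost i n J + sum slot_gain ({i..<q} - {J}) \<le>
        8 * n + (if 0 < J then 3 else 0) + 3 * slot_lev q) \<and>
   (\<forall>i. 2 \<le> i \<and> n = slot_len i - 1 \<longrightarrow>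
      3 * slot_cost 0 n (Suc (slot_lev i)) + slot_gain i + 3 * slot_lev i \<le> 8 * n + 5)"
  (is "?A n \<and> ?B n \<and> ?C n")
proof (induction n rule: less_induct)
  case (less n)
  have IHA: "3 * slot_cost i k J \<le> 8 * k + (if 0 < J then 3 else 0)"
    if "k < n" "i < 2" "J = 0 \<or> i < J" "J \<noteq> 1 \<or> k \<le> 1" for i k J
    using less[OF that(1), THEN conjunct1, rule_format, of i J] that(2-) by simp
  have IHB: "3 * slot_cost i k J + sum slot_gain ({i..<q} - {J}) \<le>
        8 * k + (if 0 < J then 3 else 0) + 3 * slot_lev q"
    if "k < n" "2 \<le> i" "i \<le> q" "q \<noteq> J" "J = 0 \<or> i \<le> J"
      "{i..<q} - {J} = {} \<or> sum slot_len ({i..<q} - {J}) + 2 \<le> k" for i k J q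
    using less[OF that(1), THEN conjunct2, THEN conjunct1, rule_format, of i q J] that(2-) by argo
  have IHC: "3 * slot_cost 0 k (Suc (slot_lev i)) + slot_gain i + 3 * slot_lev i \<le> 8 * k + 5"
    if "k < n" "2 \<le> i" "k = slot_len i - 1" for i k
    using less[OF that(1), THEN conjunct2, THEN conjunct2, rule_format, of i] that(2-) by simp
  have A: "?A n"
  proof (intro allI impI, elim conjE)
    fix i J :: nat assume i: "i < 2" "J = 0 \<or> i < J" "J \<noteq> 1 \<or> n \<le> 1"
    consider "n = 0" | "n = 1" | "2 \<le> n" by linarith
    then show "3 * slot_cost i n J \<le> 8 * n + (if 0 < J then 3 else 0)"
    proof cases
      case 1
      then show ?thesis by (simp add: slot_cost_0)
    next
      case 2
      then have "slot_cost i n J = Suc (if 0 < J then 1 else 0)"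
        using i by (subst slot_cost.simps) (auto simp: slot_cost_0)
      then show ?thesis using 2 by simp
    next
      case 3
      have "3 * slot_cost 2 (n - 2) J \<le> 8 * (n - 2) + (if 0 < J then 3 else 0) + 3"
      \<comment> \<open>If the signal takes slot 2, the next usable slot is 3, whose signal of level
        1 costs 3. The pair can afford this: it saves 10.\<close>
      proof (cases "J = 2")
        case True
        then have "{2..<3} - {J} = {}" by auto
        then show ?thesis using IHB[of "n - 2" 2 3 J] 3 True by simp
      next
        case False
        have J: "J = 0 \<or> 2 \<le> J" using 3 i(2,3) by linarith
        have "n - 2 < n" using 3 by simp
        from IHB[OF this order_refl order_refl _ J] False
        have "3 * slot_cost 2 (n - 2) J \<le> 8 * (n - 2) + (if 0 < J then 3 else 0)"
          by (simp only: atLeastLessThan_empty[OF order_refl] empty_Diff sum.empty simp_thms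
              slot_base mult_0_right add_0_right)
        then show ?thesis by linarith
      qed
      moreover have "slot_cost i n J = 2 + slot_cost 2 (n - 2) J"
        using i 3 by (subst slot_cost.simps) auto
      ultimately show ?thesis using 3 by auto
    qed
  qed
  have child: "3 * slot_cost 0 (n - 1) (Suc (slot_lev i)) \<le> 8 * (n - 1) + 3"
    if "2 \<le> i" "0 < n" "n \<le> slot_cap i" for i
  proof (cases "i = 2")
    case True
    then show ?thesis using IHA[of "n - 1" 0 "Suc (slot_lev i)"] that by simp
  next
    case False
    have "slot_lev 3 \<le> slot_lev i"
      by (rule lift_Suc_mono_le[of slot_lev]) (use slot_lev_step that False in auto)
    then show ?thesis using IHA[of "n - 1" 0 "Suc (slot_lev i)"] that by simp
  qed
  have B': "3 * slot_cost i n J + sum slot_gain ({i..<q} - {J}) \<le>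
        8 * n + (if 0 < J then 3 else 0) + 3 * slot_lev q"
    if i: "2 \<le> i" "i \<le> q" "q \<noteq> J" "J = 0 \<or> i < J" "0 < n"
      and reach: "{i..<q} - {J} = {} \<or> sum slot_len ({i..<q} - {J}) + 2 \<le> n" for i q J
  proof (cases "n \<le> slot_cap i")
    case True
    have "q = i"
    proof (rule ccontr)
      assume "q \<noteq> i"
      then have *: "i \<in> {i..<q} - {J}" using i by auto
      then have "slot_len i \<le> sum slot_len ({i..<q} - {J})" by (intro member_le_sum) auto
      then show False using reach * True slot_cap_bounds(2)[of i] by auto
    qed
    moreover have "slot_cost i n J =
        slot_lev i + slot_cost 0 (n - 1) (Suc (slot_lev i)) + 1 + (if 0 < J then 1 else 0)"
      using i True by (subst slot_cost.simps) (auto simp: slot_cost_0)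
    ultimately show ?thesis using child[of i] i True by auto
  next
    case False
    then have n: "slot_len i < n" using slot_cap_bounds(1)[of i] by simp
    have len: "2 \<le> slot_len i" using slot_len_pos[of i] i by simp
    have eq: "slot_cost i n J =
        slot_lev i + slot_cost 0 (slot_len i - 1) (Suc (slot_lev i)) + 1 +
          slot_cost (Suc i) (n - slot_len i) J"
      using i False by (subst slot_cost.simps) (auto simp: Let_def)
    have full: "3 * slot_cost 0 (slot_len i - 1) (Suc (slot_lev i)) + slot_gain i + 3 * slot_lev i
        \<le> 8 * (slot_len i - 1) + 5"
      using IHC[of "slot_len i - 1" i] n i by simp
    have "3 * slot_cost (Suc i) (n - slot_len i) J + sum slot_gain ({i..<q} - {J}) \<le>
        8 * (n - slot_len i) + (if 0 < J then 3 else 0) + 3 * slot_lev q + slot_gain i"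
    proof (cases "q = i")
      case True
      \<comment> \<open>No gain is claimed in this case, so the gain of slot \<open>i\<close> can
        pay for the signal of the next slot not taken by \<open>J\<close>.\<close>
      define q' where "q' = (if J = Suc i then Suc (Suc i) else Suc i)"
      have e: "{Suc i..<q'} - {J} = {}" by (auto simp: q'_def)
      have "3 * slot_cost (Suc i) (n - slot_len i) J \<le>
          8 * (n - slot_len i) + (if 0 < J then 3 else 0) + 3 * slot_lev q'"
        using IHB[of "n - slot_len i" "Suc i" q' J] i n len e by (auto simp: q'_def split: if_splits)
      moreover have "3 * slot_lev q' \<le> 3 * slot_lev i + slot_gain i"
      proof (cases "i = 3")
        case True
        then have "q' = 4 \<or> q' = 5" by (auto simp: q'_def)
        then show ?thesis using True by (auto simp: slot_gain_def)
      next
        case False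
        have "slot_lev q' \<le> slot_lev i + 2"
          using slot_lev_step(2)[of i] slot_lev_step(2)[of "Suc i"] by (simp add: q'_def)
        then show ?thesis using False by (auto simp: slot_gain_def)
      qed
      ultimately show ?thesis using True by simp
    next
      case False
      then have *: "{i..<q} - {J} = insert i ({Suc i..<q} - {J})" using i by auto
      then have s: "sum f ({i..<q} - {J}) = f i + sum f ({Suc i..<q} - {J})" for f :: "nat \<Rightarrow> nat"
        by simp
      have "sum slot_len ({Suc i..<q} - {J}) + 2 \<le> n - slot_len i"
        using reach * s[of slot_len] by auto
      moreover have "n - slot_len i < n" "2 \<le> Suc i" "Suc i \<le> q" "J = 0 \<or> Suc i \<le> J"
        using i n len False by linarith+
      ultimately show ?thesis
        using IHB[of "n - slot_len i" "Suc i" q J] i(3) unfolding s[of slot_gain] by linarith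
    qed
    then show ?thesis using eq full n len by simp
  qed
  have B: "?B n"
  proof (intro allI impI, elim conjE)
    fix i q J :: nat
    assume i: "2 \<le> i" "i \<le> q" "q \<noteq> J" "J = 0 \<or> i \<le> J"
      and reach: "{i..<q} - {J} = {} \<or> sum slot_len ({i..<q} - {J}) + 2 \<le> n"
    consider "n = 0" | "0 < n" "J = 0 \<or> i < J" | "0 < n" "i = J" using i by linarith
    then show "3 * slot_cost i n J + sum slot_gain ({i..<q} - {J}) \<le>
        8 * n + (if 0 < J then 3 else 0) + 3 * slot_lev q"
    proof cases
      case 1
      then have "{i..<q} - {J} = {}" using reach by simp
      then show ?thesis using 1 by (simp only: sum.empty slot_cost_0) simp
    next
      case 2
      then show ?thesis using B'[of i q J] i reach by blast
    next
      case 3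
      have e: "{i..<q} - {J} = {Suc i..<q} - {0}" using 3 by auto
      have "slot_cost i n J = Suc (slot_cost (Suc i) n 0)"
        using 3 i by (subst slot_cost.simps) simp
      then show ?thesis
        using B'[of "Suc i" q 0] 3 i reach unfolding e by simp
    qed
  qed
  have C: "?C n"
  proof (intro allI impI, elim conjE)
    fix i assume i: "2 \<le> i" "n = slot_len i - 1"
    let ?J = "Suc (slot_lev i)"
    show "3 * slot_cost 0 n ?J + slot_gain i + 3 * slot_lev i \<le> 8 * n + 5"
    proof (cases "5 \<le> i")
      case True
      have J: "3 \<le> ?J" "?J \<le> i - 2"
      proof -
        have "slot_lev 5 \<le> slot_lev i"
          by (rule lift_Suc_mono_le[of slot_lev]) (use slot_lev_step True in auto)
        then show "3 \<le> ?J" by simp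
        show "?J \<le> i - 2" using slot_len_rec(2)[OF True] .
      qed
      have len: "6 \<le> slot_len i" "6 \<le> slot_len (i - 1)"
        using slot_len_ge_6[of i] slot_len_ge_6[of "i - 1"] True by simp_all
      \<comment> \<open>The inner slots are the pair, the signal, the filled slots, and the last
        slot \<open>i - 1\<close>. The last one lacks a single position, since the first position of
        the segment takes no slot.\<close>
      have i_eq: "{..<i} =
          insert 0 (insert (Suc 0) (insert ?J (insert (i - 1) ({2..<i - 1} - {?J}))))"
        using True J by auto
      have "0 \<noteq> i - 1" "Suc 0 \<noteq> i - 1" "?J \<noteq> i - 1" "?J \<noteq> Suc 0" using True J by linarith+
      then have "slot_pre i =
          2 + slot_len ?J + slot_len (i - 1) + sum slot_len ({2..<i - 1} - {?J})"
        unfolding slot_pre_def i_eq by simp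
      then have reach: "sum slot_len ({2..<i - 1} - {?J}) + 2 \<le> n - 2"
        using slot_len_pre[OF True] len i by linarith
      have "3 * slot_cost 2 (n - 2) ?J + sum slot_gain ({2..<i - 1} - {?J}) \<le>
          8 * (n - 2) + 3 + 3 * slot_lev (i - 1)"
        using IHB[of "n - 2" 2 "i - 1" ?J] reach J True len i by simp
      moreover have "slot_cost 0 n ?J = 2 + slot_cost 2 (n - 2) ?J"
        using len i by (subst slot_cost.simps) auto
      \<comment> \<open>For \<open>i = 5\<close> only the gain 7 of slot 2 is available. From 6 on
        the levels are at most \<open>i - 3\<close> and \<open>i - 4\<close>, and
        \<open>slot_gain_sum\<close> closes the inequality with equality at 6.\<close>
      moreover have "3 * slot_lev i + 3 * slot_lev (i - 1) \<le> 4 + sum slot_gain ({2..<i - 1} - {?J})"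
      proof (cases "i = 5")
        case True
        then have "{2..<i - 1} - {?J} = {2}" by auto
        then show ?thesis using True by (simp add: slot_gain_def)
      next
        case False
        then have "6 \<le> i" using \<open>5 \<le> i\<close> by simp
        moreover have "slot_lev i \<le> i - 3" "slot_lev (i - 1) \<le> i - 1 - 3"
          using slot_lev_le[of i] slot_lev_le[of "i - 1"] \<open>6 \<le> i\<close> by linarith+
        ultimately show ?thesis
          using slot_gain_sum[of i ?J] by linarith
      qed
      moreover have "slot_gain i = 8" using True by (simp add: slot_gain_def)
      ultimately show ?thesis using len i by linarith
    next
      case False
      then consider "i = 2" | "i = 3" | "i = 4" using i by linarith
      then show ?thesis
      proof cases
        case 1
        then have "slot_cost 0 n ?J = 2"
          using i by (subst slot_cost.simps) (simp add: slot_cost_0)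
        then show ?thesis using 1 i by (simp add: slot_gain_def)
      next
        case 2
        then have "slot_cost 0 n ?J = 2"
          using i by (subst slot_cost.simps) (simp add: slot_cost_0)
        then show ?thesis using 2 i by (simp add: slot_gain_def)
      next
        case 3
        have "slot_cost 0 2 (Suc (Suc 0)) = 3"
          by (subst slot_cost.simps) (simp add: slot_cost_0)
        then have "slot_cost 3 3 0 = 5"
          by (subst slot_cost.simps) (simp add: slot_cost_0)
        moreover have "slot_cost 2 3 2 = Suc (slot_cost 3 3 0)"
          by (subst slot_cost.simps) simp
        moreover have "slot_cost 0 5 2 = 2 + slot_cost 2 3 2"
          by (subst slot_cost.simps) simp
        ultimately show ?thesis using 3 i by (simp add: slot_gain_def numeral_2_eq_2[symmetric])
      qed
    qed
  qed
  show ?case by (intro conjI A B C)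
qed

corollary slot_cost_le: "3 * slot_cost 0 n 0 \<le> 8 * n"
  using slot_cost_bounds[of n, THEN conjunct1, rule_format, of 0 0] by simp

section \<open>Growth of the capacities\<close>

definition growth_ratio :: "nat \<Rightarrow> real" where
  "growth_ratio i = 2 ^ i / slot_pre i"

text \<open>
  The first hundred capacities are computed. The arguments are the number of remaining steps, the
  capacity, three times the power of two of the current level, the slot lengths in reverse order,
  the position of the occupied slot in this list, the power of two of the depth, and the power of
  two below the capacity with its exponent.
\<close>

fun growth_check ::
  "nat \<Rightarrow> int \<Rightarrow> int \<Rightarrow> int list \<Rightarrow> nat \<Rightarrow> int \<Rightarrow> int \<Rightarrow> int \<Rightarrow> bool" where
  "growth_check 0 S t rs k w p e \<longleftrightarrow> 50 * S \<le> w \<and> w \<le> 51 * S"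
| "growth_check (Suc n) S t rs k w p e \<longleftrightarrow>
     (let t' = (if t < S then 2 * t else t);
          k' = (if t < S then k else Suc k);
          r = S - rs ! k';
          S' = S + r;
          b = (2 * p \<le> S')
      in p \<le> S \<and> 51 * w \<le> 40 * S * e \<and>
         (2 ^ 80 \<le> w \<longrightarrow> 8 * w * S \<le> 4 * w * S' + 3 * S * S') \<and>
         growth_check n S' t' (r # rs) k' (2 * w)
           (if b then 2 * p else p) (if b then e + 1 else e))"

text \<open>The check computes with binary numerals of type \<open>int\<close>; the tested
  inequalities are transferred to \<open>nat\<close>. The index \<open>k\<close> stays fixed when
  the level rises, because the list grows by one at the same time, and increases otherwise.\<close>

lemma growth_check_sound:
  assumes "growth_check n (slot_pre (Suc i)) (3 * 2 ^ slot_lev i)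
      (map (\<lambda>x. int (slot_len x)) (rev [0..<Suc i])) (i - 2 - slot_lev i) (2 ^ Suc i) (2 ^ e) (int e)"
    and "4 \<le> i"
  shows "(\<forall>x<n. (\<exists>e. 2 ^ e \<le> slot_pre (Suc i + x) \<and>
              51 * 2 ^ (Suc i + x) \<le> 40 * slot_pre (Suc i + x) * e) \<and>
            (80 \<le> Suc i + x \<longrightarrow> 8 * 2 ^ (Suc i + x) * slot_pre (Suc i + x) \<le>
              4 * 2 ^ (Suc i + x) * slot_pre (Suc (Suc i + x)) +
              3 * slot_pre (Suc i + x) * slot_pre (Suc (Suc i + x)))) \<and>
         50 * slot_pre (Suc i + n) \<le> 2 ^ (Suc i + n) \<and> 2 ^ (Suc i + n) \<le> 51 * slot_pre (Suc i + n)"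
  using assms
proof (induction n arbitrary: i e)
  case 0
  from 0(1) have "int (50 * slot_pre (Suc i)) \<le> int (2 ^ Suc i)"
    "int (2 ^ Suc i) \<le> int (51 * slot_pre (Suc i))" by (simp_all del: slot_pre_Suc)
  then show ?case by (simp only: of_nat_le_iff) simp
next
  case (Suc n)
  let ?S = "slot_pre (Suc i)" and ?rs = "map (\<lambda>x. int (slot_len x)) (rev [0..<Suc i])"
  let ?k = "if 3 * 2 ^ slot_lev i < int ?S then i - 2 - slot_lev i else Suc (i - 2 - slot_lev i)"
  let ?l = "slot_lev (Suc i)"
  have inc: "(3 * 2 ^ slot_lev i < int ?S) = (3 * 2 ^ slot_lev i < ?S)"
    using of_nat_less_iff[of "3 * 2 ^ slot_lev i" ?S, where ?'a = int] by (simp del: slot_pre_Suc)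
  have l: "?l = (if 3 * 2 ^ slot_lev i < ?S then Suc (slot_lev i) else slot_lev i)"
    and l_le: "?l \<le> i - 2" "slot_lev i \<le> i - 3"
    using slot_lev_rec[OF Suc.prems(2)] slot_lev_le[OF Suc.prems(2)] by simp_all
  have k: "?k = i - 1 - ?l"
  proof (cases "3 * 2 ^ slot_lev i < ?S")
    case True
    then show ?thesis using l unfolding inc by simp
  next
    case False
    then have "?k = Suc (i - 2 - slot_lev i)" "?l = slot_lev i" using l unfolding inc by simp_all
    then show ?thesis using l_le(2) Suc.prems(2) by linarith
  qed
  have nth: "?rs ! ?k = slot_len (Suc ?l)"
  proof -
    have "?k < Suc i" using k by simp
    then have "?rs ! ?k = slot_len (i - ?k)" by (simp add: rev_nth del: upt_Suc)
    also have "i - ?k = Suc ?l" using k l_le Suc.prems(2) by simp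
    finally show ?thesis .
  qed
  have r: "int ?S - ?rs ! ?k = slot_len (Suc i)"
    using slot_len_pre[of "Suc i"] Suc.prems(2) unfolding nth by simp
  have S': "int ?S + slot_len (Suc i) = slot_pre (Suc (Suc i))" by simp
  have t': "(if 3 * 2 ^ slot_lev i < int ?S then 2 * (3 * 2 ^ slot_lev i) else 3 * 2 ^ slot_lev i) =
      (3 * 2 ^ ?l :: int)"
    unfolding inc l by simp
  define b where "b \<longleftrightarrow> 2 * 2 ^ e \<le> int (slot_pre (Suc (Suc i)))"
  from Suc.prems(1) have
    c1: "(2 ^ e :: int) \<le> int ?S" "51 * (2 ^ Suc i :: int) \<le> 40 * int ?S * int e" and
    c2: "(2 :: int) ^ 80 \<le> 2 ^ Suc i \<longrightarrow> 8 * 2 ^ Suc i * int ?S \<le> 4 * 2 ^ Suc i * int (slot_pre (Suc (Suc i))) +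
        3 * int ?S * int (slot_pre (Suc (Suc i)))" and
    c3: "growth_check n (slot_pre (Suc (Suc i))) (3 * 2 ^ ?l) (int (slot_len (Suc i)) # ?rs) ?k
      (2 * 2 ^ Suc i) (if b then 2 * 2 ^ e else 2 ^ e) (if b then int e + 1 else int e)"
    unfolding growth_check.simps Let_def r S' t' b_def by - (elim conjE, assumption)+
  have c1': "2 ^ e \<le> ?S" "51 * 2 ^ Suc i \<le> 40 * ?S * e"
    using c1 by (simp_all only: of_nat_le_iff[symmetric, where ?'a = int]) simp_all
  have c2': "80 \<le> Suc i \<Longrightarrow> 8 * 2 ^ Suc i * ?S \<le> 4 * 2 ^ Suc i * slot_pre (Suc (Suc i)) +
        3 * ?S * slot_pre (Suc (Suc i))"
    using c2[rule_format, OF power_increasing]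
    by (simp only: of_nat_le_iff[symmetric, where ?'a = int]) simp
  have rs: "int (slot_len (Suc i)) # ?rs = map (\<lambda>x. int (slot_len x)) (rev [0..<Suc (Suc i)])"
    by simp
  have e: "(if b then 2 * 2 ^ e else 2 ^ e :: int) = 2 ^ (if b then Suc e else e)"
    "(if b then int e + 1 else int e) = int (if b then Suc e else e)" by simp_all
  have k': "?k = Suc i - 2 - ?l" using k Suc.prems(2) by simp
  have c3': "growth_check n (slot_pre (Suc (Suc i))) (3 * 2 ^ ?l)
      (map (\<lambda>x. int (slot_len x)) (rev [0..<Suc (Suc i)])) (Suc i - 2 - ?l)
      (2 ^ Suc (Suc i)) (2 ^ (if b then Suc e else e)) (int (if b then Suc e else e))"
    using c3 unfolding rs e k' by simp
  have IH: "(\<forall>x<n. (\<exists>e. 2 ^ e \<le> slot_pre (Suc (Suc i) + x) \<and>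
              51 * 2 ^ (Suc (Suc i) + x) \<le> 40 * slot_pre (Suc (Suc i) + x) * e) \<and>
            (80 \<le> Suc (Suc i) + x \<longrightarrow> 8 * 2 ^ (Suc (Suc i) + x) * slot_pre (Suc (Suc i) + x) \<le>
              4 * 2 ^ (Suc (Suc i) + x) * slot_pre (Suc (Suc (Suc i) + x)) +
              3 * slot_pre (Suc (Suc i) + x) * slot_pre (Suc (Suc (Suc i) + x)))) \<and>
         50 * slot_pre (Suc (Suc i) + n) \<le> 2 ^ (Suc (Suc i) + n) \<and>
         2 ^ (Suc (Suc i) + n) \<le> 51 * slot_pre (Suc (Suc i) + n)"
    by (rule Suc.IH[OF c3']) (use Suc.prems(2) in simp)
  show ?case
  proof (intro conjI allI impI)
    fix x assume x: "x < Suc n"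
    show "\<exists>e. 2 ^ e \<le> slot_pre (Suc i + x) \<and>
        51 * 2 ^ (Suc i + x) \<le> 40 * slot_pre (Suc i + x) * e"
    proof (cases x)
      case 0
      then show ?thesis using c1' by (simp only: add_0_right) blast
    next
      case (Suc y)
      then show ?thesis using IH x by (simp only: add_Suc add_Suc_right Suc_less_eq)
    qed
    assume x80: "80 \<le> Suc i + x"
    show "8 * 2 ^ (Suc i + x) * slot_pre (Suc i + x) \<le>
        4 * 2 ^ (Suc i + x) * slot_pre (Suc (Suc i + x)) +
        3 * slot_pre (Suc i + x) * slot_pre (Suc (Suc i + x))"
    proof (cases x)
      case 0
      then show ?thesis using c2' x80 by (simp only: add_0_right)
    next
      case (Suc y)
      then show ?thesis using IH x x80 by (simp only: add_Suc add_Suc_right Suc_less_eq)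
    qed
  qed (use IH in \<open>simp_all only: add_Suc add_Suc_right\<close>)
qed

text \<open>The initial state belongs to index 6: \<open>slot_pre 6 = 22\<close>,
  \<open>3 * 2 ^ 2 = 12\<close> for the level of slot 5, the lengths of slots 5 to 0,
  \<open>2 ^ 6 = 64\<close> and \<open>2 ^ 4 <= 22\<close>. The 94 steps lead to index 100.\<close>

lemma growth_check_100: "growth_check 94 22 12 [10, 6, 2, 2, 2, 0] 1 64 16 4"
  by code_simp

lemma slot_values_5: "slot_len 5 = 10" "slot_pre 6 = 22"
  using slot_len_rec(1)[of 5] slot_pre_Suc[of 5] by simp_all

lemma growth_small:
  assumes "6 \<le> i" "i < 100"
  shows "\<exists>e. 2 ^ e \<le> slot_pre i \<and> 51 * 2 ^ i \<le> 40 * slot_pre i * e"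
    and "80 \<le> i \<Longrightarrow> 8 * 2 ^ i * slot_pre i \<le> 4 * 2 ^ i * slot_pre (Suc i) + 3 * slot_pre i * slot_pre (Suc i)"
    and "50 * slot_pre 100 \<le> 2 ^ 100" "2 ^ 100 \<le> 51 * slot_pre 100"
proof -
  have rs: "map (\<lambda>x. int (slot_len x)) (rev [0..<6]) = [10, 6, 2, 2, 2, 0]"
    using slot_values_5 by (simp add: upt_rec numeral_2_eq_2[symmetric])
  have six: "Suc 5 = (6::nat)" by simp
  have num: "int 22 = 22" "3 * 2 ^ slot_lev 5 = (12 :: int)" "5 - 2 - slot_lev 5 = 1"
    "2 ^ 6 = (64 :: int)" "2 ^ 4 = (16 :: int)" "int 4 = 4" by simp_all
  have "growth_check 94 (slot_pre (Suc 5)) (3 * 2 ^ slot_lev 5)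
      (map (\<lambda>x. int (slot_len x)) (rev [0..<Suc 5])) (5 - 2 - slot_lev 5) (2 ^ Suc 5) (2 ^ 4) (int 4)"
    unfolding six rs slot_values_5 num using growth_check_100 by simp
  note * = growth_check_sound[OF this]
  have i: "Suc 5 + (i - 6) = i" "i - 6 < 94" "Suc 5 + 94 = (100 :: nat)" using assms by simp_all
  show "\<exists>e. 2 ^ e \<le> slot_pre i \<and> 51 * 2 ^ i \<le> 40 * slot_pre i * e"
    and "80 \<le> i \<Longrightarrow> 8 * 2 ^ i * slot_pre i \<le> 4 * 2 ^ i * slot_pre (Suc i) + 3 * slot_pre i * slot_pre (Suc i)"
    using *[THEN conjunct1, rule_format, of "i - 6"] i(2) unfolding i(1) by simp_all
  show "50 * slot_pre 100 \<le> 2 ^ 100" "2 ^ 100 \<le> 51 * slot_pre 100"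
    using *[THEN conjunct2] unfolding i(3) by simp_all
qed

section \<open>Linear growth of the ratio beyond the computed range\<close>

lemma slot_pre_pos: "2 \<le> i \<Longrightarrow> 0 < slot_pre i"
  using slot_pre_mono[of 2 i] by simp

lemma growth_ratio_mono: "2 \<le> i \<Longrightarrow> growth_ratio i \<le> growth_ratio (Suc i)"
proof -
  assume i: "2 \<le> i"
  have "real (slot_pre (Suc i)) \<le> real (2 * slot_pre i)"
    using slot_len_le_pre[OF i] by (subst of_nat_le_iff) simp
  then have "2 ^ Suc i / real (2 * slot_pre i) \<le> growth_ratio (Suc i)"
    unfolding growth_ratio_def
    using slot_pre_pos[of "Suc i"] i by (intro divide_left_mono) auto
  then show ?thesis by (simp add: growth_ratio_def)
qed

text \<open>Cleared of denominators, this is the inequality that \<open>growth_check\<close> tests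
  from index 80 on.\<close>

lemma growth_ratio_step_small:
  assumes "80 \<le> i" "i < 100"
  shows "growth_ratio (Suc i) \<le> growth_ratio i + 3 / 4"
proof -
  let ?S = "real (slot_pre i)" and ?S' = "real (slot_pre (Suc i))"
  have pos: "0 < ?S" "0 < ?S'" using slot_pre_pos[of i] slot_pre_pos[of "Suc i"] assms by linarith+
  have "real (8 * 2 ^ i * slot_pre i) \<le>
      real (4 * 2 ^ i * slot_pre (Suc i) + 3 * slot_pre i * slot_pre (Suc i))"
    using growth_small(2)[of i] assms by (subst of_nat_le_iff) simp
  then have "8 * 2 ^ i * ?S \<le> 4 * 2 ^ i * ?S' + 3 * ?S * ?S'"
    by (simp del: slot_pre_Suc)
  then show ?thesis
    using pos unfolding growth_ratio_def by (simp del: slot_pre_Suc add: field_simps)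
qed

text \<open>Let \<open>z\<close> and \<open>c\<close> be the ratios at \<open>i\<close> and at the
  occupied slot \<open>j\<close>. The recurrence bounds the factor from \<open>z\<close> to the next
  ratio by \<open>1 / (1 - 2 / (3 * c))\<close>, so the step is at most 3 / 4 as soon as
  \<open>c >= 8 / 9 * (z + 3 / 4)\<close>. As \<open>i - j\<close> is only logarithmic in
  \<open>z\<close>, the induction hypothesis applied between \<open>j\<close> and \<open>i\<close>
  yields this for \<open>z >= 50\<close>.\<close>

lemma growth_ratio_step:
  assumes "80 \<le> i"
  shows "growth_ratio (Suc i) \<le> growth_ratio i + 3 / 4"
  using assms
proof (induction i rule: less_induct)
  case (less i)
  show ?case
  proof (cases "i < 100")
    case True
    then show ?thesis using growth_ratio_step_small less.prems by simp
  next
    case False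
    define j where "j = Suc (slot_lev i)"
    define z where "z = growth_ratio i"
    define c where "c = growth_ratio j"
    let ?S = "real (slot_pre i)"
    have i: "5 \<le> i" "100 \<le> i" using False by simp_all
    have S: "0 < ?S" using slot_pre_pos[of i] i by simp
    have ji: "j < i" using slot_len_rec(2)[OF i(1)] i by (simp add: j_def)
    have z50: "50 \<le> z"
    proof -
      have "growth_ratio 100 \<le> z"
        unfolding z_def using i(2)
      proof (induction i rule: dec_induct)
        case (step k)
        then show ?case using growth_ratio_mono[of k] by simp
      qed simp
      moreover have "real (50 * slot_pre 100) \<le> real (2 ^ 100)"
        using growth_small(3)[of 6] by (subst of_nat_le_iff) simp
      then have "50 \<le> growth_ratio 100"
        using slot_pre_pos[of 100] by (simp add: growth_ratio_def field_simps)
      ultimately show ?thesis by simp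
    qed
    have lev: "3 * 2 ^ slot_lev i < 2 * ?S" "?S \<le> 3 * 2 ^ slot_lev i"
    proof -
      have "real (3 * 2 ^ slot_lev i) < real (2 * slot_pre i)"
        using slot_lev_min[OF i(1)] by (subst of_nat_less_iff)
      then show "3 * 2 ^ slot_lev i < 2 * ?S" by simp
      have "real (slot_pre i) \<le> real (3 * 2 ^ slot_lev i)"
        using slot_pre_le_lev[of i] i by (subst of_nat_le_iff) simp
      then show "?S \<le> 3 * 2 ^ slot_lev i" by simp
    qed
    \<comment> \<open>Keeps \<open>j\<close> inside the range of the induction;
      \<open>slot_pre 100\<close> exceeds \<open>2 ^ 94\<close>, far above
      \<open>3 * 2 ^ 78\<close>.\<close>
    have j80: "80 \<le> j"
    proof (rule ccontr)
      assume "\<not> 80 \<le> j"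
      then have "(2::nat) ^ slot_lev i \<le> 2 ^ 78" by (intro power_increasing) (auto simp: j_def)
      moreover have "slot_pre 100 \<le> slot_pre i" by (rule slot_pre_mono) (rule i)
      moreover have "(2::nat) ^ 100 \<le> 51 * slot_pre 100" using growth_small(4)[of 6] by simp
      ultimately show False using slot_pre_le_lev[of i] i by simp
    qed
    \<comment> \<open>\<open>2 ^ (i - j) <= 3 / 2 * z\<close> is made linear by splitting off
      \<open>2 ^ 6\<close> and using \<open>1 + v <= 2 ^ v\<close> for the rest.\<close>
    have u: "real (i - j) \<le> 5 + 3 / 128 * z"
    proof (cases "6 \<le> i - j")
      case True
      define v where "v = i - j - 6"
      have v: "i = j + 6 + v" using True by (simp add: v_def)
      have "(2 :: real) ^ i = 2 ^ j * 64 * 2 ^ v" by (subst v) (simp add: power_add)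
      moreover have "?S \<le> 3 / 2 * 2 ^ j" using lev(2) by (simp add: j_def)
      then have "?S * (64 * 2 ^ v) \<le> 3 / 2 * 2 ^ j * (64 * 2 ^ v)"
        by (rule mult_right_mono) simp
      ultimately have "?S * 64 * 2 ^ v \<le> 3 / 2 * 2 ^ i" by simp
      then have "64 * 2 ^ v \<le> 3 / 2 * z" using S by (simp add: z_def growth_ratio_def field_simps)
      moreover have "1 + real v \<le> 2 ^ v"
        using less_exp[of v] by (metis Suc_leI of_nat_Suc of_nat_le_iff of_nat_numeral of_nat_power
            add.commute)
      moreover have "real (i - j) = 6 + real v" using v by linarith
      ultimately show ?thesis by simp
    qed (use z50 in linarith)
    have "z \<le> c + 3 / 4 * real (i - j)"
    proof -
      have "growth_ratio (j + k) \<le> c + 3 / 4 * real k" if "j + k \<le> i" for k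
        using that
      proof (induction k)
        case (Suc k)
        then show ?case using less.IH[of "j + k"] j80 by (simp add: field_simps)
      qed (simp add: c_def)
      from this[of "i - j"] show ?thesis using ji by (simp add: z_def)
    qed
    \<comment> \<open>This requires \<open>z\<close> to be at least about 47.2, which is what the
      lower bound 50 on the ratio at index 100 provides.\<close>
    then have c: "8 / 9 * (z + 3 / 4) \<le> c" using u z50 by simp
    then have c0: "2 / 3 < c" "0 < c" using z50 by simp_all
    have "c * slot_len j \<le> 4 / 3 * ?S"
    proof -
      have Sj: "0 < real (slot_pre j)" using slot_pre_pos[of j] j80 by simp
      have "real (slot_len j) \<le> real (slot_pre j)"
        using slot_len_le_pre[of j] j80 by simp
      then have "c * slot_len j \<le> c * slot_pre j" using c0 by (intro mult_left_mono) auto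
      also have "\<dots> = 2 ^ j" using Sj by (simp add: c_def growth_ratio_def)
      finally show ?thesis using lev(1) by (simp add: j_def)
    qed
    moreover have S': "real (slot_pre (Suc i)) = 2 * ?S - slot_len j"
      using slot_len_pre[OF i(1)] by (simp add: j_def)
    have "c * slot_pre (Suc i) = 2 * ?S * c - c * slot_len j" unfolding S' by (simp add: algebra_simps)
    moreover have "2 * ?S * (c - 2 / 3) = 2 * ?S * c - 4 / 3 * ?S" by (simp add: algebra_simps)
    ultimately have "2 * ?S * (c - 2 / 3) \<le> c * slot_pre (Suc i)" by linarith
    moreover have "c * 2 \<le> (2 * (c - 2 / 3)) * (1 + 3 / 4 / z)"
    proof -
      have "0 \<le> (3 / 2 * c - 4 / 3 * (z + 3 / 4)) / z"
        using c z50 by (intro divide_nonneg_pos) auto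
      also have "\<dots> = (2 * (c - 2 / 3)) * (1 + 3 / 4 / z) - c * 2"
        using z50 by (simp add: field_simps)
      finally show ?thesis by simp
    qed
    ultimately have *: "c * 2 * ?S \<le> c * slot_pre (Suc i) * (1 + 3 / 4 / z)"
    proof -
      assume a: "2 * ?S * (c - 2 / 3) \<le> c * slot_pre (Suc i)"
        and b: "c * 2 \<le> (2 * (c - 2 / 3)) * (1 + 3 / 4 / z)"
      have "c * 2 * ?S \<le> (2 * (c - 2 / 3)) * (1 + 3 / 4 / z) * ?S"
        using b S by (intro mult_right_mono) auto
      also have "\<dots> = (2 * ?S * (c - 2 / 3)) * (1 + 3 / 4 / z)" by (simp add: algebra_simps)
      also have "\<dots> \<le> c * slot_pre (Suc i) * (1 + 3 / 4 / z)"
        using a z50 by (intro mult_right_mono) auto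
      finally show ?thesis .
    qed
    have "2 * ?S \<le> slot_pre (Suc i) * (1 + 3 / 4 / z)"
      using * c0(2) by (simp only: mult.assoc mult_le_cancel_left_pos)
    then have "2 * ?S * z \<le> slot_pre (Suc i) * (1 + 3 / 4 / z) * z"
      using z50 by (intro mult_right_mono) auto
    also have "\<dots> = slot_pre (Suc i) * (z + 3 / 4)" using z50 by (simp add: field_simps)
    also have "2 * ?S * z = 2 ^ Suc i" using S by (simp add: z_def growth_ratio_def)
    finally show ?thesis
      using slot_pre_pos[of "Suc i"] i
      by (simp del: slot_pre_Suc add: growth_ratio_def[of "Suc i"] z_def field_simps)
  qed
qed

lemma ln_2_ge_half: "1 / 2 \<le> ln (2 :: real)"
  using ln_le_minus_one[of "1 / 2 :: real"] by (simp add: ln_div)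

text \<open>Below 100 the table proves it with an integer lower bound for the logarithm. Beyond,
  \<open>z <= 3 / 4 * i - 24\<close> and \<open>log 2 z <= 6 + z / 32\<close> give
  \<open>i - log 2 z >= (4 / 3 - 1 / 32) * z\<close>, and this factor exceeds 51 / 40.\<close>

lemma slot_pre_log:
  assumes "6 \<le> i"
  shows "51 / 40 * 2 ^ i \<le> slot_pre i * log 2 (slot_pre i)"
proof (cases "i < 100")
  case True
  obtain e where e: "2 ^ e \<le> slot_pre i" "51 * 2 ^ i \<le> 40 * slot_pre i * e"
    using growth_small(1)[OF assms True] by blast
  have S: "0 < real (slot_pre i)" using slot_pre_pos[of i] assms by simp
  have "real (2 ^ e) \<le> real (slot_pre i)" using e(1) by (subst of_nat_le_iff)
  then have "real e \<le> log 2 (slot_pre i)" using S by (simp add: le_log_iff powr_realpow)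
  then have "40 * slot_pre i * real e \<le> 40 * slot_pre i * log 2 (slot_pre i)"
    using S by (intro mult_left_mono) auto
  moreover have "real (51 * 2 ^ i) \<le> real (40 * slot_pre i * e)" using e(2) by (subst of_nat_le_iff)
  ultimately show ?thesis by simp
next
  case False
  define z where "z = growth_ratio i"
  have S: "0 < real (slot_pre i)" using slot_pre_pos[of i] assms by simp
  have z0: "0 < z" using S by (simp add: z_def growth_ratio_def)
  have "growth_ratio (100 + k) \<le> 51 + 3 / 4 * real k" for k
  proof (induction k)
    case 0
    have "real (2 ^ 100) \<le> real (51 * slot_pre 100)"
      using growth_small(4)[of 6] by (subst of_nat_le_iff) simp
    then show ?case using slot_pre_pos[of 100] by (simp add: growth_ratio_def field_simps)
  next
    case (Suc k)
    then show ?case using growth_ratio_step[of "100 + k"] by (simp add: field_simps)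
  qed
  from this[of "i - 100"] False have z: "z \<le> 51 + 3 / 4 * (real i - 100)"
    by (simp add: z_def of_nat_diff)
  have S_eq: "real (slot_pre i) = 2 ^ i / z" using S by (simp add: z_def growth_ratio_def)
  have "log 2 (z / 64) \<le> z / 32"
  proof (cases "z \<le> 64")
    case True
    then have "log 2 (z / 64) \<le> 0" using z0 by simp
    then show ?thesis using z0 by linarith
  next
    case False
    have "ln (z / 64) \<le> z / 64" using ln_le_minus_one[of "z / 64"] z0 by simp
    also have "\<dots> \<le> z / 32 * ln 2" using z0 ln_2_ge_half mult_left_mono[of "1 / 2" "ln 2" "z / 32"] by simp
    finally show ?thesis by (simp add: log_def divide_le_eq)
  qed
  moreover have "log 2 (z / 64) = log 2 z - 6"
    using z0 log_nat_power[of 2 2 6] by (simp add: log_divide)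
  moreover have "100 \<le> real i" using False by simp
  ultimately have "51 / 40 * z \<le> real i - log 2 z"
    using z z0 by argo
  also have "\<dots> = log 2 (slot_pre i)"
    using z0 unfolding S_eq by (simp add: log_divide log_nat_power)
  finally have "slot_pre i * (51 / 40 * z) \<le> slot_pre i * log 2 (slot_pre i)"
    using S by (intro mult_left_mono) auto
  moreover have "slot_pre i * (51 / 40 * z) = 51 / 40 * 2 ^ i"
    using z0 unfolding S_eq by simp
  ultimately show ?thesis by linarith
qed

section \<open>The depth bound\<close>

lemma slot_pre_le_room: "slot_pre i \<le> room i 0 0"
  using room_ge[of 0 i 0] by simp

lemma log_mult_mono:
  assumes "2 \<le> x" "x \<le> y"
  shows "x * log 2 x \<le> y * log 2 y"
  using assms by (intro mult_mono) auto

text \<open>The hypothesis says that \<open>i\<close> slots are too few for \<open>m\<close>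
  positions, the first of which takes no slot. For some small \<open>i\<close> the inequality fails
  for \<open>slot_pre i\<close> in place of \<open>m\<close>; there the two additional positions
  make up for it.\<close>

lemma room_log:
  assumes "0 < i" "room i 0 0 + 2 \<le> m"
  shows "51 / 40 * 2 ^ i \<le> m * log 2 m"
proof -
  consider "i = Suc 0" | "i = 2" | "i = 3" | "i = 4" | "i = 5" | "6 \<le> i" using assms(1) by linarith
  then show ?thesis
  proof cases
    case 1
    have "2 * log 2 2 \<le> m * log 2 m"
      using assms(2) 1 by (intro log_mult_mono) auto
    moreover have "3 * log 2 2 \<le> m * log 2 m"
      using assms(2) 1 by (intro mult_mono) auto
    ultimately show ?thesis using 1 by simp
  next
    case 2
    have "4 * log 2 (2 ^ 2) \<le> m * log 2 m"
      using assms(2) 2 log_mult_mono[of 4 m] by simp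
    then show ?thesis using 2 by (simp only: log_pow_cancel) simp
  next
    case 3
    have "6 * log 2 (2 ^ 2) \<le> m * log 2 m"
      using assms(2) 3 by (intro mult_mono) auto
    then show ?thesis using 3 by (simp only: log_pow_cancel) simp
  next
    case 4
    have "9 * log 2 (2 ^ 3) \<le> m * log 2 m"
      using assms(2) 4 by (intro mult_mono) auto
    then show ?thesis using 4 by (simp only: log_pow_cancel) simp
  next
    case 5
    have "14 * log 2 (2 ^ 3) \<le> m * log 2 m"
      using assms(2) 5 slot_pre_le_room[of 5] by (intro mult_mono) auto
    then show ?thesis using 5 by (simp only: log_pow_cancel) simp
  next
    case 6
    have "slot_pre i * log 2 (slot_pre i) \<le> m * log 2 m"
      using assms(2) slot_pre_le_room[of i] slot_pre_mono[of 2 i] 6 by (intro log_mult_mono) auto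
    then show ?thesis using slot_pre_log[OF 6] by linarith
  qed
qed

text \<open>Taking logarithms in \<open>room_log\<close> leaves the constant
  \<open>1 - log 2 (51 / 40)\<close>. The exponent 20 is chosen since 7 / 20 = 0.35, and
  \<open>(51 / 40) ^ 20 >= 2 ^ 7\<close>.\<close>

lemma depth_bound:
  assumes "0 < i" "room i 0 0 + 2 \<le> m"
  shows "real (Suc i) \<le> log 2 m + log 2 (log 2 m) + 0.65"
proof -
  have m: "2 \<le> m" using assms(2) by simp
  then have l: "0 < log 2 m" by simp
  have "real 7 = log 2 (2 ^ 7)" by (rule log_pow_cancel[symmetric]) simp_all
  also have "\<dots> \<le> log 2 ((51 / 40) ^ 20)" by (subst log_le_cancel_iff) (simp_all add: power_divide)
  also have "\<dots> = 20 * log 2 (51 / 40)" by (subst log_nat_power) simp_all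
  finally have "0.35 \<le> log 2 (51 / 40)" by simp
  moreover have "log 2 (51 / 40 * 2 ^ i) \<le> log 2 (m * log 2 m)"
    using room_log[OF assms] m l by (subst log_le_cancel_iff) auto
  moreover have "log 2 (51 / 40 * 2 ^ i) = log 2 (51 / 40) + i"
    by (subst log_mult) (auto simp: log_nat_power)
  moreover have "log 2 (m * log 2 m) = log 2 m + log 2 (log 2 m)"
    using m l less_imp_neq[OF l] by (metis log_mult not_numeral_le_zero of_nat_eq_0_iff)
  ultimately show ?thesis by simp
qed

section \<open>Shared trees over aligned blocks\<close>

text \<open>
  Positions are grouped by parity, and x = 2 * q + p is the q-th block of 2 ^ h consecutive
  positions of parity p. The vertex of this block is stored in cell h * m + x of V.
\<close>

definition block :: "nat \<Rightarrow> nat \<Rightarrow> nat set" where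
  "block h x = {w. w mod 2 = x mod 2 \<and> w div 2 div 2 ^ h = x div 2}"

text \<open>With \<open>x = 2 * q + p\<close>, this says that the last position
  \<open>p + 2 * ((q + 1) * 2 ^ h - 1)\<close> of the block is below \<open>m\<close>, written
  without subtraction.\<close>

definition block_fits :: "nat \<Rightarrow> nat \<Rightarrow> nat \<Rightarrow> bool" where
  "block_fits m h x \<longleftrightarrow> x mod 2 + 2 * (Suc (x div 2) * 2 ^ h) \<le> m + 1"

definition tree_vertices :: "nat \<Rightarrow> (nat \<Rightarrow> nat) \<Rightarrow> gate list \<Rightarrow> bool" where
  "tree_vertices m V gs \<longleftrightarrow>
     (\<forall>h x. block_fits m h x \<longrightarrow> realizes m gs (V (h * m + x)) (agg x (block h x)) h)"

lemma tree_vertices_append: "tree_vertices m V gs \<Longrightarrow> tree_vertices m V (gs @ hs)"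
  unfolding tree_vertices_def using realizes_append by blast

lemma div_eq_iff_nat: "0 < d \<Longrightarrow> (n :: nat) div d = q \<longleftrightarrow> q * d \<le> n \<and> n < Suc q * d"
  by (metis div_less_iff_less_mult le_antisym less_Suc_eq_le less_eq_div_iff_mult_less_eq order_refl)

lemma block_iff:
  "w \<in> block h x \<longleftrightarrow>
     w mod 2 = x mod 2 \<and> x div 2 * 2 ^ h \<le> w div 2 \<and> w div 2 < Suc (x div 2) * 2 ^ h"
  unfolding block_def by (simp only: mem_Collect_eq div_eq_iff_nat[OF zero_less_power[OF pos2]])

lemma block_nonempty: "block h x \<noteq> {}"
proof -
  have "x mod 2 + 2 * (x div 2 * 2 ^ h) \<in> block h x" by (simp add: block_def)
  then show ?thesis by blast
qed

text \<open>The larger block contains two positions at distance \<open>2 * 2 ^ h\<close>, which lie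
  in different blocks of level \<open>h\<close>.\<close>

lemma block_level_unique:
  assumes "h < k"
  shows "block h x \<noteq> block k y"
proof
  assume eq: "block h x = block k y"
  let ?w = "y mod 2 + 2 * (y div 2 * 2 ^ k)"
  have lt: "(2::nat) ^ h < 2 ^ k" using assms by simp
  have "(?w + 2 * 2 ^ h) div 2 = y div 2 * 2 ^ k + 2 ^ h" by simp
  then have "?w \<in> block k y" "?w + 2 * 2 ^ h \<in> block k y"
    using lt by (simp_all add: block_def)
  then have "?w div 2 div 2 ^ h = (?w + 2 * 2 ^ h) div 2 div 2 ^ h"
    unfolding eq[symmetric] by (simp only: block_def mem_Collect_eq)
  then show False by simp
qed

lemma agg_parity: "even p = even q \<Longrightarrow> agg p = agg q"
  by (intro ext) (simp add: agg_def)

text \<open>Equal vertices would compute the same function, and by \<open>agg_inj\<close> the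
  function determines the set of positions.\<close>

lemma tree_vertices_distinct:
  assumes "tree_vertices m V gs" "block_fits m h x" "block_fits m k y" "h < k" "even x = even y"
  shows "V (h * m + x) \<noteq> V (k * m + y)"
proof
  assume eq: "V (h * m + x) = V (k * m + y)"
  have "agg x (block h x) = agg y (block k y)"
    using assms(1-3) eq realizes_unique unfolding tree_vertices_def by metis
  then show False
    using agg_inj block_level_unique[OF assms(4)] agg_parity[OF assms(5)] by metis
qed

section \<open>Signals for the blocks before a position\<close>

fun attach :: "nat \<Rightarrow> bop \<Rightarrow> gate list \<times> nat option \<Rightarrow> nat \<Rightarrow> gate list \<times> nat option" where
  "attach m f (gs, None) v = (gs, Some v)"
| "attach m f (gs, Some a) v = (gs @ [(f, a, v)], Some (m + length gs))"

text \<open>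
  Starting with v blocks of level l, attach_blocks goes up n levels. For positive n it covers at
  least 3 * 2 ^ (n - 1) of the last blocks: in the even case, the block v - 3 complements the block
  of the next level, which contains v - 2 and v - 1. For v = 2 the truncated difference is harmless,
  as the operations are idempotent.
\<close>

primrec attach_blocks ::
  "nat \<Rightarrow> (nat \<Rightarrow> nat) \<Rightarrow> nat \<Rightarrow> nat \<Rightarrow> nat \<Rightarrow> nat \<Rightarrow> gate list \<times> nat option \<Rightarrow>
     gate list \<times> nat option" where
  "attach_blocks m V p 0 l v st =
     (if 0 < v then attach m (parity_op p) st (V (l * m + (p + 2 * (v - 1)))) else st)"
| "attach_blocks m V p (Suc n) l v st =
     attach_blocks m V p n (Suc l) (v div 2)
       (if odd v then attach m (parity_op p) st (V (l * m + (p + 2 * (v - 1))))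
        else if n = 0 \<and> 0 < v then attach m (parity_op p) st (V (l * m + (p + 2 * (v - 3))))
        else st)"

context
  fixes m D p y :: nat and V :: "nat \<Rightarrow> nat" and gs\<^sub>0 :: "gate list"
  assumes trees: "tree_vertices m V gs\<^sub>0" and p: "p < 2" and y: "p + 2 * y \<le> m + 1"
begin

text \<open>The invariant on arrival at level \<open>l\<close>, where \<open>X\<close> is the set
  covered so far. An accumulated value has depth at most \<open>l\<close> and cost fewer than
  \<open>l\<close> gates. The last clause, a new gate or a block of lower level, guarantees that its
  vertex differs from the next block to be attached.\<close>

definition attached :: "nat \<Rightarrow> nat set \<Rightarrow> gate list \<times> nat option \<Rightarrow> bool" where
  "attached l X st \<longleftrightarrow>
     sound m D (fst st) \<and> X \<subseteq> {w. w mod 2 = p \<and> w div 2 < y} \<and>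
     (snd st = None \<longrightarrow> X = {} \<and> fst st = gs\<^sub>0) \<and>
     (\<forall>a. snd st = Some a \<longrightarrow> X \<noteq> {} \<and> realizes m (fst st) a (agg p X) l \<and>
       (\<exists>hs. fst st = gs\<^sub>0 @ hs \<and> length hs < l) \<and>
       (m + length gs\<^sub>0 \<le> a \<or>
        (\<exists>k<l. \<exists>x. even x = even p \<and> block_fits m k x \<and> a = V (k * m + x))))"

lemma attached_Suc: "attached l X st \<Longrightarrow> attached (Suc l) X st"
  unfolding attached_def by (meson less_SucI le_SucI order_refl realizes_mono)

lemma attached_attach:
  assumes "attached l X st" "Suc q * 2 ^ l \<le> y" "l < D"
  shows "attached (Suc l) (X \<union> block l (p + 2 * q)) (attach m (parity_op p) st (V (l * m + (p + 2 * q))))"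
proof -
  obtain gs ao where st: "st = (gs, ao)" by (cases st)
  note att = assms(1)[unfolded attached_def st fst_conv snd_conv]
  note sound = att[THEN conjunct1]
  note X = att[THEN conjunct2, THEN conjunct1]
  note att_None = att[THEN conjunct2, THEN conjunct2, THEN conjunct1, rule_format]
  note att_Some = att[THEN conjunct2, THEN conjunct2, THEN conjunct2, rule_format]
  let ?x = "p + 2 * q" and ?v = "V (l * m + (p + 2 * q))"
  have x: "?x mod 2 = p" "?x div 2 = q" "even ?x = even p" using p by auto
  have fits: "block_fits m l ?x"
    using assms(2) y unfolding block_fits_def x(1,2) by simp
  then have "realizes m gs\<^sub>0 ?v (agg ?x (block l ?x)) l"
    using trees unfolding tree_vertices_def by blast
  then have v0: "realizes m gs\<^sub>0 ?v (agg p (block l ?x)) l"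
    unfolding agg_parity[OF x(3)] .
  have sub: "block l ?x \<subseteq> {w. w mod 2 = p \<and> w div 2 < y}"
    using assms(2) by (auto simp: block_iff p)
  show ?thesis
  proof (cases ao)
    case None
    note X0 = att_None[OF None, THEN conjunct1] and gs = att_None[OF None, THEN conjunct2]
    have o: "\<exists>k<Suc l. \<exists>x. even x = even p \<and> block_fits m k x \<and> ?v = V (k * m + x)"
      using fits x(3) by blast
    show ?thesis
      unfolding attached_def st None attach.simps fst_conv snd_conv X0 gs Un_empty_left
    proof (intro conjI allI impI)
      fix b assume "Some ?v = Some b"
      then have b: "b = ?v" by simp
      show "block l ?x \<noteq> {}" by (rule block_nonempty)
      show "realizes m gs\<^sub>0 b (agg p (block l ?x)) (Suc l)"
        unfolding b using v0 by (rule realizes_mono) simp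
      show "\<exists>hs. gs\<^sub>0 = gs\<^sub>0 @ hs \<and> length hs < Suc l" by (intro exI[of _ "[]"]) simp
      show "m + length gs\<^sub>0 \<le> b \<or>
          (\<exists>k<Suc l. \<exists>x. even x = even p \<and> block_fits m k x \<and> b = V (k * m + x))"
        unfolding b using o by blast
    qed (use sound gs sub in simp_all)
  next
    case (Some a)
    note att' = att_Some[OF Some]
    have a: "X \<noteq> {}" "realizes m gs a (agg p X) l"
      and h: "\<exists>hs. gs = gs\<^sub>0 @ hs \<and> length hs < l"
      and a': "m + length gs\<^sub>0 \<le> a \<or>
             (\<exists>k<l. \<exists>x. even x = even p \<and> block_fits m k x \<and> a = V (k * m + x))"
      by (rule att'[THEN conjunct1] att'[THEN conjunct2, THEN conjunct1]
          att'[THEN conjunct2, THEN conjunct2, THEN conjunct1]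
          att'[THEN conjunct2, THEN conjunct2, THEN conjunct2])+
    from h obtain hs where hs: "gs = gs\<^sub>0 @ hs" "length hs < l" by blast
    have v: "realizes m gs ?v (agg p (block l ?x)) l"
      unfolding hs by (rule realizes_append) (rule v0)
    have ne: "a \<noteq> ?v"
      using a'
    proof
      assume "m + length gs\<^sub>0 \<le> a"
      then show ?thesis using realizes_less[OF v0] by linarith
    next
      assume "\<exists>k<l. \<exists>x. even x = even p \<and> block_fits m k x \<and> a = V (k * m + x)"
      then obtain k z where z: "k < l" "even z = even p" "block_fits m k z" "a = V (k * m + z)" by blast
      then show ?thesis using tree_vertices_distinct[OF trees z(3) fits z(1)] x(3) by simp
    qed
    let ?gs = "gs @ [(parity_op p, a, ?v)]"
    show ?thesis
      unfolding attached_def st Some attach.simps fst_conv snd_conv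
    proof (intro conjI allI impI)
      show "sound m D ?gs"
        by (rule sound_gate[OF sound a(2) v ne assms(3) assms(3)])
      show "X \<union> block l ?x \<subseteq> {w. w mod 2 = p \<and> w div 2 < y}" using X sub by blast
      fix b assume "Some (m + length gs) = Some b"
      then have b: "b = m + length gs" by simp
      show "X \<union> block l ?x \<noteq> {}" using a(1) by blast
      show "realizes m ?gs b (agg p (X \<union> block l ?x)) (Suc l)"
        using realizes_gate[OF a(2) v, of "parity_op p"] unfolding b by (simp add: agg_Un)
      show "\<exists>hs. ?gs = gs\<^sub>0 @ hs \<and> length hs < Suc l" using hs by simp
      show "m + length gs\<^sub>0 \<le> b \<or>
          (\<exists>k<Suc l. \<exists>x. even x = even p \<and> block_fits m k x \<and> b = V (k * m + x))"
        unfolding b using hs by simp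
    qed simp_all
  qed
qed

text \<open>All positions behind the first \<open>v\<close> blocks are assumed to be in
  \<open>X\<close>, so the reach in the conclusion is counted back from the end of these blocks and
  not from \<open>y\<close>.\<close>

lemma attach_blocks_attached:
  assumes "attached l X st" "v * 2 ^ l \<le> y" "l + n < D"
    and "\<forall>w. w mod 2 = p \<and> v * 2 ^ l \<le> w div 2 \<and> w div 2 < y \<longrightarrow> w \<in> X"
  shows "\<exists>X'. X \<subseteq> X' \<and> attached (Suc (l + n)) X' (attach_blocks m V p n l v st) \<and>
    (\<forall>w. w mod 2 = p \<and> w div 2 < y \<and>
       v * 2 ^ l \<le> w div 2 + (if n = 0 then 2 ^ l else 3 * 2 ^ (n - 1 + l)) \<longrightarrow> w \<in> X')"
  using assms
proof (induction n arbitrary: l v X st)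
  case 0
  show ?case
  proof (cases "0 < v")
    case True
    then have v: "Suc (v - 1) = v" by simp
    let ?b = "block l (p + 2 * (v - 1))"
    have "attached (Suc l) (X \<union> ?b) (attach_blocks m V p 0 l v st)"
      using attached_attach[OF 0(1), of "v - 1"] 0(2,3) True by (simp add: v)
    moreover have *: "w \<in> X \<union> ?b"
      if "w mod 2 = p" "w div 2 < y" "v * 2 ^ l \<le> w div 2 + 2 ^ l" for w
    proof (cases "v * 2 ^ l \<le> w div 2")
      case True
      then show ?thesis using 0(4) that by blast
    next
      case False
      moreover have "(p + 2 * (v - 1)) mod 2 = p" "(p + 2 * (v - 1)) div 2 = v - 1" using p by auto
      moreover have "(v - 1) * 2 ^ l + 2 ^ l = v * 2 ^ l" using True by (cases v) auto
      ultimately show ?thesis using that v by (auto simp: block_iff)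
    qed
    ultimately have "attached (Suc (l + 0)) (X \<union> ?b) (attach_blocks m V p 0 l v st)"
      "\<forall>w. w mod 2 = p \<and> w div 2 < y \<and>
         v * 2 ^ l \<le> w div 2 + (if (0::nat) = 0 then 2 ^ l else 3 * 2 ^ (0 - 1 + l)) \<longrightarrow> w \<in> X \<union> ?b"
      by (simp_all only: add_0_right refl if_True) blast
    then show ?thesis by blast
  next
    case False
    then show ?thesis using attached_Suc[OF 0(1)] 0(4) by (intro exI[of _ X]) simp
  qed
next
  case (Suc n)
  define st' where "st' =
    (if odd v then attach m (parity_op p) st (V (l * m + (p + 2 * (v - 1))))
     else if n = 0 \<and> 0 < v then attach m (parity_op p) st (V (l * m + (p + 2 * (v - 3)))) else st)"
  define B where "B = (if odd v then block l (p + 2 * (v - 1))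
    else if n = 0 \<and> 0 < v then block l (p + 2 * (v - 3)) else {})"
  have l: "l < D" using Suc.prems(3) by simp
  have vv: "v div 2 * 2 ^ Suc l \<le> v * 2 ^ l" by simp
  have st': "attached (Suc l) (X \<union> B) st'"
  proof -
    consider "odd v" | "even v" "n = 0" "0 < v" | "even v" "\<not> (n = 0 \<and> 0 < v)" by blast
    then show ?thesis
    proof cases
      case 1
      then have "Suc (v - 1) * 2 ^ l \<le> y" using Suc.prems(2) by (cases v) auto
      from attached_attach[OF Suc.prems(1) this l] show ?thesis
        unfolding st'_def B_def using 1 by simp
    next
      case 2
      then have "Suc (v - 3) \<le> v" by presburger
      then have "Suc (v - 3) * 2 ^ l \<le> v * 2 ^ l" by (rule mult_le_mono1)
      then have "Suc (v - 3) * 2 ^ l \<le> y" using Suc.prems(2) by linarith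
      from attached_attach[OF Suc.prems(1) this l] show ?thesis
        unfolding st'_def B_def using 2 by simp
    next
      case 3
      then show ?thesis
        unfolding st'_def B_def using attached_Suc[OF Suc.prems(1)] by auto
    qed
  qed
  have mod: "(p + 2 * k) mod 2 = p" "(p + 2 * k) div 2 = k" for k using p by auto
  have cover: "w \<in> X \<union> B" if "w mod 2 = p" "v div 2 * 2 ^ Suc l \<le> w div 2" "w div 2 < y" for w
  proof (cases "v * 2 ^ l \<le> w div 2")
    case True
    then show ?thesis using Suc.prems(4) that by blast
  next
    case False
    show ?thesis
    proof (cases "odd v")
      case True
      then obtain k where k: "v = 2 * k + 1" by (elim oddE)
      then have "(v - 1) * 2 ^ l = v div 2 * 2 ^ Suc l" "Suc (v - 1) = v" by simp_all
      then have "w \<in> B"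
        using that(1,2) False True unfolding B_def by (simp only: not_False_eq_True simp_thms if_True block_iff mod not_le)
      then show ?thesis by blast
    next
      case even: False
      then obtain k where "v = 2 * k" by (auto elim: evenE)
      then have "v div 2 * 2 ^ Suc l = v * 2 ^ l" by simp
      then have "v * 2 ^ l \<le> w div 2" using that(2) by (simp only:)
      then show ?thesis using False by blast
    qed
  qed
  have le: "v div 2 * 2 ^ Suc l \<le> y" using vv Suc.prems(2) by linarith
  have lt: "Suc l + n < D" using Suc.prems(3) by simp
  have "\<forall>w. w mod 2 = p \<and> v div 2 * 2 ^ Suc l \<le> w div 2 \<and> w div 2 < y \<longrightarrow> w \<in> X \<union> B"
    using cover by blast
  from Suc.IH[OF st' le lt this]
  obtain X' where X': "X \<union> B \<subseteq> X'"
      "attached (Suc (Suc l + n)) X' (attach_blocks m V p n (Suc l) (v div 2) st')"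
    and c: "\<And>w. w mod 2 = p \<Longrightarrow> w div 2 < y \<Longrightarrow>
       v div 2 * 2 ^ Suc l \<le> w div 2 + (if n = 0 then 2 ^ Suc l else 3 * 2 ^ (n - 1 + Suc l)) \<Longrightarrow> w \<in> X'"
    by blast
  have "w \<in> X'" if w: "w mod 2 = p" "w div 2 < y" "v * 2 ^ l \<le> w div 2 + 3 * 2 ^ (n + l)" for w
  proof (cases n)
    case 0
    have w': "v * 2 ^ l \<le> w div 2 + 3 * 2 ^ l" using w(3) 0 by simp
    show ?thesis
    proof (cases "odd v")
      case True
      then obtain k where k: "v = 2 * k + 1" by (elim oddE)
      have "v div 2 * 2 ^ Suc l \<le> w div 2 + 2 ^ Suc l" using w' k by simp
      then show ?thesis using c[OF w(1,2)] 0 by simp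
    next
      case False
      then obtain k where k: "v = 2 * k" by (auto elim: evenE)
      show ?thesis
      proof (cases "v div 2 * 2 ^ Suc l \<le> w div 2 + 2 ^ Suc l")
        case True
        then show ?thesis using c[OF w(1,2)] 0 by simp
      next
        case less: False
        then have lt: "w div 2 + 2 * 2 ^ l < v * 2 ^ l" using k by simp
        \<comment> \<open>A position not reached by the block of the next level lies before the last
          two blocks, so there is a third one and \<open>v - 3\<close> is not truncated.\<close>
        have "3 \<le> v"
        proof (rule ccontr)
          assume "\<not> 3 \<le> v"
          then have "v * 2 ^ l \<le> 2 * 2 ^ l" by (intro mult_le_mono1) simp
          then show False using lt by linarith
        qed
        then have v3: "(v - 3) * 2 ^ l + 3 * 2 ^ l = v * 2 ^ l" "0 < v"
          by (simp_all add: add_mult_distrib[symmetric])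
        have "w \<in> block l (p + 2 * (v - 3))"
          using w(1) w' lt v3(1) unfolding block_iff mod by simp
        then show ?thesis using X'(1) False 0 v3(2) by (auto simp: B_def)
      qed
    qed
  next
    case (Suc j)
    have "n - 1 + Suc l = n + l" using Suc by simp
    then have "v div 2 * 2 ^ Suc l \<le>
        w div 2 + (if n = 0 then 2 ^ Suc l else 3 * 2 ^ (n - 1 + Suc l))"
      using w(3) vv Suc by (simp only: nat.simps if_False)
    then show ?thesis by (rule c[OF w(1,2)])
  qed
  moreover have "attach_blocks m V p (Suc n) l v st = attach_blocks m V p n (Suc l) (v div 2) st'"
    by (simp add: st'_def)
  ultimately show ?case
    using X' by (intro exI[of _ X']) (simp add: add.commute)
qed

lemma attach_blocks_correct:
  assumes "sound m D gs\<^sub>0" "n < D" "0 < y"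
  shows "\<exists>gs' a X. attach_blocks m V p n 0 y (gs\<^sub>0, None) = (gs', Some a) \<and>
    (\<exists>hs. gs' = gs\<^sub>0 @ hs \<and> length hs \<le> n) \<and> sound m D gs' \<and>
    realizes m gs' a (agg p X) (Suc n) \<and> X \<noteq> {} \<and> X \<subseteq> {w. w mod 2 = p \<and> w div 2 < y} \<and>
    (\<forall>w. w mod 2 = p \<and> w div 2 < y \<and>
       y \<le> w div 2 + (if n = 0 then 1 else 3 * 2 ^ (n - 1)) \<longrightarrow> w \<in> X)"
proof -
  have "attached 0 {} (gs\<^sub>0, None)" using assms(1) by (simp add: attached_def)
  from attach_blocks_attached[OF this, of y n] assms(2)
  obtain X where X: "attached (Suc n) X (attach_blocks m V p n 0 y (gs\<^sub>0, None))"
    and c: "\<forall>w. w mod 2 = p \<and> w div 2 < y \<and>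
       y \<le> w div 2 + (if n = 0 then 1 else 3 * 2 ^ (n - 1)) \<longrightarrow> w \<in> X"
    by (auto cong: if_cong)
  obtain gs' ao where st: "attach_blocks m V p n 0 y (gs\<^sub>0, None) = (gs', ao)"
    by (cases "attach_blocks m V p n 0 y (gs\<^sub>0, None)")
  have w: "(p + 2 * (y - 1)) mod 2 = p" "(p + 2 * (y - 1)) div 2 = y - 1" using p by auto
  moreover have "1 \<le> (if n = 0 then 1 else 3 * 2 ^ (n - 1) :: nat)" by simp
  ultimately have "p + 2 * (y - 1) \<in> X"
    using c[rule_format, of "p + 2 * (y - 1)"] assms(3) by linarith
  then obtain a where a: "ao = Some a" using X unfolding st attached_def by (cases ao) auto
  show ?thesis
    using X c unfolding st a attached_def fst_conv snd_conv by (auto simp: less_Suc_eq_le)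
qed

end

section \<open>The recursive construction\<close>

text \<open>Nothing is claimed if any position before \<open>a\<close> is decisive, even one before
  the enclosing segment. This freedom lets signals reach back too far and makes shared trees
  possible.\<close>

definition prefix_correct :: "nat \<Rightarrow> nat \<Rightarrow> ((nat \<Rightarrow> bool) \<Rightarrow> bool) \<Rightarrow> bool" where
  "prefix_correct a n F \<longleftrightarrow> (\<forall>x. (\<forall>u<a. \<not> decisive x u) \<longrightarrow> F x = segment_val x n a)"

text \<open>The value \<open>odd a\<close> absorbs under the operation at \<open>a\<close>, so it
  survives all further joins within the segment. For the enclosing segment, whose operation is the
  other one, it is neutral.\<close>

definition absorbing :: "nat \<Rightarrow> nat \<Rightarrow> ((nat \<Rightarrow> bool) \<Rightarrow> bool) \<Rightarrow> bool" where
  "absorbing l a F \<longleftrightarrow>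
     (\<forall>x. (\<exists>u\<in>{l..<a}. u mod 2 = a mod 2 \<and> decisive x u) \<longrightarrow> F x = odd a)"

definition neutral :: "nat \<Rightarrow> ((nat \<Rightarrow> bool) \<Rightarrow> bool) \<Rightarrow> bool" where
  "neutral a F \<longleftrightarrow> (\<forall>x. (\<forall>u<a. \<not> decisive x u) \<longrightarrow> F x = even a)"

lemma prefix_correct_join:
  assumes "odd n" "prefix_correct a n F" "prefix_correct (a + n) k R" "absorbing a (a + n) R"
  shows "prefix_correct a (n + k) (\<lambda>x. apply_bop (parity_op a) (F x) (R x))"
  unfolding prefix_correct_def
proof (intro allI impI)
  fix x assume x: "\<forall>u<a. \<not> decisive x u"
  have 1: "R x = segment_val x k (a + n)" if "\<forall>u\<in>{a..<a + n}. \<not> decisive x u"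
  proof -
    have "\<forall>u<a + n. \<not> decisive x u" using x that by (meson atLeastLessThan_iff not_le)
    then show ?thesis using assms(3) unfolding prefix_correct_def by blast
  qed
  have 2: "R x = even a" if ex: "\<exists>u\<in>{a..<a + n}. odd (u + a) \<and> decisive x u"
  proof -
    from ex obtain u where u: "u \<in> {a..<a + n}" "odd (u + a)" "decisive x u" by blast
    have "u mod 2 = (a + n) mod 2" using u(2) assms(1) by presburger
    then have "R x = odd (a + n)" using assms(4) u unfolding absorbing_def by blast
    then show ?thesis using assms(1) by simp
  qed
  have "F x = segment_val x n a" using assms(2) x unfolding prefix_correct_def by blast
  then show "apply_bop (parity_op a) (F x) (R x) = segment_val x (n + k) a"
    using segment_val_join[OF assms(1) 1 2] by simp
qed

lemma prefix_correct_neutral: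
  assumes "prefix_correct a n F" "neutral a G"
  shows "prefix_correct a n (\<lambda>x. apply_bop (parity_op a) (F x) (G x))"
  using assms unfolding prefix_correct_def neutral_def by (auto simp: parity_op_def)

text \<open>One absorbing operand suffices, so a signal joined at any slot protects the final value
  of the segment.\<close>

lemma absorbing_join:
  assumes "absorbing l a F \<or> absorbing l a G"
  shows "absorbing l a (\<lambda>x. apply_bop (parity_op a) (F x) (G x))"
  using assms unfolding absorbing_def by (fastforce simp: parity_op_def)

lemma prefix_correct_input: "prefix_correct a 1 (\<lambda>x. x a)"
  by (simp add: prefix_correct_def parity_op_def)

text \<open>The reason why slots 0 and 1 need no signal: only the first position of the segment
  precedes them, and it has the other parity.\<close>

lemma absorbing_vacuous: "absorbing a (a + 1) F"
proof -
  have "a mod 2 \<noteq> (a + 1) mod 2" by presburger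
  then show ?thesis by (auto simp: absorbing_def)
qed

text \<open>
  The arguments of a state are the parity p of the first position of the segment, the end e of the
  segment, the next slot i, the vertex reached so far, the next position, and the pending signal s
  with its slot J, which is 0 if there is none.
\<close>

inductive chain ::
  "nat \<Rightarrow> (nat \<Rightarrow> nat) \<Rightarrow> nat \<Rightarrow> gate list \<Rightarrow> nat \<Rightarrow> nat \<Rightarrow> nat \<Rightarrow> nat \<Rightarrow> nat \<Rightarrow> nat \<Rightarrow> nat \<Rightarrow>
     gate list \<Rightarrow> nat \<Rightarrow> nat \<Rightarrow> bool"
  for m :: nat and V :: "nat \<Rightarrow> nat" and d :: nat where
  chain_done: "chain m V d gs p e i acc e 0 s gs acc 0"
| chain_signal:
    "\<lbrakk>0 < J; pos = e \<or> J \<le> i;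
      chain m V d (gs @ [(parity_op p, acc, s)]) p e (Suc i) (m + length gs) pos 0 s gs' r k\<rbrakk>
     \<Longrightarrow> chain m V d gs p e i acc pos J s gs' r (Suc k)"
| chain_single:
    "\<lbrakk>i < 2; J = 0 \<or> i < J; pos + 1 = e;
      chain m V d (gs @ [(parity_op p, acc, pos)]) p e (Suc i) (m + length gs) (pos + 1) J s gs' r k\<rbrakk>
     \<Longrightarrow> chain m V d gs p e i acc pos J s gs' r (Suc k)"
| chain_pair:
    "\<lbrakk>i < 2; J = 0 \<or> i < J; pos + 1 < e;
      chain m V d (gs @ [(parity_op (1 - p), pos, pos + 1), (parity_op p, acc, m + length gs)])
        p e 2 (m + length gs + 1) (pos + 2) J s gs' r k\<rbrakk>
     \<Longrightarrow> chain m V d gs p e i acc pos J s gs' r (Suc k)"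
| chain_slot:
    "\<lbrakk>2 \<le> i; i < d; J = 0 \<or> i < J; pos < e;
      e' = (if e \<le> pos + slot_cap i then e else pos + slot_len i);
      attach_blocks m V (1 - p) (slot_lev i) 0 (pos div 2) (gs, None) = (gs\<^sub>1, Some s');
      chain m V d gs\<^sub>1 (1 - p) e' 0 pos (pos + 1) (Suc (slot_lev i)) s' gs\<^sub>2 r' k\<^sub>1;
      chain m V d (gs\<^sub>2 @ [(parity_op p, acc, r')]) p e (Suc i) (m + length gs\<^sub>2) e' J s gs' r k\<^sub>2\<rbrakk>
     \<Longrightarrow> chain m V d gs p e i acc pos J s gs' r (k\<^sub>1 + k\<^sub>2 + 2)"

lemma slot_lev_pos: "3 \<le> i \<Longrightarrow> 0 < slot_lev i"
proof (induction i rule: dec_induct)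
  case (step i)
  then show ?case using slot_lev_step(1)[of i] by simp
qed simp

lemma Suc_slot_lev_less: "2 \<le> i \<Longrightarrow> Suc (slot_lev i) < i"
proof (cases "5 \<le> i")
  case True
  then show ?thesis using slot_len_rec(2)[OF True] by simp
next
  case False
  assume "2 \<le> i"
  with False have "i = 2 \<or> i = 3 \<or> i = 4" by auto
  then show ?thesis by auto
qed

text \<open>Only every other position between \<open>a\<close> and \<open>pos\<close> has the parity
  of \<open>pos\<close>, and \<open>a\<close> itself does not. So at most \<open>slot_pre i\<close>
  div 2 positions must be covered, and \<open>slot_pre_le_lev\<close> matches the reach of
  \<open>attach_blocks\<close>. Level 0 occurs for slot 2 only, with a single position to
  cover.\<close>

lemma slot_signal:
  assumes trees: "tree_vertices m V gs" and sound: "sound m d gs"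
    and i: "2 \<le> i" "i < d" and pos: "a < pos" "pos < m" "odd (pos - a)" "pos - a \<le> Suc (slot_pre i)"
    and p: "p = a mod 2" and pos2: "2 \<le> pos"
  obtains gs' s G where
    "attach_blocks m V (1 - p) (slot_lev i) 0 (pos div 2) (gs, None) = (gs', Some s)"
    "\<exists>hs. gs' = gs @ hs \<and> length hs \<le> slot_lev i" "sound m d gs'"
    "realizes m gs' s G (Suc (slot_lev i))" "absorbing a pos G" "neutral pos G" "s \<noteq> pos"
proof -
  have p': "1 - p = pos mod 2" "1 - p < 2"
    using pos(1,3) unfolding p by presburger+
  have y: "1 - p + 2 * (pos div 2) \<le> m + 1" "0 < pos div 2" using p' pos pos2 by simp_all
  have "slot_lev i < d" using Suc_slot_lev_less[OF i(1)] i(2) by simp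
  from attach_blocks_correct[OF trees p'(2) y(1) sound this y(2)] obtain gs' s X where
    run: "attach_blocks m V (1 - p) (slot_lev i) 0 (pos div 2) (gs, None) = (gs', Some s)"
    and gs': "\<exists>hs. gs' = gs @ hs \<and> length hs \<le> slot_lev i" "sound m d gs'"
    and s: "realizes m gs' s (agg (1 - p) X) (Suc (slot_lev i))"
    and X: "X \<noteq> {}" "X \<subseteq> {w. w mod 2 = 1 - p \<and> w div 2 < pos div 2}"
    and cover: "\<forall>w. w mod 2 = 1 - p \<and> w div 2 < pos div 2 \<and>
       pos div 2 \<le> w div 2 + (if slot_lev i = 0 then 1 else 3 * 2 ^ (slot_lev i - 1)) \<longrightarrow> w \<in> X"
    by blast
  have Xpos: "u < pos \<and> even u = even pos" if "u \<in> X" for u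
  proof -
    have "u mod 2 = pos mod 2" "u div 2 < pos div 2" using X(2) that p'(1) by auto
    then show ?thesis by presburger
  qed
  have par: "agg (1 - p) X = agg pos X" by (rule fun_cong[OF agg_parity]) (use p'(1) in presburger)
  have lev: "pos - a \<le> 1 + 2 * (if slot_lev i = 0 then 1 else 3 * 2 ^ (slot_lev i - 1))"
  proof (cases "slot_lev i")
    case 0
    then have "i = 2" using slot_lev_pos[of i] i(1) by (cases "3 \<le> i") auto
    then show ?thesis using pos(4) 0 by simp
  next
    case (Suc l)
    then show ?thesis using pos(4) slot_pre_le_lev[OF i(1)] by simp
  qed
  show ?thesis
  proof (rule that[OF run gs'])
    show "realizes m gs' s (agg pos X) (Suc (slot_lev i))" using s unfolding par .
    show "neutral pos (agg pos X)"
      unfolding neutral_def using agg_indecisive[OF _ X(1)] Xpos by blast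
    show "absorbing a pos (agg pos X)"
      unfolding absorbing_def
    proof (intro allI impI)
      fix x assume "\<exists>u\<in>{a..<pos}. u mod 2 = pos mod 2 \<and> decisive x u"
      then obtain u where u: "a \<le> u" "u < pos" "u mod 2 = pos mod 2" "decisive x u" by auto
      have "even u = even pos" using u(3) by (metis even_iff_mod_2_eq_zero)
      moreover have "even a \<noteq> even pos" using pos(1,3) by auto
      ultimately have "u \<noteq> a" by blast
      then have "pos - u \<le> 2 * (if slot_lev i = 0 then 1 else 3 * 2 ^ (slot_lev i - 1))"
        using lev u(1,2) pos(1) by linarith
      then have "pos div 2 \<le> u div 2 + (if slot_lev i = 0 then 1 else 3 * 2 ^ (slot_lev i - 1))"
        using u(2) by linarith
      moreover have "u div 2 < pos div 2"
        using u(2,3) div_mult_mod_eq[of u 2] div_mult_mod_eq[of pos 2] by linarith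
      ultimately have "u \<in> X" using cover u(3) p'(1) by simp
      then show "agg pos X x = odd pos" using agg_decisive[of u X pos x] Xpos u(4) by blast
    qed
    show "s \<noteq> pos"
    proof
      assume eq: "s = pos"
      have "agg (1 - p) X = (\<lambda>x. x pos)"
        by (rule realizes_unique[OF s[unfolded eq] realizes_input[OF pos(2), of gs' 0]])
      also have "\<dots> = agg (1 - p) {pos}" by (intro ext) (simp add: agg_def)
      finally show False using agg_inj[of "1 - p" X "{pos}"] Xpos by blast
    qed
  qed
qed

text \<open>
  The invariant of a state: a is the first position of the segment, l a lower bound for the positions
  that the signal has to cover, and D the depth available for the segment.
\<close>

definition chain_inv ::
  "nat \<Rightarrow> (nat \<Rightarrow> nat) \<Rightarrow> nat \<Rightarrow> nat \<Rightarrow> nat \<Rightarrow> nat \<Rightarrow> gate list \<Rightarrow> nat \<Rightarrow> nat \<Rightarrow> nat \<Rightarrow> nat \<Rightarrow> nat \<Rightarrow> nat \<Rightarrow>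
     nat \<Rightarrow> bool" where
  "chain_inv m V d D l a gs p e i acc pos J s \<longleftrightarrow>
     tree_vertices m V gs \<and> sound m d gs \<and> D \<le> d \<and> p = a mod 2 \<and>
     a < pos \<and> pos \<le> e \<and> e \<le> m \<and> e - pos \<le> room (D - i) i J \<and> (J = 1 \<longrightarrow> e \<le> pos + 1) \<and>
     (pos < e \<longrightarrow> odd (pos - a) \<and> pos - a \<le> Suc (slot_pre i) \<and> (0 < J \<or> 2 \<le> i \<longrightarrow> 2 \<le> pos)) \<and>
     (\<exists>F k. realizes m gs acc F k \<and> k \<le> D \<and> (pos < e \<or> 0 < J \<longrightarrow> k \<le> i) \<and>
       prefix_correct a (pos - a) F \<and> (J = 0 \<longrightarrow> absorbing l a F)) \<and>
     (0 < J \<longrightarrow> i \<le> J \<and> J < D \<and> acc \<noteq> s \<and>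
       (\<exists>G. realizes m gs s G J \<and> absorbing l a G \<and> neutral a G))"

text \<open>Three conditions deserve an explanation. A signal in slot 1 rules out a pair, so at most
  one position may be left. \<open>2 <= pos\<close> ensures that an earlier position of the parity
  of \<open>pos\<close> exists, so that its signal is not empty. The prefix length is only bounded
  by \<open>Suc (slot_pre i)\<close>, as one of the slots may have gone to the signal.\<close>

lemma chain_invI:
  assumes "tree_vertices m V gs" "sound m d gs" "D \<le> d" "p = a mod 2" "a < pos" "pos \<le> e" "e \<le> m"
    and "e - pos \<le> room (D - i) i J" "J = 1 \<Longrightarrow> e \<le> pos + 1"
    and "pos < e \<Longrightarrow> odd (pos - a)" "pos < e \<Longrightarrow> pos - a \<le> Suc (slot_pre i)"
    and "pos < e \<Longrightarrow> 0 < J \<or> 2 \<le> i \<Longrightarrow> 2 \<le> pos"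
    and "realizes m gs acc F k" "k \<le> D" "pos < e \<or> 0 < J \<Longrightarrow> k \<le> i"
    and "prefix_correct a (pos - a) F" "J = 0 \<Longrightarrow> absorbing l a F"
    and "0 < J \<Longrightarrow> i \<le> J \<and> J < D \<and> acc \<noteq> s \<and>
       (\<exists>G. realizes m gs s G J \<and> absorbing l a G \<and> neutral a G)"
  shows "chain_inv m V d D l a gs p e i acc pos J s"
  unfolding chain_inv_def using assms by blast

section \<open>Preservation of the invariant by the moves\<close>

lemma room_slot:
  assumes "i < D" "\<not> (0 < J \<and> i = J)"
  shows "room (D - i) i J = max (slot_cap i) (slot_len i + room (D - Suc i) (Suc i) J)"
  using assms by (subst room_step) auto

lemma room_pos: "0 < n \<Longrightarrow> n \<le> room (D - i) i J \<Longrightarrow> i < D"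
  by (cases "i < D") auto

text \<open>If the positions are used up, the signal is joined ahead of its slot and the depth may
  exceed \<open>Suc i\<close>. The invariant then asks only for depth at most \<open>D\<close>,
  which \<open>J < D\<close> provides.\<close>

lemma chain_inv_signal:
  assumes inv: "chain_inv m V d D l a gs p e i acc pos J s" and J: "0 < J" "pos = e \<or> J \<le> i"
  shows "chain_inv m V d D l a (gs @ [(parity_op p, acc, s)]) p e (Suc i) (m + length gs) pos 0 s"
proof -
  note I = inv[unfolded chain_inv_def]
  obtain F k where F: "realizes m gs acc F k" "k \<le> i" "prefix_correct a (pos - a) F"
    using I J(1) by blast
  obtain G where G: "realizes m gs s G J" "absorbing l a G" "neutral a G"
    and iJ: "i \<le> J" "J < D" "acc \<noteq> s"
    using I J(1) by blast
  have p: "p = a mod 2" and D: "D \<le> d" and le: "pos \<le> e" using I by blast+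
  have op: "parity_op p = parity_op a" unfolding p by (simp add: parity_op_def)
  let ?gs = "gs @ [(parity_op p, acc, s)]"
  let ?F = "\<lambda>x. apply_bop (parity_op a) (F x) (G x)"
  have R: "realizes m ?gs (m + length gs) ?F (Suc (max k J))"
    using realizes_gate[OF F(1) G(1), of "parity_op p"] unfolding op .
  have S: "sound m d ?gs"
    by (rule sound_gate[OF _ F(1) G(1)]) (use I F iJ D in auto)
  have d1: "Suc (max k J) \<le> D" using F(2) iJ by simp
  have d2: "Suc (max k J) \<le> Suc i" if "pos < e" using that J(2) F(2) iJ(1) by auto
  have rm: "e - pos \<le> room (D - Suc i) (Suc i) 0"
  proof (cases "pos = e")
    case False
    then have "i = J" using J iJ by auto
    then have "room (D - i) i J = room (D - Suc i) (Suc i) 0"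
      using J(1) iJ by (subst room_step) auto
    moreover have "e - pos \<le> room (D - i) i J" using I by blast
    ultimately show ?thesis by simp
  qed simp
  have pc: "prefix_correct a (pos - a) ?F" using prefix_correct_neutral[OF F(3) G(3)] .
  have ab: "absorbing l a ?F" using absorbing_join G(2) by blast
  have T: "tree_vertices m V ?gs" using tree_vertices_append I by blast
  have o: "pos < e \<Longrightarrow> odd (pos - a)" "pos < e \<Longrightarrow> pos - a \<le> Suc (slot_pre i)"
    and b: "a < pos" "e \<le> m" and b2: "pos < e \<Longrightarrow> 2 \<le> pos"
    using I J(1) by blast+
  have o': "pos < e \<Longrightarrow> pos - a \<le> Suc (slot_pre (Suc i))" using o(2) by simp
  show ?thesis
    by (rule chain_invI[OF T S D p b(1) le b(2) rm _ o(1) o' b2 R d1 _ pc ab]) (use d2 in simp_all)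
qed

lemma chain_inv_single:
  assumes inv: "chain_inv m V d D l a gs p e i acc pos J s"
    and i: "i < 2" "J = 0 \<or> i < J" "pos + 1 = e"
  shows "chain_inv m V d D l a (gs @ [(parity_op p, acc, pos)]) p e (Suc i) (m + length gs) (pos + 1) J s"
proof -
  note I = inv[unfolded chain_inv_def]
  have pe: "pos < e" using i(3) by simp
  obtain F k where F: "realizes m gs acc F k" "k \<le> i" "k \<le> D" "prefix_correct a (pos - a) F"
    and abs: "J = 0 \<longrightarrow> absorbing l a F"
    using I pe by blast
  have p: "p = a mod 2" and D: "D \<le> d" and e: "e \<le> m" and apos: "a < pos" using I by blast+
  have "slot_pre i = 0" using i(1) by (cases i) auto
  moreover have "pos - a \<le> Suc (slot_pre i)" using I pe by blast
  ultimately have pos: "pos = a + 1" using apos by linarith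
  have op: "parity_op p = parity_op a" unfolding p by (simp add: parity_op_def)
  have "e - pos \<le> room (D - i) i J" using I by blast
  then have iD: "i < D" using room_pos[of "e - pos" D i J] pe by simp
  let ?gs = "gs @ [(parity_op p, acc, pos)]"
  let ?F = "\<lambda>x. apply_bop (parity_op a) (F x) (x pos)"
  have X: "realizes m gs pos (\<lambda>x. x pos) 0" by (rule realizes_input) (use i(3) e in simp)
  \<comment> \<open>Under the assignment \<open>even\<close> no position is decisive, so
    \<open>F\<close> must have the value \<open>even a\<close> there, whereas the input
    \<open>pos = a + 1\<close> has the opposite value.\<close>
  have ne: "acc \<noteq> pos"
  proof
    assume eq: "acc = pos"
    have *: "F = (\<lambda>x. x pos)" using realizes_unique[OF F(1)] X eq by blast
    have "F even = segment_val even 1 a"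
      using F(4) pos unfolding prefix_correct_def by (simp add: decisive_def)
    then show False using pos unfolding * by (auto simp: parity_op_def)
  qed
  have R: "realizes m ?gs (m + length gs) ?F (Suc k)"
    using realizes_gate[OF F(1) X, of "parity_op p"] unfolding op by simp
  have S: "sound m d ?gs"
    by (rule sound_gate[OF _ F(1) X ne]) (use I in blast, use F iD D in simp_all)
  have pos_eq: "a + (pos - a) = pos" "pos - a + 1 = pos + 1 - a" using pos by simp_all
  have j1: "prefix_correct (a + (pos - a)) 1 (\<lambda>x. x pos)"
    unfolding pos_eq(1) by (rule prefix_correct_input)
  have j2: "absorbing a (a + (pos - a)) (\<lambda>x. x pos)"
    unfolding pos_eq(1) unfolding pos by (rule absorbing_vacuous)
  have j3: "odd (pos - a)" using pos by simp
  have pc: "prefix_correct a (pos + 1 - a) ?F"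
    unfolding pos_eq(2)[symmetric] by (rule prefix_correct_join[OF j3 F(4) j1 j2])
  have ab: "absorbing l a ?F" if "J = 0"
    by (rule absorbing_join) (use abs that in simp)
  have T: "tree_vertices m V ?gs" using tree_vertices_append I by blast
  have sg: "Suc i \<le> J \<and> J < D \<and> m + length gs \<noteq> s \<and>
      (\<exists>G. realizes m ?gs s G J \<and> absorbing l a G \<and> neutral a G)" if J: "0 < J"
  proof -
    obtain G where G: "realizes m gs s G J" "absorbing l a G" "neutral a G" and JD: "J < D"
      using I J by blast
    then show ?thesis using realizes_append[OF G(1)] realizes_less[OF G(1)] i(2) J by auto
  qed
  have k: "Suc k \<le> D" "Suc k \<le> Suc i" using F(2) iD by simp_all
  show ?thesis
    by (rule chain_invI[OF T S D p _ _ e _ _ _ _ _ R k(1) _ pc ab sg]) (use apos i(3) k in simp_all)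
qed

lemma chain_inv_pair:
  assumes inv: "chain_inv m V d D l a gs p e i acc pos J s"
    and i: "i < 2" "J = 0 \<or> i < J" "pos + 1 < e"
  shows "chain_inv m V d D l a
    (gs @ [(parity_op (1 - p), pos, pos + 1), (parity_op p, acc, m + length gs)])
    p e 2 (m + length gs + 1) (pos + 2) J s"
proof -
  note I = inv[unfolded chain_inv_def]
  have pe: "pos < e" using i(3) by simp
  obtain F k where F: "realizes m gs acc F k" "k \<le> i" "k \<le> D" "prefix_correct a (pos - a) F"
    and abs: "J = 0 \<longrightarrow> absorbing l a F"
    using I pe by blast
  have p: "p = a mod 2" and D: "D \<le> d" and e: "e \<le> m" and apos: "a < pos" using I by blast+
  have "slot_pre i = 0" using i(1) by (cases i) auto
  moreover have "pos - a \<le> Suc (slot_pre i)" using I pe by blast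
  ultimately have pos: "pos = a + 1" using apos by linarith
  have "J = 1 \<longrightarrow> e \<le> pos + 1" using I by blast
  then have J1: "J \<noteq> 1" using i(3) by linarith
  have op: "parity_op p = parity_op a" "parity_op (1 - p) = parity_op pos"
    unfolding p pos by (auto simp: parity_op_def mod2_eq_if)
  have rm0: "e - pos \<le> room (D - i) i J" using I by blast
  have iD: "i < D" using rm0 i(3) room_pos[of "e - pos" D i J] by simp
  \<comment> \<open>The pair has depth 1 and is joined in slot 1. If slot 0 is still free it is
    passed over, as its capacity 1 cannot account for two positions.\<close>
  have rm1: "1 < D \<and> e - pos \<le> room (D - 1) 1 J"
  proof (cases i)
    case 0
    then have "e - pos \<le> room (D - 1) 1 J"
      using rm0 i(3) room_slot[of 0 D J] iD 0 by (cases "J = 0") simp_all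
    then show ?thesis using room_pos[of "e - pos" D 1 J] i(3) by simp
  next
    case (Suc j)
    then have "i = 1" using i(1) by simp
    then show ?thesis using rm0 iD by simp
  qed
  have rm2: "e - (pos + 2) \<le> room (D - 2) 2 J"
  proof -
    have "room (D - 1) 1 J = 2 + room (D - 2) 2 J"
      using rm1 room_slot[of 1 D J] J1 by (simp add: numeral_2_eq_2)
    then show ?thesis using rm1 by linarith
  qed
  let ?g1 = "(parity_op (1 - p), pos, pos + 1)"
  let ?g2 = "(parity_op p, acc, m + length gs)"
  let ?R = "\<lambda>x. apply_bop (parity_op pos) (x pos) (x (pos + 1))"
  let ?F = "\<lambda>x. apply_bop (parity_op a) (F x) (?R x)"
  have X: "realizes m gs pos (\<lambda>x. x pos) 0" "realizes m gs (pos + 1) (\<lambda>x. x (pos + 1)) 0"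
    by (rule realizes_input, use i(3) e in simp)+
  have R1: "realizes m (gs @ [?g1]) (m + length gs) ?R 1"
    using realizes_gate[OF X, of "parity_op (1 - p)"] unfolding op by simp
  have S1: "sound m d (gs @ [?g1])"
    by (rule sound_gate[OF _ X]) (use I in blast, use rm1 D in simp_all)
  have F1: "realizes m (gs @ [?g1]) acc F k" by (rule realizes_append[OF F(1)])
  have R2: "realizes m ((gs @ [?g1]) @ [?g2]) (m + length (gs @ [?g1])) ?F (Suc (max k 1))"
    using realizes_gate[OF F1 R1, of "parity_op p"] unfolding op .
  have S2: "sound m d ((gs @ [?g1]) @ [?g2])"
    by (rule sound_gate[OF S1 F1 R1]) (use F realizes_less[OF F(1)] rm1 iD i D in simp_all)
  have "prefix_correct (pos + 1) 1 (\<lambda>x. x (pos + 1))" by (rule prefix_correct_input)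
  from prefix_correct_join[OF _ prefix_correct_input this absorbing_vacuous]
  have pc2: "prefix_correct pos 2 ?R" by (simp add: numeral_2_eq_2)
  have pos_eq: "a + (pos - a) = pos" "pos - a + 2 = pos + 2 - a" using pos by simp_all
  have j1: "prefix_correct (a + (pos - a)) 2 ?R"
    unfolding pos_eq(1) by (rule pc2)
  have j2: "absorbing a (a + (pos - a)) ?R"
    unfolding pos_eq(1) unfolding pos by (rule absorbing_vacuous)
  have j3: "odd (pos - a)" using pos by simp
  have pc: "prefix_correct a (pos + 2 - a) ?F"
    unfolding pos_eq(2)[symmetric] by (rule prefix_correct_join[OF j3 F(4) j1 j2])
  have ab: "absorbing l a ?F" if "J = 0"
    by (rule absorbing_join) (use abs that in simp)
  let ?gs = "(gs @ [?g1]) @ [?g2]"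
  have T: "tree_vertices m V ?gs"
    using tree_vertices_append[OF tree_vertices_append] I by blast
  have sg: "2 \<le> J \<and> J < D \<and> m + length (gs @ [?g1]) \<noteq> s \<and>
      (\<exists>G. realizes m ?gs s G J \<and> absorbing l a G \<and> neutral a G)" if J: "0 < J"
  proof -
    obtain G where G: "realizes m gs s G J" "absorbing l a G" "neutral a G" and JD: "J < D"
      using I J by blast
    have "realizes m ?gs s G J" by (rule realizes_append[OF realizes_append[OF G(1)]])
    then have "\<exists>G. realizes m ?gs s G J \<and> absorbing l a G \<and> neutral a G" using G(2,3) by blast
    moreover have "m + length (gs @ [?g1]) \<noteq> s" using realizes_less[OF G(1)] by simp
    moreover have "2 \<le> J" using J J1 by linarith
    ultimately show ?thesis using JD by blast
  qed
  have k: "Suc (max k 1) \<le> D" "Suc (max k 1) \<le> 2" using F(2) i(1) rm1 by simp_all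
  have "odd (pos + 2 - a)" "pos + 2 - a \<le> Suc (slot_pre 2)" using pos by simp_all
  then have "chain_inv m V d D l a ?gs p e 2 (m + length (gs @ [?g1])) (pos + 2) J s"
    by (intro chain_invI[OF T S2 D p _ _ e rm2 _ _ _ _ R2 k(1) _ pc ab sg])
      (use apos i(3) k J1 in simp_all)
  then show ?thesis by simp
qed

lemma chain_inv_child:
  assumes inv: "chain_inv m V d D l a gs p e i acc pos J s"
    and i: "2 \<le> i" "i < D" and pe: "pos < e"
    and e': "e' = (if e \<le> pos + slot_cap i then e else pos + slot_len i)"
    and gs': "\<exists>hs. gs' = gs @ hs" "sound m d gs'"
    and s': "realizes m gs' s' G (Suc (slot_lev i))" "absorbing a pos G" "neutral pos G" "s' \<noteq> pos"
  shows "chain_inv m V d i a pos gs' (1 - p) e' 0 pos (pos + 1) (Suc (slot_lev i)) s'"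
proof -
  note I = inv[unfolded chain_inv_def]
  have p: "p = a mod 2" and D: "D \<le> d" and e: "e \<le> m" and odd: "odd (pos - a)" and apos: "a < pos"
    using I pe by blast+
  have T: "tree_vertices m V gs'" using gs'(1) I tree_vertices_append by blast
  have p': "1 - p = pos mod 2" using odd apos unfolding p by presburger
  have len: "2 \<le> slot_len i" using slot_len_pos[of i] i(1) by simp
  have e1: "pos + 1 \<le> e'" "e' \<le> e" "e' \<le> pos + slot_cap i"
    using len pe slot_cap_bounds[of i] unfolding e' by auto
  have rm: "e' - (pos + 1) \<le> room (i - 0) 0 (Suc (slot_lev i))"
    using e1(3) slot_cap_le_room[OF i(1)] by simp
  \<comment> \<open>The signal takes slot 1 only for \<open>i = 2\<close>, and the capacity 2 of
    that slot leaves one position after the first.\<close>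
  have J1: "e' \<le> pos + 1 + 1" if "Suc (slot_lev i) = 1"
  proof -
    have "i = 2" using that slot_lev_pos[of i] i(1) by (cases "3 \<le> i") auto
    then show ?thesis using e1(3) by simp
  qed
  have X: "realizes m gs' pos (\<lambda>x. x pos) 0" by (rule realizes_input) (use pe e in simp)
  have "prefix_correct pos (pos + 1 - pos) (\<lambda>x. x pos)" using prefix_correct_input[of pos] by simp
  moreover have "0 \<le> Suc (slot_lev i) \<and> Suc (slot_lev i) < i \<and> pos \<noteq> s' \<and>
      (\<exists>G. realizes m gs' s' G (Suc (slot_lev i)) \<and> absorbing a pos G \<and> neutral pos G)"
    using s' Suc_slot_lev_less[OF i(1)] by blast
  ultimately show ?thesis
    by (intro chain_invI[OF T gs'(2) _ p' _ e1(1) _ rm J1 _ _ _ X]) (use i D e e1(2) apos in simp_all)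
qed

lemma chain_inv_slot:
  assumes inv: "chain_inv m V d D l a gs p e i acc pos J s"
    and i: "2 \<le> i" "i < D" "J = 0 \<or> i < J" and pe: "pos < e"
    and e': "e' = (if e \<le> pos + slot_cap i then e else pos + slot_len i)"
    and gs': "\<exists>hs. gs' = gs @ hs" "sound m d gs'"
    and r: "realizes m gs' r R i" "prefix_correct pos (e' - pos) R" "absorbing a pos R"
      "m + length gs \<le> r"
  shows "chain_inv m V d D l a (gs' @ [(parity_op p, acc, r)]) p e (Suc i) (m + length gs') e' J s"
proof -
  note I = inv[unfolded chain_inv_def]
  obtain F k where F: "realizes m gs acc F k" "k \<le> i" "k \<le> D" "prefix_correct a (pos - a) F"
    and abs: "J = 0 \<longrightarrow> absorbing l a F"
    using I pe by blast
  have p: "p = a mod 2" and D: "D \<le> d" and e: "e \<le> m" and odd: "odd (pos - a)" and apos: "a < pos"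
    and pre: "pos - a \<le> Suc (slot_pre i)" and rm0: "e - pos \<le> room (D - i) i J"
    using I pe by blast+
  have op: "parity_op p = parity_op a" unfolding p by (simp add: parity_op_def)
  have len: "2 \<le> slot_len i" using slot_len_pos[of i] i(1) by simp
  have e1: "pos < e'" "e' \<le> e" using len pe slot_cap_bounds[of i] unfolding e' by auto
  have full: "e' = pos + slot_len i" if "e' < e" using that unfolding e' by (auto split: if_splits)
  have rm: "e - e' \<le> room (D - Suc i) (Suc i) J"
  proof (cases "e \<le> pos + slot_cap i")
    case True
    then show ?thesis unfolding e' by simp
  next
    case False
    have "room (D - i) i J = max (slot_cap i) (slot_len i + room (D - Suc i) (Suc i) J)"
      by (rule room_slot) (use i in auto)
    then show ?thesis using rm0 False unfolding e' by auto
  qed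
  obtain hs where hs: "gs' = gs @ hs" using gs'(1) by blast
  let ?gs = "gs' @ [(parity_op p, acc, r)]"
  let ?F = "\<lambda>x. apply_bop (parity_op a) (F x) (R x)"
  have F': "realizes m gs' acc F k" unfolding hs by (rule realizes_append[OF F(1)])
  have ne: "acc \<noteq> r" using realizes_less[OF F(1)] r(4) by simp
  have RR: "realizes m ?gs (m + length gs') ?F (Suc (max k i))"
    using realizes_gate[OF F' r(1), of "parity_op p"] unfolding op .
  have S: "sound m d ?gs"
    by (rule sound_gate[OF gs'(2) F' r(1) ne]) (use F(2) i D in simp_all)
  have T: "tree_vertices m V ?gs"
    unfolding hs using tree_vertices_append[OF tree_vertices_append] I by blast
  have pos_eq: "a + (pos - a) = pos" "pos - a + (e' - pos) = e' - a" using apos e1 by simp_all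
  have j1: "prefix_correct (a + (pos - a)) (e' - pos) R" unfolding pos_eq(1) by (rule r(2))
  have j2: "absorbing a (a + (pos - a)) R" unfolding pos_eq(1) by (rule r(3))
  have pc: "prefix_correct a (e' - a) ?F"
    unfolding pos_eq(2)[symmetric] by (rule prefix_correct_join[OF odd F(4) j1 j2])
  have ab: "absorbing l a ?F" if "J = 0"
    by (rule absorbing_join) (use abs that in simp)
  have sg: "Suc i \<le> J \<and> J < D \<and> m + length gs' \<noteq> s \<and>
      (\<exists>G. realizes m ?gs s G J \<and> absorbing l a G \<and> neutral a G)" if J: "0 < J"
  proof -
    obtain G where G: "realizes m gs s G J" "absorbing l a G" "neutral a G" and JD: "J < D"
      using I J by blast
    have "realizes m ?gs s G J" unfolding hs by (rule realizes_append[OF realizes_append[OF G(1)]])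
    then have "\<exists>G. realizes m ?gs s G J \<and> absorbing l a G \<and> neutral a G" using G(2,3) by blast
    moreover have "m + length gs' \<noteq> s" using realizes_less[OF G(1)] hs by simp
    ultimately show ?thesis using JD i(3) J by simp
  qed
  \<comment> \<open>If positions remain, the slot was filled with exactly \<open>slot_len i\<close>
    positions, an even number.\<close>
  have o: "odd (e' - a)" if "e' < e"
  proof -
    have "e' - a = pos - a + slot_len i" using full[OF that] apos by simp
    then show ?thesis using odd slot_len_even[of i] by simp
  qed
  have o': "e' - a \<le> Suc (slot_pre (Suc i))" if "e' < e"
    using full[OF that] pre apos by simp
  have k: "Suc (max k i) \<le> D" "Suc (max k i) \<le> Suc i" using F(2) i(2) by simp_all
  have J1: "e \<le> e' + 1" if "J = 1" using that i by simp
  show ?thesis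
    by (rule chain_invI[OF T S D p _ e1(2) e rm J1 o o' _ RR k(1) k(2) pc ab sg])
      (use apos e1 in simp_all)
qed

text \<open>A position weighs 2 in the measure, since a child receives a pending signal in exchange
  for its first position. The clause that \<open>r\<close> is a new vertex makes it differ from the
  accumulated vertex with which the caller joins it. A slot needs one move to open, one to close,
  and one for its signal, hence 3 moves per position.\<close>

theorem chain_exists:
  assumes "chain_inv m V d D l a gs p e i acc pos J s"
  shows "\<exists>gs' r k F. chain m V d gs p e i acc pos J s gs' r k \<and> (\<exists>hs. gs' = gs @ hs) \<and>
    sound m d gs' \<and> realizes m gs' r F D \<and> prefix_correct a (e - a) F \<and> absorbing l a F \<and>
    (r = acc \<and> J = 0 \<or> m + length gs \<le> r) \<and>
    length gs' \<le> length gs + slot_cost i (e - pos) J \<and>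
    k \<le> 3 * (e - pos) + (if 0 < J then 1 else 0)"
  using assms
proof (induction "2 * (e - pos) + (if 0 < J then 1 else 0)"
    arbitrary: D l a gs p e i acc pos J s rule: less_induct)
  case less
  note inv = less.prems
  note I = inv[unfolded chain_inv_def]
  have le: "pos \<le> e" using I by blast
  consider (signal) "0 < J" "pos = e \<or> J \<le> i" | (finished) "J = 0" "pos = e"
    | (single) "J = 0 \<or> i < J" "i < 2" "pos + 1 = e" | (pair) "J = 0 \<or> i < J" "i < 2" "pos + 1 < e"
    | (slot) "J = 0 \<or> i < J" "2 \<le> i" "pos < e"
    using le by linarith
  then show ?case
  proof cases
    case signal
    let ?gs = "gs @ [(parity_op p, acc, s)]"
    have "2 * (e - pos) + (if 0 < (0::nat) then 1 else 0) < 2 * (e - pos) + (if 0 < J then 1 else 0)"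
      using signal by simp
    from less.hyps[OF this chain_inv_signal[OF inv signal]]
    obtain gs' r k F where c: "chain m V d ?gs p e (Suc i) (m + length gs) pos 0 s gs' r k"
      and h: "\<exists>hs. gs' = ?gs @ hs" and R: "sound m d gs'" "realizes m gs' r F D"
        "prefix_correct a (e - a) F" "absorbing l a F"
      and r: "r = m + length gs \<or> m + length ?gs \<le> r"
      and len: "length gs' \<le> length ?gs + slot_cost (Suc i) (e - pos) 0"
      and k: "k \<le> 3 * (e - pos)" by auto
    have "chain m V d gs p e i acc pos J s gs' r (Suc k)" by (rule chain_signal[OF signal c])
    moreover have "\<exists>hs. gs' = gs @ hs" using h by auto
    moreover have "slot_cost i (e - pos) J = Suc (slot_cost (Suc i) (e - pos) 0)"
      using signal by (subst slot_cost.simps) auto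
    then have "length gs' \<le> length gs + slot_cost i (e - pos) J" using len by simp
    moreover have "m + length gs \<le> r" using r by auto
    ultimately show ?thesis using R k signal(1) by (intro exI[of _ gs'] exI[of _ r] exI[of _ "Suc k"] exI[of _ F]) simp
  next
    case finished
    obtain F k where F: "realizes m gs acc F k" "k \<le> D" "prefix_correct a (pos - a) F" "absorbing l a F"
      using I finished(1) by blast
    have "sound m d gs" using I by blast
    moreover have "realizes m gs acc F D" using realizes_mono[OF F(1,2)] .
    ultimately show ?thesis
      using chain_done[of m V d gs p e i acc s] F finished
      by (intro exI[of _ gs] exI[of _ acc] exI[of _ 0] exI[of _ F]) simp
  next
    case single
    let ?gs = "gs @ [(parity_op p, acc, pos)]"
    have "2 * (e - (pos + 1)) + (if 0 < J then 1 else 0) < 2 * (e - pos) + (if 0 < J then 1 else 0)"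
      using single by simp
    from less.hyps[OF this chain_inv_single[OF inv single(2,1,3)]]
    obtain gs' r k F where c: "chain m V d ?gs p e (Suc i) (m + length gs) (pos + 1) J s gs' r k"
      and h: "\<exists>hs. gs' = ?gs @ hs" and R: "sound m d gs'" "realizes m gs' r F D"
        "prefix_correct a (e - a) F" "absorbing l a F"
      and r: "r = m + length gs \<or> m + length ?gs \<le> r"
      and len: "length gs' \<le> length ?gs + slot_cost (Suc i) (e - (pos + 1)) J"
      and k: "k \<le> 3 * (e - (pos + 1)) + (if 0 < J then 1 else 0)" by blast
    have "chain m V d gs p e i acc pos J s gs' r (Suc k)"
      by (rule chain_single[OF single(2,1,3) c])
    moreover have "\<exists>hs. gs' = gs @ hs" using h by auto
    moreover have "slot_cost i (e - pos) J = Suc (slot_cost (Suc i) (e - (pos + 1)) J)"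
      using single by (subst slot_cost.simps) auto
    then have "length gs' \<le> length gs + slot_cost i (e - pos) J" using len by simp
    moreover have "m + length gs \<le> r" using r by auto
    moreover have "Suc k \<le> 3 * (e - pos) + (if 0 < J then 1 else 0)" using k single by simp
    ultimately show ?thesis using R by blast
  next
    case pair
    let ?gs = "gs @ [(parity_op (1 - p), pos, pos + 1), (parity_op p, acc, m + length gs)]"
    have "2 * (e - (pos + 2)) + (if 0 < J then 1 else 0) < 2 * (e - pos) + (if 0 < J then 1 else 0)"
      using pair by simp
    from less.hyps[OF this chain_inv_pair[OF inv pair(2,1,3)]]
    obtain gs' r k F where c: "chain m V d ?gs p e 2 (m + length gs + 1) (pos + 2) J s gs' r k"
      and h: "\<exists>hs. gs' = ?gs @ hs" and R: "sound m d gs'" "realizes m gs' r F D"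
        "prefix_correct a (e - a) F" "absorbing l a F"
      and r: "r = m + length gs + 1 \<or> m + length ?gs \<le> r"
      and len: "length gs' \<le> length ?gs + slot_cost 2 (e - (pos + 2)) J"
      and k: "k \<le> 3 * (e - (pos + 2)) + (if 0 < J then 1 else 0)" by blast
    have "chain m V d gs p e i acc pos J s gs' r (Suc k)"
      by (rule chain_pair[OF pair(2,1,3) c])
    moreover have "\<exists>hs. gs' = gs @ hs" using h by auto
    moreover have "slot_cost i (e - pos) J = 2 + slot_cost 2 (e - (pos + 2)) J"
      using pair by (subst slot_cost.simps) auto
    then have "length gs' \<le> length gs + slot_cost i (e - pos) J" using len by simp
    moreover have "m + length gs \<le> r" using r by auto
    moreover have "Suc k \<le> 3 * (e - pos) + (if 0 < J then 1 else 0)" using k pair by simp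
    ultimately show ?thesis using R by blast
  next
    case slot
    define e' where "e' = (if e \<le> pos + slot_cap i then e else pos + slot_len i)"
    have T: "tree_vertices m V gs" and S: "sound m d gs" and D: "D \<le> d" and p: "p = a mod 2"
      and apos: "a < pos" and em: "e \<le> m" and rm: "e - pos \<le> room (D - i) i J"
      and odd: "odd (pos - a)" "pos - a \<le> Suc (slot_pre i)"
      using I slot(3) by blast+
    have iD: "i < D" using rm slot(3) room_pos[of "e - pos" D i J] by simp
    have pos2: "2 \<le> pos" using I slot(2,3) by blast
    have pm: "pos < m" using slot(3) em by simp
    have id: "i < d" using iD D by simp
    obtain gs\<^sub>1 s' G where
      q: "attach_blocks m V (1 - p) (slot_lev i) 0 (pos div 2) (gs, None) = (gs\<^sub>1, Some s')"
      and g1: "\<exists>hs. gs\<^sub>1 = gs @ hs \<and> length hs \<le> slot_lev i" "sound m d gs\<^sub>1"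
      and s': "realizes m gs\<^sub>1 s' G (Suc (slot_lev i))" "absorbing a pos G" "neutral pos G" "s' \<noteq> pos"
      by (rule slot_signal[OF T S slot(2) id apos pm odd p pos2])
    have g1': "\<exists>hs. gs\<^sub>1 = gs @ hs" "length gs\<^sub>1 \<le> length gs + slot_lev i" using g1(1) by auto
    have len: "2 \<le> slot_len i" using slot_len_pos[of i] slot(2) by simp
    have e1: "pos < e'" "e' \<le> e" using len slot(3) slot_cap_bounds[of i] unfolding e'_def by auto
    have "2 * (e' - (pos + 1)) + (if 0 < Suc (slot_lev i) then 1 else 0) <
        2 * (e - pos) + (if 0 < J then 1 else 0)"
      using e1 by simp
    from less.hyps[OF this chain_inv_child[OF inv slot(2) iD slot(3) e'_def g1'(1) g1(2) s']]
    obtain gs\<^sub>2 r' k\<^sub>1 F' where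
      c1: "chain m V d gs\<^sub>1 (1 - p) e' 0 pos (pos + 1) (Suc (slot_lev i)) s' gs\<^sub>2 r' k\<^sub>1"
      and g2: "\<exists>hs. gs\<^sub>2 = gs\<^sub>1 @ hs" "sound m d gs\<^sub>2" and F': "realizes m gs\<^sub>2 r' F' i"
        "prefix_correct pos (e' - pos) F'" "absorbing a pos F'"
      and r': "r' = pos \<and> Suc (slot_lev i) = 0 \<or> m + length gs\<^sub>1 \<le> r'"
      and l1: "length gs\<^sub>2 \<le> length gs\<^sub>1 + slot_cost 0 (e' - (pos + 1)) (Suc (slot_lev i))"
      and k1: "k\<^sub>1 \<le> 3 * (e' - (pos + 1)) + (if 0 < Suc (slot_lev i) then 1 else 0)"
      by blast
    have g2': "\<exists>hs. gs\<^sub>2 = gs @ hs" using g2(1) g1'(1) by auto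
    have r'': "m + length gs \<le> r'" using r' g1'(1) by auto
    let ?gs = "gs\<^sub>2 @ [(parity_op p, acc, r')]"
    have "2 * (e - e') + (if 0 < J then 1 else 0) < 2 * (e - pos) + (if 0 < J then 1 else 0)"
      using e1 by simp
    from less.hyps[OF this chain_inv_slot[OF inv slot(2) iD slot(1,3) e'_def g2' g2(2) F' r'']]
    obtain gs' r k\<^sub>2 F where c2: "chain m V d ?gs p e (Suc i) (m + length gs\<^sub>2) e' J s gs' r k\<^sub>2"
      and h: "\<exists>hs. gs' = ?gs @ hs" and R: "sound m d gs'" "realizes m gs' r F D"
        "prefix_correct a (e - a) F" "absorbing l a F"
      and r: "r = m + length gs\<^sub>2 \<and> J = 0 \<or> m + length ?gs \<le> r"
      and l2: "length gs' \<le> length ?gs + slot_cost (Suc i) (e - e') J"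
      and k2: "k\<^sub>2 \<le> 3 * (e - e') + (if 0 < J then 1 else 0)" by blast
    have "chain m V d gs p e i acc pos J s gs' r (k\<^sub>1 + k\<^sub>2 + 2)"
      by (rule chain_slot[OF slot(2) id slot(1,3) e'_def q c1 c2])
    moreover have "\<exists>hs. gs' = gs @ hs" using h g2' by auto
    moreover have "slot_cost i (e - pos) J =
        slot_lev i + slot_cost 0 (e' - (pos + 1)) (Suc (slot_lev i)) + 1 + slot_cost (Suc i) (e - e') J"
    proof -
      have t: "(if e - pos \<le> slot_cap i then e - pos else slot_len i) = e' - pos"
        unfolding e'_def using slot(3) by auto
      have t': "e' - pos - 1 = e' - (pos + 1)" "e - pos - (e' - pos) = e - e'" using e1 by simp_all
      have c: "(0 < J \<and> J \<le> i) = False" "(e - pos = 0) = False" "(i < 2) = False"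
        using slot by auto
      show ?thesis
        by (subst slot_cost.simps) (simp only: c t t' Let_def if_False simp_thms)
    qed
    then have "length gs' \<le> length gs + slot_cost i (e - pos) J" using l1 l2 g1'(2) by simp
    moreover have "m + length gs \<le> r" using r g2' by auto
    moreover have "k\<^sub>1 + k\<^sub>2 + 2 \<le> 3 * (e - pos) + (if 0 < J then 1 else 0)"
    proof -
      have "3 * (e' - (pos + 1)) + 3 + 3 * (e - e') = 3 * (e - pos)" using e1 by simp
      then show ?thesis using k1 k2 by (simp split: if_splits)
    qed
    ultimately show ?thesis using R by blast
  qed
qed

section \<open>Executions\<close>

text \<open>Without loops, the final store is a function of the initial one and the cost has a bound
  independent of it, so simplification replaces reasoning about \<open>exec\<close>.\<close>

primrec loop_free :: "com \<Rightarrow> bool" where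
  "loop_free Skip = True"
| "loop_free (Assign a e f) = True"
| "loop_free (Seq c d) = (loop_free c \<and> loop_free d)"
| "loop_free (IfElse b c d) = (loop_free c \<and> loop_free d)"
| "loop_free (While b c) = False"

primrec result :: "com \<Rightarrow> store \<Rightarrow> store" where
  "result Skip s = s"
| "result (Assign a e f) s = s(a := (s a)(aval e s := aval f s))"
| "result (Seq c d) s = result d (result c s)"
| "result (IfElse b c d) s = (if bval b s then result c s else result d s)"
| "result (While b c) s = s"

primrec max_cost :: "com \<Rightarrow> nat" where
  "max_cost Skip = 1"
| "max_cost (Assign a e f) = 1 + acost e + acost f"
| "max_cost (Seq c d) = max_cost c + max_cost d"
| "max_cost (IfElse b c d) = 1 + bcost b + max (max_cost c) (max_cost d)"
| "max_cost (While b c) = 0"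

lemma exec_loop_free: "loop_free c \<Longrightarrow> \<exists>n\<le>max_cost c. exec c s n (result c s)"
proof (induction c arbitrary: s)
  case (Seq c d)
  then have "loop_free c" "loop_free d" by simp_all
  with Seq.IH obtain n k where "n \<le> max_cost c" "exec c s n (result c s)"
      "k \<le> max_cost d" "exec d (result c s) k (result d (result c s))" by meson
  then show ?case by (intro exI[of _ "n + k"]) (simp add: exec.Seq)
next
  case (IfElse b c d)
  then have "loop_free c" "loop_free d" by simp_all
  with IfElse.IH obtain n k where n: "n \<le> max_cost c" "exec c s n (result c s)"
      and k: "k \<le> max_cost d" "exec d s k (result d s)" by meson
  show ?case
  proof (cases "bval b s")
    case True
    then show ?thesis
      using n exec.IfTrue[OF True n(2), of d] by (intro exI[of _ "1 + bcost b + n"]) simp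
  next
    case False
    then show ?thesis
      using k exec.IfFalse[OF False k(2), of c] by (intro exI[of _ "1 + bcost b + k"]) simp
  qed
qed (auto intro: exec.Skip exec.Assign simp del: One_nat_def)

definition run :: "com \<Rightarrow> store \<Rightarrow> nat \<Rightarrow> (store \<Rightarrow> bool) \<Rightarrow> bool" where
  "run c s B Q \<longleftrightarrow> (\<exists>n s'. exec c s n s' \<and> n \<le> B \<and> Q s')"

lemma run_loop_free: "loop_free c \<Longrightarrow> max_cost c \<le> B \<Longrightarrow> Q (result c s) \<Longrightarrow> run c s B Q"
  unfolding run_def using exec_loop_free[of c s] by (meson order_trans)

lemma run_Seq:
  assumes "run c s A P" "\<And>s'. P s' \<Longrightarrow> run d s' B Q"
  shows "run (Seq c d) s (A + B) Q"
  using assms unfolding run_def by (meson add_mono exec.Seq)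

lemma run_mono: "run c s A P \<Longrightarrow> A \<le> B \<Longrightarrow> (\<And>s'. P s' \<Longrightarrow> Q s') \<Longrightarrow> run c s B Q"
  unfolding run_def by (meson order_trans)

lemma run_If:
  assumes "bval b s \<Longrightarrow> run c s B Q" "\<not> bval b s \<Longrightarrow> run d s B Q"
  shows "run (IfElse b c d) s (1 + bcost b + B) Q"
proof (cases "bval b s")
  case True
  then obtain n s' where "exec c s n s'" "n \<le> B" "Q s'" using assms(1) unfolding run_def by blast
  then show ?thesis
    using exec.IfTrue[OF True, of c n s' d] unfolding run_def by (meson add_le_cancel_left)
next
  case False
  then obtain n s' where "exec d s n s'" "n \<le> B" "Q s'" using assms(2) unfolding run_def by blast
  then show ?thesis
    using exec.IfFalse[OF False, of d n s' c] unfolding run_def by (meson add_le_cancel_left)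
qed

text \<open>The potential f pays for the iterations.\<close>

lemma run_While:
  fixes f :: "store \<Rightarrow> nat"
  assumes "P s"
    and step: "\<And>s. P s \<Longrightarrow> bval b s \<Longrightarrow>
      \<exists>B. run c s B (\<lambda>s'. P s' \<and> B + (1 + bcost b) + f s' \<le> f s)"
  shows "run (While b c) s (f s + (1 + bcost b)) (\<lambda>s'. P s' \<and> \<not> bval b s')"
  using assms(1)
proof (induction "f s" arbitrary: s rule: less_induct)
  case less
  show ?case
  proof (cases "bval b s")
    case True
    then obtain B n s' where s': "exec c s n s'" "n \<le> B" "P s'" "B + (1 + bcost b) + f s' \<le> f s"
      using step[OF less.prems] unfolding run_def by blast
    then have "f s' < f s" by simp
    from less.hyps[OF this s'(3)] obtain k s'' where
      s'': "exec (While b c) s' k s''" "k \<le> f s' + (1 + bcost b)" "P s'' \<and> \<not> bval b s''"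
      unfolding run_def by blast
    have "1 + bcost b + n + k \<le> f s + (1 + bcost b)" using s'(2,4) s''(2) by linarith
    then show ?thesis
      unfolding run_def using exec.WhileTrue[OF True s'(1) s''(1)] s''(3) by blast
  next
    case False
    then show ?thesis
      unfolding run_def using exec.WhileFalse[OF False, of c] less.prems
      by (intro exI[of _ "1 + bcost b"] exI[of _ s]) simp
  qed
qed

text \<open>Unlike a run of the whole loop, a number of iterations can be continued by further ones;
  the simulation of nested segments depends on this.\<close>

inductive iterations :: "bexp \<Rightarrow> com \<Rightarrow> nat \<Rightarrow> nat \<Rightarrow> store \<Rightarrow> store \<Rightarrow> bool"
  for b :: bexp and c :: com and B :: nat where
  iterations_0: "iterations b c B 0 s s"
| iterations_Suc: "\<lbrakk>bval b s; exec c s n s'; n \<le> B; iterations b c B k s' s''\<rbrakk>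
    \<Longrightarrow> iterations b c B (Suc k) s s''"

lemma iterations_trans:
  "iterations b c B k s s' \<Longrightarrow> iterations b c B l s' s'' \<Longrightarrow> iterations b c B (k + l) s s''"
  by (induction rule: iterations.induct) (auto intro: iterations.intros)

lemma run_iterations:
  assumes "iterations b c B k s s'" "\<not> bval b s'"
  shows "run (While b c) s ((B + (1 + bcost b)) * k + (1 + bcost b)) (\<lambda>x. x = s')"
  using assms
proof (induction rule: iterations.induct)
  case (iterations_0 s)
  then show ?case unfolding run_def using exec.WhileFalse by fastforce
next
  case (iterations_Suc s n s' k s'')
  then obtain l where l: "exec (While b c) s' l s''" "l \<le> (B + (1 + bcost b)) * k + (1 + bcost b)"
    unfolding run_def by blast
  have "1 + bcost b + n + l \<le> (B + (1 + bcost b)) * Suc k + (1 + bcost b)"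
    using l(2) iterations_Suc.hyps(3) by simp
  then show ?case
    unfolding run_def using exec.WhileTrue[OF iterations_Suc.hyps(1,2) l(1)] by blast
qed

section \<open>The program\<close>

abbreviation Var :: "nat \<Rightarrow> aexp" where "Var a \<equiv> Cell a (Const 0)"
abbreviation Set :: "nat \<Rightarrow> aexp \<Rightarrow> com" where "Set a \<equiv> Assign a (Const 0)"
abbreviation num_inputs :: aexp where "num_inputs \<equiv> Cell 0 (Const 0)"
abbreviation num_gates :: aexp where "num_gates \<equiv> Cell 0 (Const 1)"
abbreviation last_vertex :: aexp where
  "last_vertex \<equiv> Minus (Plus num_inputs num_gates) (Const 1)"

definition emit :: "aexp \<Rightarrow> aexp \<Rightarrow> aexp \<Rightarrow> com" where
  "emit p a b = Seq (Assign 2 num_gates p) (Seq (Assign 3 num_gates a)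
     (Seq (Assign 4 num_gates b) (Assign 0 (Const 1) (Plus num_gates (Const 1)))))"

definition gate_list :: "nat \<Rightarrow> (nat \<Rightarrow> nat) \<Rightarrow> (nat \<Rightarrow> nat) \<Rightarrow> (nat \<Rightarrow> nat) \<Rightarrow> gate list" where
  "gate_list n f a b = map (\<lambda>j. (if f j = 0 then AND else OR, a j, b j)) [0..<n]"

abbreviation gates_of :: "store \<Rightarrow> gate list" where
  "gates_of s \<equiv> gate_list (s 0 (Suc 0)) (s 2) (s 3) (s 4)"

lemma length_gate_list [simp]: "length (gate_list n f a b) = n"
  by (simp add: gate_list_def)

lemma gate_list_0 [simp]: "gate_list 0 f a b = []"
  by (simp add: gate_list_def)

lemma gate_list_snoc [simp]:
  "p < 2 \<Longrightarrow> gate_list (Suc n) (f(n := p)) (a(n := u)) (b(n := v)) =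
     gate_list n f a b @ [(parity_op p, u, v)]"
  by (auto simp: gate_list_def parity_op_def less_2_cases_iff)

text \<open>
  Array 5 contains the vertices of the blocks, array 6 halves, arrays 7 to 9 the lengths, capacities
  and levels of the slots, and arrays 10 to 15 the stack of pending segments. The arrays from 16 on
  are used as single cells: 16 is the height of the stack and 17 the next position.
\<close>

definition take_block :: "aexp \<Rightarrow> com" where
  "take_block e = IfElse (Less (Var 22) (Const 1))
     (Seq (Set 23 (Cell 5 e)) (Set 22 (Const 1)))
     (Seq (emit (Var 18) (Var 23) (Cell 5 e)) (Set 23 last_vertex))"

abbreviation last_block :: aexp where
  "last_block \<equiv> Plus (Var 20) (Minus (Plus (Var 19) (Var 19)) (Const 2))"

definition signal_step :: com where
  "signal_step = Seq (Set 24 (Cell 6 (Var 19)))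
     (Seq (IfElse (Less (Plus (Var 24) (Var 24)) (Var 19)) (take_block last_block)
        (IfElse (Conj (Less (Var 21) (Const 2)) (Less (Const 0) (Var 19)))
           (take_block (Plus (Var 20) (Plus (Minus (Var 19) (Const 3)) (Minus (Var 19) (Const 3)))))
           Skip))
     (Seq (Set 19 (Var 24)) (Seq (Set 20 (Plus (Var 20) num_inputs))
        (Set 21 (Minus (Var 21) (Const 1))))))"

definition signal :: com where
  "signal =
     Seq (Seq (Set 18 (Minus (Const 1) (Cell 10 (Var 16)))) (Seq (Set 19 (Cell 6 (Var 17)))
       (Seq (Set 20 (Var 18)) (Seq (Set 21 (Cell 9 (Cell 12 (Var 16)))) (Set 22 (Const 0))))))
     (Seq (While (Less (Const 0) (Var 21)) signal_step)
       (IfElse (Less (Const 0) (Var 19)) (take_block last_block) Skip))"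

definition push :: com where
  "push =
     Seq (IfElse (Less (Plus (Var 17) (Cell 8 (Cell 12 (Var 16)))) (Cell 15 (Var 16)))
       (Set 24 (Plus (Var 17) (Cell 7 (Cell 12 (Var 16))))) (Set 24 (Cell 15 (Var 16))))
     (Seq (Set 21 (Plus (Cell 9 (Cell 12 (Var 16))) (Const 1)))
     (Seq (Set 16 (Plus (Var 16) (Const 1)))
     (Seq (Assign 10 (Var 16) (Var 18))
     (Seq (Assign 11 (Var 16) (Var 17))
     (Seq (Assign 12 (Var 16) (Const 0))
     (Seq (Assign 13 (Var 16) (Var 21))
     (Seq (Assign 14 (Var 16) (Var 23))
     (Seq (Assign 15 (Var 16) (Var 24))
       (Set 17 (Plus (Var 17) (Const 1)))))))))))"

abbreviation next_slot :: com where
  "next_slot \<equiv> Seq (Assign 11 (Var 16) last_vertex)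
     (Assign 12 (Var 16) (Plus (Cell 12 (Var 16)) (Const 1)))"

definition pop :: com where
  "pop = Seq (Set 24 (Cell 11 (Var 16))) (Seq (Set 16 (Minus (Var 16) (Const 1)))
     (Seq (emit (Cell 10 (Var 16)) (Cell 11 (Var 16)) (Var 24)) next_slot))"

definition use_signal :: com where
  "use_signal = Seq (emit (Cell 10 (Var 16)) (Cell 11 (Var 16)) (Cell 14 (Var 16)))
     (Seq next_slot (Assign 13 (Var 16) (Const 0)))"

definition use_single :: com where
  "use_single = Seq (emit (Cell 10 (Var 16)) (Cell 11 (Var 16)) (Var 17))
     (Seq next_slot (Set 17 (Plus (Var 17) (Const 1))))"

definition use_pair :: com where
  "use_pair =
     Seq (emit (Minus (Const 1) (Cell 10 (Var 16))) (Var 17) (Plus (Var 17) (Const 1)))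
     (Seq (emit (Cell 10 (Var 16)) (Cell 11 (Var 16)) last_vertex)
     (Seq (Assign 11 (Var 16) last_vertex)
     (Seq (Assign 12 (Var 16) (Const 2)) (Set 17 (Plus (Var 17) (Const 2))))))"

definition main_step :: com where
  "main_step =
     IfElse (Conj (Less (Const 0) (Cell 13 (Var 16)))
         (Not (Conj (Less (Var 17) (Cell 15 (Var 16))) (Less (Cell 12 (Var 16)) (Cell 13 (Var 16))))))
       use_signal
       (IfElse (Less (Var 17) (Cell 15 (Var 16)))
         (IfElse (Less (Cell 12 (Var 16)) (Const 2))
           (IfElse (Less (Plus (Var 17) (Const 1)) (Cell 15 (Var 16))) use_pair use_single)
           (Seq signal push))
         pop)"

definition main_guard :: bexp where
  "main_guard = Not (Conj (Less (Var 16) (Const 1)) (Not (Less (Var 17) num_inputs)))"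

section \<open>The program follows the construction\<close>

definition env :: "nat \<Rightarrow> (nat \<Rightarrow> nat) \<Rightarrow> nat \<Rightarrow> store \<Rightarrow> bool" where
  "env m V d s \<longleftrightarrow> s 0 0 = m \<and> s 5 = V \<and> (\<forall>x\<le>m. s 6 x = x div 2) \<and>
     (\<forall>x. 2 \<le> x \<and> x < d \<longrightarrow> s 7 x = slot_len x \<and> s 8 x = slot_cap x \<and> s 9 x = slot_lev x)"

definition attach_state :: "store \<Rightarrow> gate list \<times> nat option" where
  "attach_state s = (gates_of s, if s 22 0 = 0 then None else Some (s 23 0))"

text \<open>The index is evaluated after \<open>emit\<close> has already written to arrays 2 and 3,
  which is why it may only depend on arrays left unchanged.\<close>

lemma take_block_result:
  assumes "s 18 0 < 2" "\<forall>s'. s' 19 = s 19 \<and> s' 20 = s 20 \<longrightarrow> aval e s' = aval e s"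
  shows "attach_state (result (take_block e) s) =
      attach (s 0 0) (parity_op (s 18 0)) (attach_state s) (s 5 (aval e s))"
    and "result (take_block e) s 0 0 = s 0 0"
    and "a \<notin> {0, 2, 3, 4, 22, 23} \<Longrightarrow> result (take_block e) s a = s a"
proof -
  have e: "aval e (s(2 := x, 3 := y)) = aval e s" for x y
    by (rule assms(2)[rule_format]) simp
  show "attach_state (result (take_block e) s) =
      attach (s 0 0) (parity_op (s 18 0)) (attach_state s) (s 5 (aval e s))"
    and "result (take_block e) s 0 0 = s 0 0"
    and "a \<notin> {0, 2, 3, 4, 22, 23} \<Longrightarrow> result (take_block e) s a = s a"
    using assms(1) by (simp_all add: take_block_def emit_def attach_state_def e)
qed

lemma take_block_cost: "loop_free (take_block e)" "max_cost (take_block e) = 34 + acost e"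
  by (simp_all add: take_block_def emit_def)

lemma signal_step_result:
  assumes m: "s 0 0 = m" and p: "s 18 0 < 2" and H: "\<forall>x\<le>m. s 6 x = x div 2" and v: "s 19 0 \<le> m"
    and base: "s 20 0 = l * m + s 18 0" and n: "s 21 0 = Suc n"
  defines "s' \<equiv> result signal_step s"
  shows "attach_blocks m (s 5) (s 18 0) n (Suc l) (s' 19 0) (attach_state s') =
      attach_blocks m (s 5) (s 18 0) (Suc n) l (s 19 0) (attach_state s)"
    and "s' 19 0 \<le> m" "s' 20 0 = Suc l * m + s 18 0" "s' 21 0 = n" "s' 0 0 = m"
    and "a \<notin> {0, 2, 3, 4, 19, 20, 21, 22, 23, 24} \<Longrightarrow> s' a = s a"
proof -
  define s1 where "s1 = s(24 := (s 24)(0 := s 19 0 div 2))"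
  have H1: "s 6 (s 19 0) = s 19 0 div 2" using H v by simp
  have s1: "s1 0 = s 0" "s1 2 = s 2" "s1 3 = s 3" "s1 4 = s 4" "s1 5 = s 5" "s1 18 = s 18"
    "s1 19 = s 19" "s1 20 = s 20" "s1 21 = s 21" "s1 22 = s 22" "s1 23 = s 23"
    "s1 24 0 = s 19 0 div 2" "a \<noteq> 24 \<Longrightarrow> s1 a = s a" for a
    by (simp_all add: s1_def)
  have att1: "attach_state s1 = attach_state s" by (simp add: attach_state_def s1)
  define e2 where "e2 = Plus (Var 20) (Plus (Minus (Var 19) (Const 3)) (Minus (Var 19) (Const 3)))"
  define s2 where "s2 = (if odd (s 19 0) then result (take_block last_block) s1
     else if n = 0 \<and> 0 < s 19 0 then result (take_block e2) s1 else s1)"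
  \<comment> \<open>Parity is not primitive: a number is odd if it exceeds twice its tabulated
    half.\<close>
  have odd: "s 19 0 div 2 + s 19 0 div 2 < s 19 0 \<longleftrightarrow> odd (s 19 0)" by presburger
  have s': "s' = s2(19 := (s2 19)(0 := s2 24 0), 20 := (s2 20)(0 := s2 20 0 + s2 0 0),
      21 := (s2 21)(0 := s2 21 0 - 1))"
  proof -
    have r1: "result (Set 24 (Cell 6 (Var 19))) s = s1" by (simp add: s1_def H1)
    have b1: "bval (Less (Plus (Var 24) (Var 24)) (Var 19)) s1 = odd (s 19 0)"
      using odd by (simp add: s1)
    have b2: "bval (Conj (Less (Var 21) (Const 2)) (Less (Const 0) (Var 19))) s1 = (n = 0 \<and> 0 < s 19 0)"
      using n by (auto simp: s1)
    have r2: "result (IfElse (Less (Plus (Var 24) (Var 24)) (Var 19)) (take_block last_block)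
        (IfElse (Conj (Less (Var 21) (Const 2)) (Less (Const 0) (Var 19))) (take_block e2) Skip)) s1 = s2"
      unfolding s2_def result.simps(1,4) b1 b2 ..
    show ?thesis
      unfolding s'_def signal_step_def result.simps(3) r1 e2_def[symmetric] r2 by simp
  qed
  have p1: "s1 18 0 < 2" using p s1 by simp
  have idx: "\<forall>t. t 19 = s1 19 \<and> t 20 = s1 20 \<longrightarrow> aval last_block t = aval last_block s1"
    "\<forall>t. t 19 = s1 19 \<and> t 20 = s1 20 \<longrightarrow> aval e2 t = aval e2 s1"
    by (simp_all add: e2_def)
  have av: "aval last_block s1 = l * m + (s 18 0 + 2 * (s 19 0 - 1))"
    "aval e2 s1 = l * m + (s 18 0 + 2 * (s 19 0 - 3))"
    using base by (simp_all add: e2_def s1)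
  have s2_cases: "f s2 = x" if "f (result (take_block last_block) s1) = x"
      "f (result (take_block e2) s1) = x" "f s1 = x" for f :: "store \<Rightarrow> 'c" and x
    unfolding s2_def using that by simp
  have s2: "s2 b = s b" if b: "b \<notin> {0, 2, 3, 4, 22, 23, 24}" for b
  proof -
    have "s1 b = s b" by (rule s1(13)) (use b in simp)
    moreover have "result (take_block last_block) s1 b = s1 b"
      by (rule take_block_result(3)[of s1 last_block, OF p1 idx(1)]) (use b in simp_all)
    moreover have "result (take_block e2) s1 b = s1 b"
      by (rule take_block_result(3)[of s1 e2, OF p1 idx(2)]) (use b in simp_all)
    ultimately show ?thesis by (intro s2_cases[of "\<lambda>t. t b"]) simp_all
  qed
  have s2': "s2 0 0 = m" "s2 24 0 = s 19 0 div 2"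
  proof -
    have "result (take_block last_block) s1 0 0 = m" "result (take_block e2) s1 0 0 = m" "s1 0 0 = m"
      using take_block_result(2)[of s1 last_block, OF p1 idx(1)] take_block_result(2)[of s1 e2, OF p1 idx(2)] m s1(1) by simp_all
    then show "s2 0 0 = m" by (rule s2_cases[of "\<lambda>t. t 0 0"])
    have "result (take_block last_block) s1 24 = s1 24" "result (take_block e2) s1 24 = s1 24"
      using take_block_result(3)[of s1 last_block, OF p1 idx(1)] take_block_result(3)[of s1 e2, OF p1 idx(2)] by simp_all
    then have "s2 24 = s1 24" by (intro s2_cases[of "\<lambda>t. t 24"]) simp_all
    then show "s2 24 0 = s 19 0 div 2" using s1(12) by simp
  qed
  have att2: "attach_state s2 =
      (if odd (s 19 0) then attach m (parity_op (s 18 0)) (attach_state s)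
          (s 5 (l * m + (s 18 0 + 2 * (s 19 0 - 1))))
       else if n = 0 \<and> 0 < s 19 0 then attach m (parity_op (s 18 0)) (attach_state s)
          (s 5 (l * m + (s 18 0 + 2 * (s 19 0 - 3)))) else attach_state s)"
  proof -
    have 1: "attach_state (result (take_block last_block) s1) =
        attach m (parity_op (s 18 0)) (attach_state s) (s 5 (l * m + (s 18 0 + 2 * (s 19 0 - 1))))"
      using take_block_result(1)[of s1 last_block, OF p1 idx(1)] unfolding av att1 s1(1,5,6) m .
    have 2: "attach_state (result (take_block e2) s1) =
        attach m (parity_op (s 18 0)) (attach_state s) (s 5 (l * m + (s 18 0 + 2 * (s 19 0 - 3))))"
      using take_block_result(1)[of s1 e2, OF p1 idx(2)] unfolding av att1 s1(1,5,6) m .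
    show ?thesis
      by (cases "odd (s 19 0)"; cases "n = 0 \<and> 0 < s 19 0")
        (simp_all only: s2_def if_True if_False 1 2 att1 simp_thms)
  qed
  have att': "attach_state s' = attach_state s2" unfolding s' by (simp add: attach_state_def)
  show "s' 19 0 \<le> m" "s' 20 0 = Suc l * m + s 18 0" "s' 21 0 = n" "s' 0 0 = m"
    using v base n s2' s2[of 20] s2[of 21] unfolding s' by simp_all
  show "attach_blocks m (s 5) (s 18 0) n (Suc l) (s' 19 0) (attach_state s') =
      attach_blocks m (s 5) (s 18 0) (Suc n) l (s 19 0) (attach_state s)"
    unfolding att' att2 attach_blocks.simps(2) unfolding s' using s2' by simp
  show "s' a = s a" if "a \<notin> {0, 2, 3, 4, 19, 20, 21, 22, 23, 24}"
    using that s2[of a] unfolding s' by simp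
qed

lemma signal_step_cost: "loop_free signal_step" "max_cost signal_step \<le> 120"
  by (simp_all add: signal_step_def take_block_cost)

lemma run_signal:
  assumes env: "env m V d s" and p: "s 10 (s 16 0) < 2" and pos: "s 17 0 \<le> m"
    and i: "2 \<le> s 12 (s 16 0)" "s 12 (s 16 0) < d"
    and att: "attach_blocks m V (1 - s 10 (s 16 0)) (slot_lev (s 12 (s 16 0))) 0 (s 17 0 div 2)
      (gates_of s, None) = (gs, Some r)"
  shows "run signal s (150 + 130 * slot_lev (s 12 (s 16 0)))
    (\<lambda>s'. gates_of s' = gs \<and> s' 23 0 = r \<and> s' 18 0 = 1 - s 10 (s 16 0) \<and> s' 0 0 = m \<and>
       (\<forall>a. a \<notin> {0, 2, 3, 4, 18, 19, 20, 21, 22, 23, 24} \<longrightarrow> s' a = s a))"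
proof -
  let ?t = "s 16 0"
  define q where "q = 1 - s 10 ?t"
  define h where "h = slot_lev (s 12 ?t)"
  have q: "q < 2" by (simp add: q_def)
  have E: "s 0 0 = m" "s 5 = V" "\<forall>x\<le>m. s 6 x = x div 2" "s 9 (s 12 ?t) = h"
    using env i by (auto simp: env_def h_def)
  define frame where
    "frame s' \<longleftrightarrow> s' 0 0 = m \<and> (\<forall>a. a \<notin> {0, 2, 3, 4, 18, 19, 20, 21, 22, 23, 24} \<longrightarrow> s' a = s a)"
    for s' :: store
  define inv where "inv s' \<longleftrightarrow> frame s' \<and> s' 18 0 = q \<and> s' 19 0 \<le> m \<and>
    (\<exists>l. s' 20 0 = l * m + q \<and>
      attach_blocks m V q (s' 21 0) l (s' 19 0) (attach_state s') = (gs, Some r))" for s'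
  let ?init = "Seq (Set 18 (Minus (Const 1) (Cell 10 (Var 16)))) (Seq (Set 19 (Cell 6 (Var 17)))
       (Seq (Set 20 (Var 18)) (Seq (Set 21 (Cell 9 (Cell 12 (Var 16)))) (Set 22 (Const 0)))))"
  have 1: "run ?init s 30 (\<lambda>s'. inv s' \<and> s' 21 0 = h)"
  proof (rule run_loop_free)
    have "inv (result ?init s)"
      unfolding inv_def
    proof (intro conjI exI[of _ 0])
      show "frame (result ?init s)" using E(1) by (simp add: frame_def)
      show "result ?init s 18 0 = q" by (simp add: q_def)
      show "result ?init s 19 0 \<le> m" using E(3) pos by simp
      show "result ?init s 20 0 = 0 * m + q" by (simp add: q_def)
      show "attach_blocks m V q (result ?init s 21 0) 0 (result ?init s 19 0)
          (attach_state (result ?init s)) = (gs, Some r)"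
        using att E(3,4) pos by (simp add: attach_state_def q_def h_def)
    qed
    then show "inv (result ?init s) \<and> result ?init s 21 0 = h" using E(4) by simp
  qed simp_all
  have 2: "run (While (Less (Const 0) (Var 21)) signal_step) s1 (130 * h + 5)
      (\<lambda>s'. inv s' \<and> \<not> bval (Less (Const 0) (Var 21)) s')"
    if s1: "inv s1 \<and> s1 21 0 = h" for s1
  proof (rule run_mono[OF run_While[where P = inv and f = "\<lambda>s. 130 * s 21 0"]])
    fix s2 assume s2: "inv s2" "bval (Less (Const 0) (Var 21)) s2"
    then obtain n where n: "s2 21 0 = Suc n" by (cases "s2 21 0") auto
    from s2(1) obtain l where l: "s2 20 0 = l * m + q"
      "attach_blocks m V q (s2 21 0) l (s2 19 0) (attach_state s2) = (gs, Some r)"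
      and f: "frame s2" "s2 18 0 = q" "s2 19 0 \<le> m" unfolding inv_def by blast
    have fr: "s2 0 0 = m" "s2 5 = V" "\<forall>x\<le>m. s2 6 x = x div 2"
      using f(1) E by (simp_all add: frame_def)
    note R = signal_step_result[of s2 m l n, OF fr(1) _ fr(3) f(3) _ n, unfolded f(2), OF q l(1)]
    have "inv (result signal_step s2)"
      unfolding inv_def
    proof (intro conjI exI[of _ "Suc l"])
      show "frame (result signal_step s2)"
        using R(5) R(6) f(1) unfolding frame_def by simp
      show "result signal_step s2 18 0 = q" using R(6)[of 18] f(2) by simp
      show "attach_blocks m V q (result signal_step s2 21 0) (Suc l) (result signal_step s2 19 0)
          (attach_state (result signal_step s2)) = (gs, Some r)"
        unfolding R(4) using R(1) l(2) fr(2) n by simp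
    qed (use R in simp_all)
    then show "\<exists>B. run signal_step s2 B (\<lambda>s'. inv s' \<and>
        B + (1 + bcost (Less (Const 0) (Var 21))) + 130 * s' 21 0 \<le> 130 * s2 21 0)"
      using R(4) n signal_step_cost by (intro exI[of _ 120] run_loop_free) simp_all
  qed (use s1 in simp_all)
  have 3: "run (IfElse (Less (Const 0) (Var 19)) (take_block last_block) Skip) s1 80
      (\<lambda>s'. gates_of s' = gs \<and> s' 23 0 = r \<and> s' 18 0 = q \<and> frame s')"
    if s1: "inv s1 \<and> \<not> bval (Less (Const 0) (Var 21)) s1" for s1
  proof (rule run_loop_free)
    have c0: "s1 21 0 = 0" using s1 by simp
    from s1 obtain l where l1: "s1 20 0 = l * m + q"
      and l2: "attach_blocks m V q (s1 21 0) l (s1 19 0) (attach_state s1) = (gs, Some r)"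
      and f: "frame s1" "s1 18 0 = q" unfolding inv_def by blast
    note l = l1 l2[unfolded c0]
    have fr: "s1 0 0 = m" "s1 5 = V" using f(1) E by (simp_all add: frame_def)
    have idx: "\<forall>t. t 19 = s1 19 \<and> t 20 = s1 20 \<longrightarrow> aval last_block t = aval last_block s1" by simp
    have p1: "s1 18 0 < 2" using f(2) q by simp
    have av: "aval last_block s1 = l * m + (q + 2 * (s1 19 0 - 1))" using l(1) by simp
    let ?s = "result (IfElse (Less (Const 0) (Var 19)) (take_block last_block) Skip) s1"
    note R = take_block_result[of s1 last_block, OF p1 idx]
    have "attach_state ?s = (gs, Some r)"
      using R(1) l(2) unfolding av by (cases "0 < s1 19 0") (simp_all add: fr f(2))
    then have "gates_of ?s = gs" "?s 23 0 = r" unfolding attach_state_def by (auto split: if_splits)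
    moreover have "?s 18 0 = q" using R(3)[of 18] f(2) by simp
    moreover have "frame ?s" using R(2,3) f(1) unfolding frame_def by simp
    ultimately show "gates_of ?s = gs \<and> ?s 23 0 = r \<and> ?s 18 0 = q \<and> frame ?s" by blast
  qed (simp_all add: take_block_cost)
  have "run signal s (30 + ((130 * h + 5) + 80))
      (\<lambda>s'. gates_of s' = gs \<and> s' 23 0 = r \<and> s' 18 0 = q \<and> frame s')"
    unfolding signal_def by (rule run_Seq[OF 1 run_Seq[OF 2 3]])
  then show ?thesis
    by (rule run_mono) (auto simp: h_def q_def frame_def)
qed

section \<open>One iteration of the main loop for each move\<close>

definition top_segment ::
  "store \<Rightarrow> nat \<Rightarrow> nat \<Rightarrow> nat \<Rightarrow> nat \<Rightarrow> nat \<Rightarrow> nat \<Rightarrow> nat \<Rightarrow> bool" where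
  "top_segment s p e i acc pos J r \<longleftrightarrow>
     s 10 (s 16 0) = p \<and> s 11 (s 16 0) = acc \<and> s 12 (s 16 0) = i \<and> s 13 (s 16 0) = J \<and>
     s 14 (s 16 0) = r \<and> s 15 (s 16 0) = e \<and> s 17 0 = pos"

text \<open>A child works at stack height \<open>t\<close> and above, so the suspended segments
  below are found unchanged after the return.\<close>

definition same_below :: "nat \<Rightarrow> store \<Rightarrow> store \<Rightarrow> bool" where
  "same_below t s s' \<longleftrightarrow> s' 1 = s 1 \<and> (\<forall>a\<in>{10, 11, 12, 13, 14, 15}. \<forall>x<t. s' a x = s a x)"

abbreviation signal_guard :: bexp where
  "signal_guard \<equiv> Conj (Less (Const 0) (Cell 13 (Var 16)))
     (Not (Conj (Less (Var 17) (Cell 15 (Var 16))) (Less (Cell 12 (Var 16)) (Cell 13 (Var 16)))))"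
abbreviation open_guard :: bexp where
  "open_guard \<equiv> Less (Var 17) (Cell 15 (Var 16))"
abbreviation first_guard :: bexp where
  "first_guard \<equiv> Less (Cell 12 (Var 16)) (Const 2)"
abbreviation pair_guard :: bexp where
  "pair_guard \<equiv> Less (Plus (Var 17) (Const 1)) (Cell 15 (Var 16))"

lemma run_IfTrue': "bval b s \<Longrightarrow> run c s B Q \<Longrightarrow> run (IfElse b c d) s (1 + bcost b + B) Q"
  by (rule run_If) auto

lemma run_IfFalse': "\<not> bval b s \<Longrightarrow> run d s B Q \<Longrightarrow> run (IfElse b c d) s (1 + bcost b + B) Q"
  by (rule run_If) auto

lemma run_loop_free': "loop_free c \<Longrightarrow> Q (result c s) \<Longrightarrow> run c s (max_cost c) Q"
  by (rule run_loop_free) auto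

lemma step_signal:
  assumes env: "env m V d s" and top: "top_segment s p e i acc pos J r" and p: "p < 2"
    and J: "0 < J" "pos = e \<or> J \<le> i" and pe: "pos \<le> e"
  shows "run main_step s 100 (\<lambda>s'. env m V d s' \<and> s' 16 0 = s 16 0 \<and>
    top_segment s' p e (Suc i) (m + length (gates_of s)) pos 0 r \<and>
    gates_of s' = gates_of s @ [(parity_op p, acc, r)] \<and> same_below (s 16 0) s s')" (is "run _ _ _ ?Q")
proof -
  have m: "s 0 0 = m" using env by (simp add: env_def)
  have g: "bval signal_guard s" using top J pe by (auto simp: top_segment_def)
  have lf: "loop_free use_signal" by (simp add: use_signal_def emit_def)
  have q: "?Q (result use_signal s)"
    using top p m env
    by (simp add: use_signal_def emit_def top_segment_def env_def same_below_def)
  from run_IfTrue'[OF g run_loop_free'[of _ ?Q, OF lf q]] show ?thesis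
    unfolding main_step_def by (rule run_mono) (simp_all add: use_signal_def emit_def)
qed

lemma step_single:
  assumes env: "env m V d s" and top: "top_segment s p e i acc pos J r" and p: "p < 2"
    and i: "i < 2" "J = 0 \<or> i < J" "pos + 1 = e"
  shows "run main_step s 100 (\<lambda>s'. env m V d s' \<and> s' 16 0 = s 16 0 \<and>
    top_segment s' p e (Suc i) (m + length (gates_of s)) (pos + 1) J r \<and>
    gates_of s' = gates_of s @ [(parity_op p, acc, pos)] \<and> same_below (s 16 0) s s')" (is "run _ _ _ ?Q")
proof -
  have m: "s 0 0 = m" using env by (simp add: env_def)
  have g: "\<not> bval signal_guard s" "bval open_guard s" "bval first_guard s" "\<not> bval pair_guard s"
    using top i by (auto simp: top_segment_def)
  have lf: "loop_free use_single" by (simp add: use_single_def emit_def)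
  have q: "?Q (result use_single s)"
    using top p m env
    by (simp add: use_single_def emit_def top_segment_def env_def same_below_def)
  from run_IfFalse'[OF g(1) run_IfTrue'[OF g(2) run_IfTrue'[OF g(3) run_IfFalse'[OF g(4)
    run_loop_free'[of _ ?Q, OF lf q]]]]] show ?thesis
    unfolding main_step_def by (rule run_mono) (simp_all add: use_single_def emit_def)
qed

lemma step_pair:
  assumes env: "env m V d s" and top: "top_segment s p e i acc pos J r" and p: "p < 2"
    and i: "i < 2" "J = 0 \<or> i < J" "pos + 1 < e"
  shows "run main_step s 150 (\<lambda>s'. env m V d s' \<and> s' 16 0 = s 16 0 \<and>
    top_segment s' p e 2 (m + length (gates_of s) + 1) (pos + 2) J r \<and>
    gates_of s' = gates_of s @ [(parity_op (1 - p), pos, pos + 1),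
      (parity_op p, acc, m + length (gates_of s))] \<and> same_below (s 16 0) s s')" (is "run _ _ _ ?Q")
proof -
  have m: "s 0 0 = m" using env by (simp add: env_def)
  have g: "\<not> bval signal_guard s" "bval open_guard s" "bval first_guard s" "bval pair_guard s"
    using top i by (auto simp: top_segment_def)
  have lf: "loop_free use_pair" by (simp add: use_pair_def emit_def)
  have q: "?Q (result use_pair s)"
    using top p m env
    by (simp add: use_pair_def emit_def top_segment_def env_def same_below_def)
  from run_IfFalse'[OF g(1) run_IfTrue'[OF g(2) run_IfTrue'[OF g(3) run_IfTrue'[OF g(4)
    run_loop_free'[of _ ?Q, OF lf q]]]]] show ?thesis
    unfolding main_step_def by (rule run_mono) (simp_all add: use_pair_def emit_def)
qed

lemma step_pop:
  assumes env: "env m V d s" and t: "s 16 0 = Suc t" and fin: "s 13 (Suc t) = 0" "s 15 (Suc t) = s 17 0"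
    and top: "s 10 t = p" "s 11 t = acc" "s 12 t = i" "s 13 t = J" "s 14 t = r" "s 15 t = e" and p: "p < 2"
  shows "run main_step s 100 (\<lambda>s'. env m V d s' \<and> s' 16 0 = t \<and>
    top_segment s' p e (Suc i) (m + length (gates_of s)) (s 17 0) J r \<and>
    gates_of s' = gates_of s @ [(parity_op p, acc, s 11 (Suc t))] \<and> same_below t s s')" (is "run _ _ _ ?Q")
proof -
  have m: "s 0 0 = m" using env by (simp add: env_def)
  have g: "\<not> bval signal_guard s" "\<not> bval open_guard s"
    using t fin by auto
  have lf: "loop_free pop" by (simp add: pop_def emit_def)
  have q: "?Q (result pop s)"
    using top p m env t
    by (simp add: pop_def emit_def top_segment_def env_def same_below_def)
  from run_IfFalse'[OF g(1) run_IfFalse'[OF g(2) run_loop_free'[of _ ?Q, OF lf q]]] show ?thesis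
    unfolding main_step_def by (rule run_mono) (simp_all add: pop_def emit_def)
qed

lemma step_push:
  assumes env: "env m V d s" and top: "top_segment s p e i acc pos J r" and p: "p < 2"
    and i: "2 \<le> i" "i < d" "J = 0 \<or> i < J" and pe: "pos < e" "e \<le> m"
    and e': "e' = (if e \<le> pos + slot_cap i then e else pos + slot_len i)"
    and att: "attach_blocks m V (1 - p) (slot_lev i) 0 (pos div 2) (gates_of s, None) = (gs, Some r')"
  shows "run main_step s (300 + 130 * slot_lev i) (\<lambda>s'. env m V d s' \<and> s' 16 0 = Suc (s 16 0) \<and>
    top_segment s' (1 - p) e' 0 pos (pos + 1) (Suc (slot_lev i)) r' \<and>
    gates_of s' = gs \<and> same_below (Suc (s 16 0)) s s')" (is "run _ _ _ ?Q")
proof -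
  let ?t = "s 16 0"
  have T: "s 10 ?t = p" "s 11 ?t = acc" "s 12 ?t = i" "s 13 ?t = J" "s 14 ?t = r" "s 15 ?t = e"
    "s 17 0 = pos" using top by (simp_all add: top_segment_def)
  have g: "\<not> bval signal_guard s" "bval open_guard s" "\<not> bval first_guard s"
    using T i pe by auto
  have E: "s 7 i = slot_len i" "s 8 i = slot_cap i" "s 9 i = slot_lev i"
    using env i by (auto simp: env_def)
  have 1: "run signal s (150 + 130 * slot_lev i) (\<lambda>s1. gates_of s1 = gs \<and> s1 23 0 = r' \<and>
      s1 18 0 = 1 - p \<and> s1 0 0 = m \<and>
      (\<forall>a. a \<notin> {0, 2, 3, 4, 18, 19, 20, 21, 22, 23, 24} \<longrightarrow> s1 a = s a))"
    using run_signal[OF env, of gs r'] T p i pe att by simp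
  have 2: "run push s1 (max_cost push) ?Q"
    if s1: "gates_of s1 = gs \<and> s1 23 0 = r' \<and> s1 18 0 = 1 - p \<and> s1 0 0 = m \<and>
      (\<forall>a. a \<notin> {0, 2, 3, 4, 18, 19, 20, 21, 22, 23, 24} \<longrightarrow> s1 a = s a)" for s1
  proof -
    have f: "s1 a = s a" if "a \<in> {1, 5, 6, 7, 8, 9, 10, 11, 12, 13, 14, 15, 16, 17}" for a
      using s1 that by auto
    have F: "s1 (Suc 0) = s (Suc 0)" "s1 5 = s 5" "s1 6 = s 6" "s1 7 = s 7" "s1 8 = s 8" "s1 9 = s 9"
      "s1 10 = s 10" "s1 11 = s 11" "s1 12 = s 12" "s1 13 = s 13" "s1 14 = s 14" "s1 15 = s 15"
      "s1 16 = s 16" "s1 17 = s 17"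
      by (rule f, simp)+
    have G: "gates_of s1 = gs" "s1 23 0 = r'" "s1 18 0 = 1 - p" "s1 0 0 = m"
      using s1 by blast+
    have e'': "e' = (if pos + slot_cap i < e then pos + slot_len i else e)"
      unfolding e' by auto
    have lf: "loop_free push" by (simp add: push_def)
    have q: "?Q (result push s1)"
      unfolding e''
      using env G(1)
      by (cases "pos + slot_cap i < e")
        (simp_all add: push_def top_segment_def env_def same_below_def F G(2-4) T E)
    show ?thesis by (rule run_loop_free'[of _ ?Q, OF lf q])
  qed
  from run_IfFalse'[OF g(1) run_IfTrue'[OF g(2) run_IfFalse'[OF g(3) run_Seq[OF 1 2]]]] show ?thesis
    unfolding main_step_def by (rule run_mono) (simp_all add: push_def)
qed

lemma bval_main_guard: "bval main_guard s \<longleftrightarrow> 0 < s 16 0 \<or> s 17 0 < s 0 0"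
  by (auto simp: main_guard_def)

lemma iterations_run:
  assumes "bval b s" "run c s A Q" "A \<le> B"
  obtains s' where "iterations b c B (Suc 0) s s'" "Q s'"
  using assms iterations_Suc[OF assms(1) _ _ iterations_0] unfolding run_def by (meson order_trans)

lemma same_below_trans: "same_below t s s' \<Longrightarrow> same_below t' s' s'' \<Longrightarrow> t \<le> t' \<Longrightarrow> same_below t s s''"
  by (simp add: same_below_def)

lemma same_below_mono: "same_below t' s s' \<Longrightarrow> t \<le> t' \<Longrightarrow> same_below t s s'"
  by (simp add: same_below_def)

text \<open>Every rule is one iteration, except that \<open>chain_slot\<close> is a push, the
  iterations of the child, a pop, and the rest. The last assumption keeps the guard true: at height
  0 it holds only while inputs are left, so the bottom segment must extend to \<open>m\<close> and
  have no pending signal.\<close>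

theorem chain_simulation:
  assumes "chain m V d gs p e i acc pos J r gs' v k"
    and "\<And>i. 2 \<le> i \<Longrightarrow> i < d \<Longrightarrow> slot_lev i \<le> h"
    and "env m V d s" "top_segment s p e i acc pos J r" "gates_of s = gs" "p < 2" "pos \<le> e" "e \<le> m"
    and "0 < s 16 0 \<or> J = 0 \<and> e = m"
  shows "\<exists>s' i' r'. iterations main_guard main_step (300 + 130 * h) k s s' \<and> env m V d s' \<and>
    s' 16 0 = s 16 0 \<and> top_segment s' p e i' v e 0 r' \<and> gates_of s' = gs' \<and> same_below (s 16 0) s s'"
  using assms
proof (induction arbitrary: s rule: chain.induct)
  case (chain_done gs p e i acc r)
  then show ?case
    by (intro exI[of _ s] exI[of _ i] exI[of _ r]) (simp add: iterations_0 same_below_def)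
next
  case (chain_signal J pos e i gs p acc r gs' v k)
  note pr = chain_signal.prems
  have m: "s 0 0 = m" using pr(2) by (simp add: env_def)
  have g: "bval main_guard s" using pr(8) chain_signal.hyps(1) by (auto simp: bval_main_guard)
  obtain s1 where s1: "iterations main_guard main_step (300 + 130 * h) (Suc 0) s s1"
    "env m V d s1" "s1 16 0 = s 16 0" "top_segment s1 p e (Suc i) (m + length gs) pos 0 r"
    "gates_of s1 = gs @ [(parity_op p, acc, r)]" "same_below (s 16 0) s s1"
    by (rule iterations_run[OF g step_signal[OF pr(2,3,5) chain_signal.hyps(1,2) pr(6)], of "300 + 130 * h"])
      (use pr(4) in auto)
  have sp: "0 < s1 16 0" using pr(8) chain_signal.hyps(1) s1(3) by auto
  from chain_signal.IH[OF pr(1) s1(2,4,5) pr(5,6,7)] sp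
  obtain s2 i' r' where s2: "iterations main_guard main_step (300 + 130 * h) k s1 s2" "env m V d s2"
    "s2 16 0 = s1 16 0" "top_segment s2 p e i' v e 0 r'" "gates_of s2 = gs'" "same_below (s1 16 0) s1 s2"
    by blast
  have "same_below (s 16 0) s s2" using same_below_trans[OF s1(6) s2(6)] s1(3) by simp
  then show ?case using iterations_trans[OF s1(1) s2(1)] s2 s1(3) by auto
next
  case (chain_single i J pos e gs p acc r gs' v k)
  note pr = chain_single.prems
  have m: "s 0 0 = m" using pr(2) by (simp add: env_def)
  have g: "bval main_guard s"
    using pr(3,8) m chain_single.hyps(3) by (auto simp: bval_main_guard top_segment_def)
  obtain s1 where s1: "iterations main_guard main_step (300 + 130 * h) (Suc 0) s s1"
    "env m V d s1" "s1 16 0 = s 16 0" "top_segment s1 p e (Suc i) (m + length gs) (pos + 1) J r"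
    "gates_of s1 = gs @ [(parity_op p, acc, pos)]" "same_below (s 16 0) s s1"
    by (rule iterations_run[OF g step_single[OF pr(2,3,5) chain_single.hyps(1,2,3)], of "300 + 130 * h"])
      (use pr(4) in auto)
  have le: "pos + 1 \<le> e" using chain_single.hyps(3) by simp
  from chain_single.IH[OF pr(1) s1(2,4,5) pr(5) le pr(7)] pr(8) s1(3)
  obtain s2 i' r' where s2: "iterations main_guard main_step (300 + 130 * h) k s1 s2" "env m V d s2"
    "s2 16 0 = s1 16 0" "top_segment s2 p e i' v e 0 r'" "gates_of s2 = gs'" "same_below (s1 16 0) s1 s2"
    by auto
  have "same_below (s 16 0) s s2" using same_below_trans[OF s1(6) s2(6)] s1(3) by simp
  then show ?case using iterations_trans[OF s1(1) s2(1)] s2 s1(3) by auto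
next
  case (chain_pair i J pos e gs p acc r gs' v k)
  note pr = chain_pair.prems
  have m: "s 0 0 = m" using pr(2) by (simp add: env_def)
  have g: "bval main_guard s"
    using pr(3,8) m chain_pair.hyps(3) by (auto simp: bval_main_guard top_segment_def)
  obtain s1 where s1: "iterations main_guard main_step (300 + 130 * h) (Suc 0) s s1"
    "env m V d s1" "s1 16 0 = s 16 0" "top_segment s1 p e 2 (m + length gs + 1) (pos + 2) J r"
    "gates_of s1 = gs @ [(parity_op (1 - p), pos, pos + 1), (parity_op p, acc, m + length gs)]"
    "same_below (s 16 0) s s1"
    by (rule iterations_run[OF g step_pair[OF pr(2,3,5) chain_pair.hyps(1,2,3)], of "300 + 130 * h"])
      (use pr(4) in auto)
  have le: "pos + 2 \<le> e" using chain_pair.hyps(3) by simp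
  from chain_pair.IH[OF pr(1) s1(2,4,5) pr(5) le pr(7)] pr(8) s1(3)
  obtain s2 i' r' where s2: "iterations main_guard main_step (300 + 130 * h) k s1 s2" "env m V d s2"
    "s2 16 0 = s1 16 0" "top_segment s2 p e i' v e 0 r'" "gates_of s2 = gs'" "same_below (s1 16 0) s1 s2"
    by auto
  have "same_below (s 16 0) s s2" using same_below_trans[OF s1(6) s2(6)] s1(3) by simp
  then show ?case using iterations_trans[OF s1(1) s2(1)] s2 s1(3) by auto
next
  case (chain_slot i J pos e e' p gs gs\<^sub>1 r' gs\<^sub>2 v' k\<^sub>1 acc r gs' v k\<^sub>2)
  note pr = chain_slot.prems
  let ?t = "s 16 0"
  have m: "s 0 0 = m" using pr(2) by (simp add: env_def)
  have T: "s 10 ?t = p" "s 11 ?t = acc" "s 12 ?t = i" "s 13 ?t = J" "s 14 ?t = r" "s 15 ?t = e"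
    using pr(3) by (simp_all add: top_segment_def)
  have g: "bval main_guard s"
    using pr(3,8) m chain_slot.hyps(4) by (auto simp: bval_main_guard top_segment_def)
  have lev: "slot_lev i \<le> h" using pr(1) chain_slot.hyps(1,2) by blast
  have len: "2 \<le> slot_len i" using slot_len_pos[of i] chain_slot.hyps(1) by simp
  have e': "pos + 1 \<le> e'" "e' \<le> e"
    using len chain_slot.hyps(4) slot_cap_bounds[of i] unfolding chain_slot.hyps(5) by auto
  obtain s1 where s1: "iterations main_guard main_step (300 + 130 * h) (Suc 0) s s1"
    "env m V d s1" "s1 16 0 = Suc ?t"
    "top_segment s1 (1 - p) e' 0 pos (pos + 1) (Suc (slot_lev i)) r'" "gates_of s1 = gs\<^sub>1"
    "same_below (Suc ?t) s s1"
    by (rule iterations_run[OF g step_push[OF pr(2,3,5) chain_slot.hyps(1-4) pr(7) chain_slot.hyps(5)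
      chain_slot.hyps(6)[folded pr(4)]], of "300 + 130 * h"]) (use lev in auto)
  have "1 - p < 2" "e' \<le> m" "0 < s1 16 0" using e' pr(7) s1(3) by simp_all
  from chain_slot.IH(1)[OF pr(1) s1(2,4,5) this(1) e'(1) this(2)] this(3)
  obtain s2 i' r'' where s2: "iterations main_guard main_step (300 + 130 * h) k\<^sub>1 s1 s2" "env m V d s2"
    "s2 16 0 = s1 16 0" "top_segment s2 (1 - p) e' i' v' e' 0 r''" "gates_of s2 = gs\<^sub>2"
    "same_below (s1 16 0) s1 s2"
    by blast
  have B: "same_below (Suc ?t) s s2" using same_below_trans[OF s1(6) s2(6)] s1(3) by simp
  have t2: "s2 16 0 = Suc ?t" using s2(3) s1(3) by simp
  have U: "s2 10 ?t = p" "s2 11 ?t = acc" "s2 12 ?t = i" "s2 13 ?t = J" "s2 14 ?t = r" "s2 15 ?t = e"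
    using B T by (simp_all add: same_below_def)
  have W: "s2 13 (Suc ?t) = 0" "s2 15 (Suc ?t) = s2 17 0" "s2 17 0 = e'" "s2 11 (Suc ?t) = v'"
    using s2(4) t2 by (simp_all add: top_segment_def)
  have g2: "bval main_guard s2" using t2 by (simp add: bval_main_guard)
  obtain s3 where s3: "iterations main_guard main_step (300 + 130 * h) (Suc 0) s2 s3"
    "env m V d s3" "s3 16 0 = ?t" "top_segment s3 p e (Suc i) (m + length gs\<^sub>2) e' J r"
    "gates_of s3 = gs\<^sub>2 @ [(parity_op p, acc, v')]" "same_below ?t s2 s3"
    by (rule iterations_run[OF g2 step_pop[OF s2(2) t2 W(1,2) U pr(5)], of "300 + 130 * h"])
      (use s2(5) W in auto)
  from chain_slot.IH(2)[OF pr(1) s3(2,4,5) pr(5) e'(2) pr(7)] pr(8) s3(3)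
  obtain s4 i'' r''' where s4: "iterations main_guard main_step (300 + 130 * h) k\<^sub>2 s3 s4" "env m V d s4"
    "s4 16 0 = s3 16 0" "top_segment s4 p e i'' v e 0 r'''" "gates_of s4 = gs'" "same_below (s3 16 0) s3 s4"
    by auto
  have "same_below ?t s s4"
    using same_below_trans[OF same_below_trans[OF same_below_mono[OF B] s3(6)] s4(6)] s3(3) by simp
  moreover have "iterations main_guard main_step (300 + 130 * h) (k\<^sub>1 + k\<^sub>2 + 2) s s4"
    using iterations_trans[OF iterations_trans[OF s1(1) s2(1)] iterations_trans[OF s3(1) s4(1)]]
    by (simp add: add.commute add.left_commute)
  ultimately show ?case using s4 s3(3) by auto
qed

section \<open>Tables\<close>

text \<open>The machine cannot divide, so halves are tabulated once, two equal entries per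
  iteration.\<close>

definition half_table :: com where
  "half_table = While (Less (Var 19) (Plus num_inputs (Const 1)))
     (Seq (Assign 6 (Var 19) (Var 24)) (Seq (Assign 6 (Plus (Var 19) (Const 1)) (Var 24))
     (Seq (Set 19 (Plus (Var 19) (Const 2))) (Set 24 (Plus (Var 24) (Const 1))))))"

lemma run_half_table:
  assumes "s 0 0 = m" "s 19 0 = 0" "s 24 0 = 0"
  shows "run half_table s (40 * m + 90)
    (\<lambda>s'. (\<forall>x\<le>m. s' 6 x = x div 2) \<and> (\<forall>a. a \<notin> {6, 19, 24} \<longrightarrow> s' a = s a))"
proof -
  define inv where "inv s' \<longleftrightarrow> s' 19 0 = 2 * s' 24 0 \<and> (\<forall>x<s' 19 0. s' 6 x = x div 2) \<and>
    (\<forall>a. a \<notin> {6, 19, 24} \<longrightarrow> s' a = s a)" for s' :: store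
  let ?b = "Less (Var 19) (Plus num_inputs (Const 1))"
  let ?c = "Seq (Assign 6 (Var 19) (Var 24)) (Seq (Assign 6 (Plus (Var 19) (Const 1)) (Var 24))
     (Seq (Set 19 (Plus (Var 19) (Const 2))) (Set 24 (Plus (Var 24) (Const 1)))))"
  have "run (While ?b ?c) s (40 * (m + 2 - s 19 0) + (1 + bcost ?b)) (\<lambda>s'. inv s' \<and> \<not> bval ?b s')"
  proof (rule run_While[where P = inv and f = "\<lambda>s'. 40 * (m + 2 - s' 19 0)"])
    show "inv s" using assms by (simp add: inv_def)
    fix t assume t: "inv t" "bval ?b t"
    have m: "t 0 0 = m" using t(1) assms(1) by (simp add: inv_def)
    have "inv (result ?c t)" using t(1) by (auto simp: inv_def less_Suc_eq)
    moreover have "result ?c t 19 0 = t 19 0 + 2" by simp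
    ultimately show "\<exists>B. run ?c t B (\<lambda>s'. inv s' \<and>
        B + (1 + bcost ?b) + 40 * (m + 2 - s' 19 0) \<le> 40 * (m + 2 - t 19 0))"
      using t(2) m by (intro exI[of _ 30] run_loop_free) simp_all
  qed
  then show ?thesis
    unfolding half_table_def
  proof (rule run_mono)
    fix t assume t: "inv t \<and> \<not> bval ?b t"
    then have "t 0 0 = m" using assms(1) by (simp add: inv_def)
    then have "\<forall>x\<le>m. x < t 19 0" using t by simp
    then show "(\<forall>x\<le>m. t 6 x = x div 2) \<and> (\<forall>a. a \<notin> {6, 19, 24} \<longrightarrow> t a = s a)"
      using t unfolding inv_def by blast
  qed (use assms in simp)
qed

definition slot_table_init :: com where
  "slot_table_init =
     Seq (Assign 7 (Const 2) (Const 2)) (Seq (Assign 7 (Const 3) (Const 2))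
     (Seq (Assign 7 (Const 4) (Const 6)) (Seq (Assign 8 (Const 2) (Const 2))
     (Seq (Assign 8 (Const 3) (Const 3)) (Seq (Assign 8 (Const 4) (Const 6))
     (Seq (Assign 9 (Const 2) (Const 0)) (Seq (Assign 9 (Const 3) (Const 1))
     (Seq (Assign 9 (Const 4) (Const 1)) (Seq (Set 19 (Const 12)) (Seq (Set 20 (Const 6))
     (Seq (Set 21 (Const 1)) (Set 22 (Const 5)))))))))))))"

definition slot_table_step :: com where
  "slot_table_step =
     Seq (IfElse (Less (Var 20) (Var 19))
       (Seq (Set 20 (Plus (Var 20) (Var 20))) (Set 21 (Plus (Var 21) (Const 1)))) Skip)
     (Seq (Assign 7 (Var 22) (Minus (Var 19) (Cell 7 (Plus (Var 21) (Const 1)))))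
     (Seq (Assign 8 (Var 22) (Plus (Cell 7 (Var 22)) (Const 1)))
     (Seq (Assign 9 (Var 22) (Var 21))
     (Seq (Set 19 (Plus (Var 19) (Cell 7 (Var 22)))) (Set 22 (Plus (Var 22) (Const 1)))))))"

lemma run_slot_table:
  assumes "s 0 0 = m"
  shows "run (Seq slot_table_init (While (Less (Var 19) num_inputs) slot_table_step)) s (80 * m + 80)
    (\<lambda>s'. (\<forall>x. 2 \<le> x \<and> slot_pre x < m \<longrightarrow>
        s' 7 x = slot_len x \<and> s' 8 x = slot_cap x \<and> s' 9 x = slot_lev x) \<and>
      (\<forall>a. a \<notin> {7, 8, 9, 19, 20, 21, 22} \<longrightarrow> s' a = s a))"
proof -
  let ?b = "Less (Var 19) num_inputs"
  define inv where "inv s' \<longleftrightarrow> (\<exists>k\<ge>4. s' 22 0 = Suc k \<and> s' 19 0 = slot_pre (Suc k) \<and>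
      s' 20 0 = 3 * 2 ^ slot_lev k \<and> s' 21 0 = slot_lev k \<and>
      (\<forall>x. 2 \<le> x \<and> x < Suc k \<longrightarrow>
        s' 7 x = slot_len x \<and> s' 8 x = slot_cap x \<and> s' 9 x = slot_lev x)) \<and>
    (\<forall>a. a \<notin> {7, 8, 9, 19, 20, 21, 22} \<longrightarrow> s' a = s a)" for s' :: store
  have init: "run slot_table_init s 60 (\<lambda>s'. inv s' \<and> s' 19 0 = 12)"
  proof (rule run_loop_free)
    have x: "x = 2 \<or> x = 3 \<or> x = 4" if "2 \<le> x \<and> x < Suc 4" for x :: nat using that by auto
    have "inv (result slot_table_init s)"
      unfolding inv_def
    proof (intro conjI exI[of _ 4] allI impI)
      fix x :: nat assume "2 \<le> x \<and> x < Suc 4"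
      from x[OF this] show "result slot_table_init s 7 x = slot_len x"
        "result slot_table_init s 8 x = slot_cap x" "result slot_table_init s 9 x = slot_lev x"
        by (elim disjE; simp add: slot_table_init_def)+
    qed (simp_all add: slot_table_init_def)
    then show "inv (result slot_table_init s) \<and> result slot_table_init s 19 0 = 12"
      by (simp add: slot_table_init_def)
  qed (simp_all add: slot_table_init_def)
  have loop: "run (While ?b slot_table_step) t (70 * (m - 12) + (1 + bcost ?b))
      (\<lambda>s'. inv s' \<and> \<not> bval ?b s')" if t: "inv t \<and> t 19 0 = 12" for t
  proof (rule run_mono[OF run_While[where P = inv and f = "\<lambda>s'. 70 * (m - s' 19 0)"]])
    fix t assume t: "inv t" "bval ?b t"
    have m: "t 0 0 = m" using t(1) assms by (simp add: inv_def)
    from t(1) obtain k where k: "4 \<le> k" "t 22 0 = Suc k" "t 19 0 = slot_pre (Suc k)"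
      "t 20 0 = 3 * 2 ^ slot_lev k" "t 21 0 = slot_lev k"
      and tab: "\<forall>x. 2 \<le> x \<and> x < Suc k \<longrightarrow>
        t 7 x = slot_len x \<and> t 8 x = slot_cap x \<and> t 9 x = slot_lev x"
      and fr: "\<forall>a. a \<notin> {7, 8, 9, 19, 20, 21, 22} \<longrightarrow> t a = s a"
      unfolding inv_def by blast
    let ?l = "slot_lev (Suc k)"
    define t1 where "t1 = t(20 := (t 20)(0 := 3 * 2 ^ ?l), 21 := (t 21)(0 := ?l))"
    have l: "?l = (if 3 * 2 ^ slot_lev k < slot_pre (Suc k) then Suc (slot_lev k) else slot_lev k)"
      by (rule slot_lev_rec(1)[OF k(1)])
    have t1: "result (IfElse (Less (Var 20) (Var 19))
       (Seq (Set 20 (Plus (Var 20) (Var 20))) (Set 21 (Plus (Var 21) (Const 1)))) Skip) t = t1"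
    proof (cases "3 * 2 ^ slot_lev k < slot_pre (Suc k)")
      case True
      then show ?thesis using k l by (simp del: slot_pre_Suc add: t1_def)
    next
      case False
      have "(t 20)(0 := t 20 0) = t 20" "(t 21)(0 := t 21 0) = t 21" by simp_all
      then show ?thesis using False k l by (simp del: slot_pre_Suc fun_upd_triv add: t1_def) simp
    qed
    have ge: "2 \<le> Suc ?l" "Suc ?l < Suc k"
      using slot_lev_pos[of "Suc k"] slot_lev_le[of "Suc k"] k(1) by simp_all
    have len: "slot_pre (Suc k) - t 7 (Suc ?l) = slot_len (Suc k)"
      using slot_lev_rec(2)[OF k(1)] tab ge by simp
    have cap: "slot_cap (Suc k) = Suc (slot_len (Suc k))" using k(1) by (simp add: slot_cap_def)
    have len6: "6 \<le> slot_len (Suc k)" using slot_len_ge_6[of "Suc k"] k(1) by simp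
    let ?t = "result slot_table_step t"
    have t': "?t = t1(7 := (t 7)(Suc k := slot_len (Suc k)), 8 := (t 8)(Suc k := slot_cap (Suc k)),
        9 := (t 9)(Suc k := ?l), 19 := (t 19)(0 := slot_pre (Suc (Suc k))),
        22 := (t 22)(0 := Suc (Suc k)))"
      unfolding slot_table_step_def result.simps(3) t1
      using k len cap by (simp del: slot_pre_Suc add: t1_def) simp
    have "inv ?t"
      unfolding inv_def
    proof (intro conjI exI[of _ "Suc k"] allI impI)
      fix x assume "2 \<le> x \<and> x < Suc (Suc k)"
      then show "?t 7 x = slot_len x" "?t 8 x = slot_cap x" "?t 9 x = slot_lev x"
        using tab unfolding t' by (auto simp: less_Suc_eq)
    next
      fix a :: nat assume "a \<notin> {7, 8, 9, 19, 20, 21, 22}"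
      then show "?t a = s a" using fr unfolding t' t1_def by simp
    qed (use k(1) in \<open>simp_all add: t' t1_def\<close>)
    moreover have "?t 19 0 = t 19 0 + slot_len (Suc k)" unfolding t' k(3) by simp
    ultimately show "\<exists>B. run slot_table_step t B (\<lambda>s'. inv s' \<and>
        B + (1 + bcost ?b) + 70 * (m - s' 19 0) \<le> 70 * (m - t 19 0))"
      using t(2) m len6
      by (intro exI[of _ 60] run_loop_free) (simp_all add: slot_table_step_def)
  qed (use t in simp_all)
  have "run (Seq slot_table_init (While ?b slot_table_step)) s
      (60 + (70 * (m - 12) + (1 + bcost ?b))) (\<lambda>s'. inv s' \<and> \<not> bval ?b s')"
    by (rule run_Seq[OF init loop])
  then show ?thesis
  proof (rule run_mono)
    fix t assume t: "inv t \<and> \<not> bval ?b t"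
    then have m: "t 0 0 = m" using assms by (simp add: inv_def)
    from t obtain k where k: "t 19 0 = slot_pre (Suc k)"
      and tab: "\<forall>x. 2 \<le> x \<and> x < Suc k \<longrightarrow>
        t 7 x = slot_len x \<and> t 8 x = slot_cap x \<and> t 9 x = slot_lev x"
      and fr: "\<forall>a. a \<notin> {7, 8, 9, 19, 20, 21, 22} \<longrightarrow> t a = s a"
      unfolding inv_def by blast
    have "x < Suc k" if "slot_pre x < m" for x
      using that slot_pre_mono[of "Suc k" x] t m k by (cases "x < Suc k") auto
    then show "(\<forall>x. 2 \<le> x \<and> slot_pre x < m \<longrightarrow>
        t 7 x = slot_len x \<and> t 8 x = slot_cap x \<and> t 9 x = slot_lev x) \<and>
      (\<forall>a. a \<notin> {7, 8, 9, 19, 20, 21, 22} \<longrightarrow> t a = s a)"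
      using tab fr by blast
  qed simp
qed

section \<open>Construction of the shared trees\<close>

definition levels_built :: "nat \<Rightarrow> (nat \<Rightarrow> nat) \<Rightarrow> gate list \<Rightarrow> nat \<Rightarrow> bool" where
  "levels_built m V gs h \<longleftrightarrow> (\<forall>k y. k \<le> h \<longrightarrow> block_fits m k y \<longrightarrow>
     realizes m gs (V (k * m + y)) (agg y (block k y)) k)"

definition level_built :: "nat \<Rightarrow> (nat \<Rightarrow> nat) \<Rightarrow> gate list \<Rightarrow> nat \<Rightarrow> nat \<Rightarrow> bool" where
  "level_built m V gs h x \<longleftrightarrow> (\<forall>y<x. block_fits m h y \<and>
     realizes m gs (V (h * m + y)) (agg y (block h y)) h)"

lemma block_fits_less: "block_fits m h y \<Longrightarrow> y < m"
proof -
  assume fits: "block_fits m h y"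
  define b where "b = Suc (y div 2) * 2 ^ h"
  have "Suc (y div 2) \<le> b" using mult_le_mono2[of 1 "2 ^ h" "Suc (y div 2)"] by (simp add: b_def)
  moreover have "y mod 2 + 2 * b \<le> m + 1" using fits unfolding block_fits_def b_def .
  ultimately show ?thesis using div_mult_mod_eq[of y 2] by linarith
qed

text \<open>For \<open>x = 2 * q + p\<close>, the halves of a block have the numbers
  \<open>2 * q\<close> and \<open>2 * q + 1\<close> within their parity, hence the indices
  \<open>4 * q + p\<close> and \<open>4 * q + p + 2\<close>; and \<open>2 * x - x mod 2\<close> is
  \<open>4 * q + p\<close>.\<close>

lemma child_index: "(2 * x - x mod 2) mod 2 = x mod 2" "(2 * x - x mod 2) div 2 = 2 * (x div 2)"
    "(2 * x - x mod 2 + 2) mod 2 = x mod 2" "(2 * x - x mod 2 + 2) div 2 = Suc (2 * (x div 2))"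
proof -
  define q where "q = x div 2"
  have "x mod 2 = 0 \<or> x mod 2 = 1" by linarith
  moreover have "2 * x - x mod 2 = 4 * q + x mod 2"
    using div_mult_mod_eq[of x 2] unfolding q_def by linarith
  moreover have "Suc (4 * q) mod 2 = Suc 0" by presburger
  ultimately show "(2 * x - x mod 2) mod 2 = x mod 2" "(2 * x - x mod 2) div 2 = 2 * (x div 2)"
    "(2 * x - x mod 2 + 2) mod 2 = x mod 2" "(2 * x - x mod 2 + 2) div 2 = Suc (2 * (x div 2))"
    unfolding q_def[symmetric] by auto
qed

lemma block_fits_Suc: "block_fits m (Suc h) x \<longleftrightarrow> block_fits m h (2 * x - x mod 2 + 2)"
  unfolding block_fits_def child_index by simp

text \<open>The numbering of a level follows the last positions of the blocks, so the fitting blocks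
  form an initial segment, which a single count describes.\<close>

lemma block_fits_antimono:
  assumes "block_fits m h y" "x \<le> y"
  shows "block_fits m h x"
proof (cases "x div 2 = y div 2")
  case True
  then have "x mod 2 \<le> y mod 2" using assms(2) by presburger
  then show ?thesis using assms(1) True unfolding block_fits_def by simp
next
  case False
  then have "Suc (x div 2) \<le> y div 2" using assms(2) by (simp add: Suc_leI div_le_mono le_neq_implies_less)
  then have "Suc (Suc (x div 2)) * 2 ^ h \<le> Suc (y div 2) * 2 ^ h" by (intro mult_le_mono1) simp
  moreover have "Suc (Suc (x div 2)) * 2 ^ h = 2 ^ h + Suc (x div 2) * 2 ^ h" by simp
  moreover have "1 \<le> (2::nat) ^ h" "x mod 2 \<le> 1" by simp_all
  ultimately show ?thesis using assms(1) unfolding block_fits_def by linarith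
qed

lemma block_Suc:
  "block (Suc h) x = block h (2 * x - x mod 2) \<union> block h (2 * x - x mod 2 + 2)"
  unfolding block_iff set_eq_iff Un_iff child_index by (auto simp: algebra_simps)

lemma block_disjoint: "block h (2 * x - x mod 2) \<noteq> block h (2 * x - x mod 2 + 2)"
  using block_nonempty[of h "2 * x - x mod 2"] unfolding block_def child_index by auto

lemma level_built_step:
  assumes m: "levels_built m V gs h" and x: "level_built m V gs (Suc h) x" and sound: "sound m d gs"
    and h: "h < d" and fits: "block_fits m (Suc h) x"
  defines "gs' \<equiv> gs @ [(parity_op (x mod 2), V (h * m + (2 * x - x mod 2)), V (h * m + (2 * x - x mod 2 + 2)))]"
    and "V' \<equiv> V(Suc h * m + x := m + length gs)"
  shows "levels_built m V' gs' h" "level_built m V' gs' (Suc h) (Suc x)" "sound m d gs'"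
proof -
  let ?c = "2 * x - x mod 2"
  let ?f = "parity_op (x mod 2)"
  have f2: "block_fits m h (?c + 2)" using fits by (simp add: block_fits_Suc)
  have f1: "block_fits m h ?c" by (rule block_fits_antimono[OF f2]) simp
  have par: "agg ?c = agg (x mod 2)" "agg (?c + 2) = agg (x mod 2)" "agg x = agg (x mod 2)"
    by (rule agg_parity, simp only: even_iff_mod_2_eq_zero child_index mod_mod_trivial)+
  have r: "realizes m gs (V (h * m + ?c)) (agg (x mod 2) (block h ?c)) h"
    "realizes m gs (V (h * m + (?c + 2))) (agg (x mod 2) (block h (?c + 2))) h"
    using m[unfolded levels_built_def, rule_format, OF order_refl f1]
      m[unfolded levels_built_def, rule_format, OF order_refl f2] unfolding par(1,2) .
  have ne: "V (h * m + ?c) \<noteq> V (h * m + (?c + 2))"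
  proof
    assume eq: "V (h * m + ?c) = V (h * m + (?c + 2))"
    have "agg (x mod 2) (block h ?c) = agg (x mod 2) (block h (?c + 2))"
      by (rule realizes_unique[OF r(1)[unfolded eq] r(2)])
    from agg_inj[OF this] block_disjoint[of h x] show False by contradiction
  qed
  show "sound m d gs'" unfolding gs'_def by (rule sound_gate[OF sound r ne h h])
  have new: "realizes m gs' (m + length gs) (agg x (block (Suc h) x)) (Suc h)"
    using realizes_gate[OF r, of ?f] unfolding gs'_def par block_Suc by (simp add: agg_Un)
  have V': "V' (k * m + y) = V (k * m + y)" if "k \<le> h" "y < m" for k y
  proof -
    have "k * m + y < Suc h * m"
      unfolding mult_Suc using that(2) mult_le_mono1[OF that(1), of m] by linarith
    then show ?thesis unfolding V'_def by simp
  qed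
  show "levels_built m V' gs' h"
    unfolding levels_built_def
  proof (intro allI impI)
    fix k y assume k: "k \<le> h" "block_fits m k y"
    then have "realizes m gs (V (k * m + y)) (agg y (block k y)) k"
      using m unfolding levels_built_def by blast
    then show "realizes m gs' (V' (k * m + y)) (agg y (block k y)) k"
      unfolding gs'_def V'[OF k(1) block_fits_less[OF k(2)]] by (rule realizes_append)
  qed
  show "level_built m V' gs' (Suc h) (Suc x)"
    unfolding level_built_def
  proof (intro allI impI)
    fix y assume "y < Suc x"
    then consider "y < x" | "y = x" by linarith
    then show "block_fits m (Suc h) y \<and>
        realizes m gs' (V' (Suc h * m + y)) (agg y (block (Suc h) y)) (Suc h)"
    proof cases
      case 1
      then have *: "block_fits m (Suc h) y"
        "realizes m gs (V (Suc h * m + y)) (agg y (block (Suc h) y)) (Suc h)"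
        using x unfolding level_built_def by blast+
      have "V' (Suc h * m + y) = V (Suc h * m + y)" unfolding V'_def using 1 by simp
      then show ?thesis using * realizes_append[OF *(2)] unfolding gs'_def by simp
    next
      case 2
      then show ?thesis using fits new unfolding V'_def by simp
    qed
  qed
qed

text \<open>Cell 22 holds the child index \<open>2 * x - x mod 2\<close>. It is updated by adding 1
  or 3, depending on the parity of \<open>x\<close> in cell 18, which avoids a case distinction on a
  computed remainder.\<close>

definition tree_step :: com where
  "tree_step =
     Seq (emit (Var 18) (Cell 5 (Plus (Var 20) (Var 22)))
       (Cell 5 (Plus (Var 20) (Plus (Var 22) (Const 2)))))
     (Seq (Assign 5 (Plus (Plus (Var 20) num_inputs) (Var 23)) last_vertex)
     (Seq (IfElse (Less (Var 18) (Const 1))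
       (Seq (Set 22 (Plus (Var 22) (Const 1))) (Set 18 (Const 1)))
       (Seq (Set 22 (Plus (Var 22) (Const 3))) (Set 18 (Const 0))))
     (Set 23 (Plus (Var 23) (Const 1)))))"

definition tree_level :: com where
  "tree_level =
     Seq (Seq (Set 22 (Const 0)) (Seq (Set 23 (Const 0)) (Set 18 (Const 0))))
     (Seq (While (Less (Plus (Var 22) (Const 2)) (Var 21)) tree_step)
     (Seq (Set 21 (Var 23)) (Set 20 (Plus (Var 20) num_inputs))))"

definition trees :: com where
  "trees =
     Seq (Set 19 (Const 0))
     (Seq (While (Less (Var 19) num_inputs) (Seq (Assign 5 (Var 19) (Var 19)) (Set 19 (Plus (Var 19) (Const 1)))))
     (Seq (Seq (Set 20 (Const 0)) (Set 21 num_inputs))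
       (While (Less (Const 0) (Var 21)) tree_level)))"

abbreviation tree_arrays :: "nat set" where
  "tree_arrays \<equiv> {0, 2, 3, 4, 5, 18, 19, 20, 21, 22, 23}"

text \<open>
  Cell 21 contains the number of blocks of level h.
\<close>

definition tree_inv :: "nat \<Rightarrow> nat \<Rightarrow> store \<Rightarrow> nat \<Rightarrow> store \<Rightarrow> bool" where
  "tree_inv m d s h t \<longleftrightarrow> t 0 0 = m \<and> t 20 0 = h * m \<and> (\<forall>y. y < t 21 0 \<longleftrightarrow> block_fits m h y) \<and>
     levels_built m (t 5) (gates_of t) h \<and> sound m d (gates_of t) \<and>
     length (gates_of t) + t 21 0 \<le> m \<and> (t 21 0 < 2 \<longrightarrow> length (gates_of t) + 2 \<le> m) \<and>
     (\<forall>a. a \<notin> tree_arrays \<longrightarrow> t a = s a)"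

text \<open>Each new block costs a gate and stands for two old ones, so gates plus current blocks
  never exceed their initial number \<open>m\<close>. A positive number \<open>x\<close> of new
  blocks needs at least \<open>x + 2\<close> old ones, which yields the final saving of two gates;
  the clause for fewer than two blocks keeps it.\<close>

lemma run_tree_level:
  assumes t: "tree_inv m d s h t" and pos: "0 < t 21 0"
    and d: "\<And>h x. block_fits m (Suc h) x \<Longrightarrow> h < d"
  shows "run tree_level t (200 * (t 21 0 div 2) + 50)
    (\<lambda>t'. tree_inv m d s (Suc h) t' \<and> 2 * t' 21 0 \<le> t 21 0)"
proof -
  define L where "L = t 21 0"
  define n where "n = length (gates_of t)"
  define inv where "inv t' \<longleftrightarrow> t' 0 0 = m \<and> t' 20 0 = h * m \<and> t' 21 0 = L \<and>
    t' 18 0 = t' 23 0 mod 2 \<and> t' 22 0 = 2 * t' 23 0 - t' 23 0 mod 2 \<and>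
    (0 < t' 23 0 \<longrightarrow> t' 23 0 + 2 \<le> L) \<and> 2 * t' 23 0 \<le> L \<and>
    length (gates_of t') = n + t' 23 0 \<and> sound m d (gates_of t') \<and>
    levels_built m (t' 5) (gates_of t') h \<and> level_built m (t' 5) (gates_of t') (Suc h) (t' 23 0) \<and>
    (\<forall>a. a \<notin> tree_arrays \<longrightarrow> t' a = s a)" for t'
  let ?b = "Less (Plus (Var 22) (Const 2)) (Var 21)"
  let ?init = "Seq (Set 22 (Const 0)) (Seq (Set 23 (Const 0)) (Set 18 (Const 0)))"
  let ?exit = "Seq (Set 21 (Var 23)) (Set 20 (Plus (Var 20) num_inputs))"
  have L: "y < L \<longleftrightarrow> block_fits m h y" for y
    using t unfolding tree_inv_def L_def by blast
  have 1: "run ?init t 20 (\<lambda>t'. inv t' \<and> t' 23 0 = 0)"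
    by (rule run_loop_free)
      (use t in \<open>simp_all add: tree_inv_def inv_def L_def n_def level_built_def\<close>)
  have 2: "run (While ?b tree_step) t' (200 * (L div 2) + (1 + bcost ?b)) (\<lambda>t'. inv t' \<and> \<not> bval ?b t')"
    if t': "inv t' \<and> t' 23 0 = 0" for t'
  proof (rule run_mono[OF run_While[where P = inv and f = "\<lambda>t. 200 * (L div 2 - t 23 0)"]])
    fix u assume u: "inv u" "bval ?b u"
    define x where "x = u 23 0"
    let ?c = "2 * x - x mod 2"
    from u(1) have U: "u 0 0 = m" "u 20 0 = h * m" "u 21 0 = L" "u 18 0 = x mod 2" "u 22 0 = ?c"
      "length (gates_of u) = n + x" and S: "sound m d (gates_of u)"
      and B: "levels_built m (u 5) (gates_of u) h" "level_built m (u 5) (gates_of u) (Suc h) x"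
      and F: "\<forall>a. a \<notin> tree_arrays \<longrightarrow> u a = s a"
      unfolding inv_def x_def by blast+
    have cL: "?c + 2 < L" using u(2) U by simp
    then have fits: "block_fits m (Suc h) x" unfolding block_fits_Suc L[symmetric] .
    have x1: "x mod 2 = 0 \<or> x mod 2 = 1" by linarith
    have xL: "Suc x + 2 \<le> L" "2 * Suc x \<le> L"
    proof -
      have bound: "2 * Suc x \<le> L \<and> Suc x + 2 \<le> L" if "2 * x - r + 2 < L" "r \<le> x" "r \<le> 1" for r
        using that by (cases r) auto
      show "Suc x + 2 \<le> L" "2 * Suc x \<le> L" using bound[OF cL] by simp_all
    qed
    note step = level_built_step[OF B S d[OF fits] fits]
    let ?gs = "gates_of u @ [(parity_op (x mod 2), u 5 (h * m + ?c), u 5 (h * m + (?c + 2)))]"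
    let ?V = "(u 5)(Suc h * m + x := m + length (gates_of u))"
    let ?u = "result tree_step u"
    have R: "gates_of ?u = ?gs" "?u 5 = ?V" "?u 0 0 = m" "?u 20 0 = h * m" "?u 21 0 = L" "?u 23 0 = Suc x"
      "?u 18 0 = Suc x mod 2" "?u 22 0 = 2 * Suc x - Suc x mod 2"
      and R': "\<forall>a. a \<notin> tree_arrays \<longrightarrow> ?u a = u a"
    proof -
      have idx: "m + h * m + x = h * m + (m + x)" "Suc (h * m + (m + x)) = h * m + (m + Suc x)" by simp_all
      have le: "x mod 2 \<le> x" by simp
      from x1 have all: "gates_of ?u = ?gs \<and> ?u 5 = ?V \<and> ?u 0 0 = m \<and> ?u 20 0 = h * m \<and> ?u 21 0 = L \<and>
          ?u 23 0 = Suc x \<and> ?u 18 0 = Suc x mod 2 \<and> ?u 22 0 = 2 * Suc x - Suc x mod 2 \<and>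
          (\<forall>a. a \<notin> tree_arrays \<longrightarrow> ?u a = u a)"
      proof
        assume "x mod 2 = 0"
        moreover from this have "Suc x mod 2 = 1" by (simp add: mod_Suc)
        ultimately show ?thesis
          using U(1-5) x_def by (simp add: tree_step_def emit_def add.assoc add.left_commute)
      next
        assume "x mod 2 = 1"
        moreover from this have "Suc x mod 2 = 0" by (simp add: mod_Suc)
        moreover have "1 \<le> x" using le \<open>x mod 2 = 1\<close> by simp
        ultimately show ?thesis
          using U(1-5) x_def by (simp add: tree_step_def emit_def add.assoc add.left_commute)
      qed
      then show "gates_of ?u = ?gs" "?u 5 = ?V" "?u 0 0 = m" "?u 20 0 = h * m" "?u 21 0 = L" "?u 23 0 = Suc x"
          "?u 18 0 = Suc x mod 2" "?u 22 0 = 2 * Suc x - Suc x mod 2"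
          "\<forall>a. a \<notin> tree_arrays \<longrightarrow> ?u a = u a" by - (elim conjE, assumption)+
    qed
    have "inv ?u"
      unfolding inv_def R(1-8)
      using step R(3-8) xL U(6) F R' by (simp add: x_def)
    then show "\<exists>B. run tree_step u B (\<lambda>t'. inv t' \<and>
        B + (1 + bcost ?b) + 200 * (L div 2 - t' 23 0) \<le> 200 * (L div 2 - u 23 0))"
      using R(6) xL(2) unfolding x_def
      by (intro exI[of _ 100] run_loop_free) (simp_all add: tree_step_def emit_def)
  qed (use t' in simp_all)
  have 3: "run ?exit t' 20 (\<lambda>t'. tree_inv m d s (Suc h) t' \<and> 2 * t' 21 0 \<le> L)"
    if t': "inv t' \<and> \<not> bval ?b t'" for t'
  proof (rule run_loop_free)
    define x where "x = t' 23 0"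
    let ?u = "result ?exit t'"
    from t' have U: "t' 0 0 = m" "t' 20 0 = h * m" "t' 21 0 = L" "t' 22 0 = 2 * x - x mod 2"
      "length (gates_of t') = n + x" "0 < x \<longrightarrow> x + 2 \<le> L" "2 * x \<le> L" and S: "sound m d (gates_of t')"
      and B: "levels_built m (t' 5) (gates_of t') h" "level_built m (t' 5) (gates_of t') (Suc h) x"
      and F: "\<forall>a. a \<notin> tree_arrays \<longrightarrow> t' a = s a"
      unfolding inv_def x_def by blast+
    have ge: "\<not> 2 * x - x mod 2 + 2 < L" using t' U by simp
    have fits: "y < x \<longleftrightarrow> block_fits m (Suc h) y" for y
    proof
      show "y < x \<Longrightarrow> block_fits m (Suc h) y" using B(2) unfolding level_built_def by blast
      assume f: "block_fits m (Suc h) y"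
      show "y < x"
      proof (rule ccontr)
        assume "\<not> y < x"
        then have "block_fits m (Suc h) x" using block_fits_antimono[OF f] by simp
        then show False using ge unfolding block_fits_Suc L[symmetric] by simp
      qed
    qed
    have built: "levels_built m (t' 5) (gates_of t') (Suc h)"
      unfolding levels_built_def
    proof (intro allI impI)
      fix k y assume k: "k \<le> Suc h" "block_fits m k y"
      show "realizes m (gates_of t') (t' 5 (k * m + y)) (agg y (block k y)) k"
      proof (cases "k = Suc h")
        case True
        then show ?thesis using k fits B(2) unfolding level_built_def by blast
      next
        case False
        then have "k \<le> h" using k(1) by simp
        then show ?thesis using k(2) B(1) unfolding levels_built_def by blast
      qed
    qed
    have T: "n + L \<le> m" "L < 2 \<longrightarrow> n + 2 \<le> m"
      using t unfolding tree_inv_def n_def L_def by blast+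
    have num: "n + x + x \<le> m" "x < 2 \<longrightarrow> n + x + 2 \<le> m"
      using T U(6,7) by (cases "x = 0"; linarith)+
    have "tree_inv m d s (Suc h) ?u"
      unfolding tree_inv_def using U S built fits num F by (simp add: x_def)
    then show "tree_inv m d s (Suc h) ?u \<and> 2 * ?u 21 0 \<le> L" using U(7) by (simp add: x_def)
  qed simp_all
  have "run tree_level t (20 + ((200 * (L div 2) + (1 + bcost ?b)) + 20))
      (\<lambda>t'. tree_inv m d s (Suc h) t' \<and> 2 * t' 21 0 \<le> L)"
    unfolding tree_level_def by (rule run_Seq[OF 1 run_Seq[OF 2 3]])
  then show ?thesis unfolding L_def by (rule run_mono) simp_all
qed

lemma block_fits_0: "block_fits m 0 y \<longleftrightarrow> y < m"
  using div_mult_mod_eq[of y 2] unfolding block_fits_def by auto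

lemma block_fits_lower: "block_fits m (h + j) y \<Longrightarrow> \<exists>z. block_fits m h z"
  by (induction j arbitrary: y) (auto simp: block_fits_Suc)

lemma tree_inv_0:
  assumes t: "t 0 0 = m" "t 0 (Suc 0) = 0" "t 20 0 = 0" "t 21 0 = m" "\<forall>x<m. t 5 x = x"
    and m: "2 \<le> m" and frame: "\<forall>a. a \<notin> tree_arrays \<longrightarrow> t a = s a"
  shows "tree_inv m d s 0 t"
proof -
  have "levels_built m (t 5) [] 0"
    unfolding levels_built_def
  proof (intro allI impI)
    fix k y assume k: "k \<le> 0" "block_fits m k y"
    have y: "y < m" using k(2) by (rule block_fits_less)
    have w: "w = y" if "w mod 2 = y mod 2" "w div 2 = y div 2" for w
      using that by (metis div_mult_mod_eq)
    have "u \<in> block 0 y \<longleftrightarrow> u = y" for u unfolding block_def using w[of u] by auto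
    then have "block 0 y = {y}" by blast
    then have "agg y (block k y) = (\<lambda>x. x y)" using k(1) by (intro ext) (simp add: agg_def)
    then show "realizes m [] (t 5 (k * m + y)) (agg y (block k y)) k"
      using realizes_input[OF y] t(5) y k(1) by simp
  qed
  then show ?thesis
    unfolding tree_inv_def block_fits_0 using t m frame by (simp add: sound_Nil)
qed

lemma tree_inv_finish:
  assumes "tree_inv m d s h t" "t 21 0 = 0"
  shows "tree_vertices m (t 5) (gates_of t)"
  unfolding tree_vertices_def
proof (intro allI impI)
  fix k y assume k: "block_fits m k y"
  from assms have L: "\<not> block_fits m h z" for z unfolding tree_inv_def by auto
  have "k \<le> h"
  proof (rule ccontr)
    assume "\<not> k \<le> h"
    then have "block_fits m (h + (k - h)) y" using k by simp
    then show False using block_fits_lower L by blast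
  qed
  with k show "realizes m (gates_of t) (t 5 (k * m + y)) (agg y (block k y)) k"
    using assms(1) unfolding tree_inv_def levels_built_def by blast
qed

lemma run_trees:
  assumes s: "s 0 0 = m" "s 0 (Suc 0) = 0" and m: "2 \<le> m"
    and d: "\<And>h x. block_fits m (Suc h) x \<Longrightarrow> h < d"
  shows "run trees s (500 * m + 50) (\<lambda>t. tree_vertices m (t 5) (gates_of t) \<and>
    sound m d (gates_of t) \<and> length (gates_of t) + 2 \<le> m \<and> t 0 0 = m \<and>
    (\<forall>a. a \<notin> tree_arrays \<longrightarrow> t a = s a))"
proof -
  define inv where "inv t \<longleftrightarrow> t 0 0 = m \<and> t 0 (Suc 0) = 0 \<and> t 19 0 \<le> m \<and> (\<forall>x<t 19 0. t 5 x = x) \<and>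
    (\<forall>a. a \<notin> tree_arrays \<longrightarrow> t a = s a)" for t :: store
  let ?b = "Less (Var 19) num_inputs"
  let ?c = "Seq (Assign 5 (Var 19) (Var 19)) (Set 19 (Plus (Var 19) (Const 1)))"
  let ?init = "Seq (Set 20 (Const 0)) (Set 21 num_inputs)"
  let ?g = "Less (Const 0) (Var 21)"
  have 1: "run (Set 19 (Const 0)) s 5 (\<lambda>t. inv t \<and> t 19 0 = 0)"
    by (rule run_loop_free) (simp_all add: inv_def s)
  have 2: "run (While ?b ?c) t (50 * m + (1 + bcost ?b)) (\<lambda>t. inv t \<and> \<not> bval ?b t)"
    if t: "inv t \<and> t 19 0 = 0" for t
  proof (rule run_mono[OF run_While[where P = inv and f = "\<lambda>t. 50 * (m - t 19 0)"]])
    fix u assume u: "inv u" "bval ?b u"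
    then have lt: "u 19 0 < m" by (simp add: inv_def)
    have "inv (result ?c u)" using u lt by (auto simp: inv_def less_Suc_eq)
    then show "\<exists>B. run ?c u B (\<lambda>t'. inv t' \<and> B + (1 + bcost ?b) + 50 * (m - t' 19 0) \<le> 50 * (m - u 19 0))"
      using lt by (intro exI[of _ 20] run_loop_free) simp_all
  qed (use t in simp_all)
  have 3: "run ?init t 10 (\<lambda>t. \<exists>h. tree_inv m d s h t \<and> t 21 0 = m)"
    if t: "inv t \<and> \<not> bval ?b t" for t
  proof (rule run_loop_free)
    have "tree_inv m d s 0 (result ?init t)"
      using t m by (intro tree_inv_0) (simp_all add: inv_def)
    then show "\<exists>h. tree_inv m d s h (result ?init t) \<and> result ?init t 21 0 = m"
      using t by (auto simp: inv_def)
  qed simp_all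
  have 4: "run (While ?g tree_level) t (450 * m + (1 + bcost ?g))
      (\<lambda>t. (\<exists>h. tree_inv m d s h t) \<and> \<not> bval ?g t)"
    if t: "\<exists>h. tree_inv m d s h t \<and> t 21 0 = m" for t
  \<comment> \<open>The number of blocks at least halves per level, so a potential linear in it pays
    for the current level and for all later ones.\<close>
  proof (rule run_mono[OF run_While[where P = "\<lambda>t. \<exists>h. tree_inv m d s h t" and f = "\<lambda>t. 450 * t 21 0"]])
    fix u assume u: "\<exists>h. tree_inv m d s h u" "bval ?g u"
    then obtain h where h: "tree_inv m d s h u" by blast
    have pos: "0 < u 21 0" using u(2) by simp
    show "\<exists>B. run tree_level u B (\<lambda>t'. (\<exists>h. tree_inv m d s h t') \<and>
        B + (1 + bcost ?g) + 450 * t' 21 0 \<le> 450 * u 21 0)"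
    proof (intro exI)
      show "run tree_level u (200 * (u 21 0 div 2) + 50) (\<lambda>t'. (\<exists>h. tree_inv m d s h t') \<and>
          (200 * (u 21 0 div 2) + 50) + (1 + bcost ?g) + 450 * t' 21 0 \<le> 450 * u 21 0)"
      proof (rule run_mono[OF run_tree_level[OF h pos d] order_refl])
        fix t' assume t': "tree_inv m d s (Suc h) t' \<and> 2 * t' 21 0 \<le> u 21 0"
        have "200 * (u 21 0 div 2) + 50 + (1 + bcost ?g) + 450 * t' 21 0 \<le> 450 * u 21 0"
        proof -
          have half: "2 * (L div 2) \<le> L" for L :: nat by simp
          have "2 * t' 21 0 \<le> u 21 0" using t' by (rule conjunct2)
          moreover have "bcost ?g = 4" by simp
          ultimately show ?thesis using half[of "u 21 0"] pos by linarith
        qed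
        then show "(\<exists>h. tree_inv m d s h t') \<and>
            (200 * (u 21 0 div 2) + 50) + (1 + bcost ?g) + 450 * t' 21 0 \<le> 450 * u 21 0"
          using t' by blast
      qed
    qed
  qed (use t in auto)
  have "run trees s (5 + ((50 * m + (1 + bcost ?b)) + (10 + (450 * m + (1 + bcost ?g)))))
      (\<lambda>t. (\<exists>h. tree_inv m d s h t) \<and> \<not> bval ?g t)"
    unfolding trees_def by (rule run_Seq[OF 1 run_Seq[OF 2 run_Seq[OF 3 4]]])
  then show ?thesis
  proof (rule run_mono)
    fix t assume t: "(\<exists>h. tree_inv m d s h t) \<and> \<not> bval ?g t"
    from conjunct1[OF t] obtain h where h: "tree_inv m d s h t" by (rule exE)
    have L: "t 21 0 = 0" using conjunct2[OF t] by simp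
    show "tree_vertices m (t 5) (gates_of t) \<and> sound m d (gates_of t) \<and>
        length (gates_of t) + 2 \<le> m \<and> t 0 0 = m \<and> (\<forall>a. a \<notin> tree_arrays \<longrightarrow> t a = s a)"
      using tree_inv_finish[OF h L] h[unfolded tree_inv_def] L by (elim conjE) simp
  qed simp
qed

section \<open>The algorithm\<close>

lemma slot_pre_lower: "2 * i \<le> slot_pre (Suc i)"
proof (induction i)
  case (Suc i)
  then show ?case using slot_len_pos[of "Suc i"] slot_pre_Suc[of "Suc i"] by simp
qed simp

lemma slot_pre_upper: "2 \<le> i \<Longrightarrow> slot_pre i \<le> 2 ^ i"
proof (induction i rule: dec_induct)
  case (step i)
  then show ?case using slot_len_le_pre[of i] by simp
qed simp

lemma slot_cap_upper: "slot_cap i \<le> 2 ^ i"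
proof (cases "5 \<le> i")
  case True
  have "slot_len i + 2 \<le> slot_pre i"
    using slot_len_pre[OF True] slot_len_pos[of "Suc (slot_lev i)"] by simp
  moreover have "slot_pre i \<le> 2 ^ i" using True by (intro slot_pre_upper) simp
  moreover have "slot_cap i \<le> Suc (slot_len i)" by (rule slot_cap_bounds)
  ultimately show ?thesis by linarith
next
  case False
  then have "i \<le> 4" by simp
  from nat_le_4_cases[OF this] show ?thesis by (elim disjE) simp_all
qed

text \<open>No more than \<open>2 ^ d\<close> positions fit into depth \<open>d\<close>. This bounds
  the height of the shared trees by the depth of the circuit, also for blocks that no signal
  uses.\<close>

lemma room_upper: "room k i 0 + 2 ^ i \<le> 2 ^ (i + k)"
proof (induction k arbitrary: i)
  case (Suc k)
  have "2 * 2 ^ i \<le> (2 :: nat) ^ (i + Suc k)"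
    using power_increasing[of "Suc i" "i + Suc k" "2 :: nat"] by simp
  moreover have "room k (Suc i) 0 + 2 * 2 ^ i \<le> 2 ^ (i + Suc k)" using Suc[of "Suc i"] by simp
  moreover have "slot_cap i \<le> 2 ^ i" "slot_len i \<le> 2 ^ i"
    using slot_cap_upper[of i] slot_cap_bounds(1)[of i] by linarith+
  ultimately show ?case by simp
qed simp

lemma slot_lev_upper:
  assumes "2 \<le> i" "slot_pre i < m"
  shows "2 ^ slot_lev i \<le> m"
proof (cases "5 \<le> i")
  case True
  then show ?thesis using slot_lev_min[OF True] assms(2) by simp
next
  case False
  with assms(1) have "i = 2 \<or> i = 3 \<or> i = 4" by auto
  then show ?thesis using assms(2) by (elim disjE) simp_all
qed

text \<open>Minimality of \<open>d\<close> gives the depth bound, through \<open>depth_bound\<close>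
  at \<open>d - 1\<close>, and shows that \<open>slot_pre\<close> stays below \<open>m\<close> for
  all slots in use. The case \<open>d = 1\<close>, where \<open>m = 2\<close>, is direct, since
  \<open>depth_bound\<close> needs a positive index.\<close>

lemma obtain_depth:
  assumes "2 \<le> m"
  obtains d where "0 < d" "m \<le> room d 0 0 + 1" "real d \<le> log 2 m + log 2 (log 2 m) + 0.65"
    "\<And>x. 2 \<le> x \<Longrightarrow> x < d \<Longrightarrow> slot_pre x < m" "\<And>h x. block_fits m (Suc h) x \<Longrightarrow> h < d"
proof -
  define d where "d = (LEAST d. m \<le> room d 0 0 + 1)"
  have "m \<le> room (Suc m) 0 0 + 1"
    using slot_pre_lower[of m] slot_pre_le_room[of "Suc m"] by linarith
  then have d: "m \<le> room d 0 0 + 1" unfolding d_def by (rule LeastI)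
  have less: "room e 0 0 + 2 \<le> m" if "e < d" for e
    using not_less_Least[of e "\<lambda>d. m \<le> room d 0 0 + 1"] that unfolding d_def by simp
  have pos: "0 < d"
  proof (rule ccontr)
    assume "\<not> 0 < d"
    then show False using d assms by simp
  qed
  have bound: "real d \<le> log 2 m + log 2 (log 2 m) + 0.65"
  proof (cases "d = 1")
    case True
    then have "m = 2" using d assms by simp
    then show ?thesis using True by simp
  next
    case False
    then have "0 < d - 1" "d - 1 < d" "Suc (d - 1) = d" using pos by simp_all
    then show ?thesis using depth_bound[of "d - 1" m] less[of "d - 1"] by simp
  qed
  have pre: "slot_pre x < m" if "2 \<le> x" "x < d" for x
    using less[OF that(2)] slot_pre_le_room[of x] by linarith
  have height: "h < d" if "block_fits m (Suc h) x" for h x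
  proof (rule ccontr)
    assume "\<not> h < d"
    then have "(2 :: nat) ^ d \<le> 2 ^ h" by (intro power_increasing) simp_all
    moreover have "Suc (x div 2) * 2 ^ h \<ge> 2 ^ h" by simp
    then have "4 * 2 ^ h \<le> m + 1" using that unfolding block_fits_def by simp
    moreover have "room d 0 0 + 1 \<le> 2 ^ d" using room_upper[of d 0] by simp
    moreover have "1 \<le> (2 :: nat) ^ d" by simp
    ultimately show False using d by linarith
  qed
  show ?thesis by (rule that[OF pos d bound pre height])
qed

definition prepare :: com where
  "prepare = Seq half_table
     (Seq (Seq slot_table_init (While (Less (Var 19) num_inputs) slot_table_step))
     (Seq trees (Seq (Set 15 num_inputs) (Set 17 (Const 1)))))"

definition and_or_program :: com where
  "and_or_program = Seq prepare
     (Seq (While main_guard main_step) (Assign 0 (Const 2) (Var 11)))"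

lemma run_prepare:
  assumes m: "length ts = m" "2 \<le> m"
    and d: "\<And>x. 2 \<le> x \<Longrightarrow> x < d \<Longrightarrow> slot_pre x < m" "\<And>h x. block_fits m (Suc h) x \<Longrightarrow> h < d"
  shows "run prepare (input_store ts) (620 * m + 240) (\<lambda>s.
    env m (s 5) d s \<and> top_segment s 0 m 0 0 1 0 0 \<and> s 16 0 = 0 \<and> s 1 = input_store ts 1 \<and>
    tree_vertices m (s 5) (gates_of s) \<and> sound m d (gates_of s) \<and> length (gates_of s) + 2 \<le> m)"
proof -
  let ?s = "input_store ts"
  let ?slots = "Seq slot_table_init (While (Less (Var 19) num_inputs) slot_table_step)"
  let ?P = "\<lambda>s. (\<forall>x\<le>m. s 6 x = x div 2) \<and> (\<forall>a. a \<notin> {6, 19, 24} \<longrightarrow> s a = ?s a)"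
  let ?Q = "\<lambda>s. (\<forall>x\<le>m. s 6 x = x div 2) \<and> (\<forall>x. 2 \<le> x \<and> x < d \<longrightarrow>
      s 7 x = slot_len x \<and> s 8 x = slot_cap x \<and> s 9 x = slot_lev x) \<and>
      (\<forall>a. a \<notin> {6, 7, 8, 9, 19, 20, 21, 22, 24} \<longrightarrow> s a = ?s a)"
  let ?R = "\<lambda>s. (tree_vertices m (s 5) (gates_of s) \<and> sound m d (gates_of s) \<and>
      length (gates_of s) + 2 \<le> m \<and> s 0 0 = m) \<and> (\<forall>x\<le>m. s 6 x = x div 2) \<and>
      (\<forall>x. 2 \<le> x \<and> x < d \<longrightarrow> s 7 x = slot_len x \<and> s 8 x = slot_cap x \<and> s 9 x = slot_lev x) \<and>
      (\<forall>a\<in>{1, 10, 11, 12, 13, 14, 15, 16}. s a = ?s a)"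
  have s: "?s 0 0 = m" "?s 0 (Suc 0) = 0" "\<And>a x. 1 < a \<Longrightarrow> ?s a x = 0"
    using m(1) by (simp_all add: input_store_def)
  have 1: "run half_table ?s (40 * m + 90) ?P" by (rule run_half_table) (simp_all add: s)
  have 2: "run ?slots t (80 * m + 80) ?Q" if t: "?P t" for t
  proof (rule run_mono[OF run_slot_table[of t m]])
    show "t 0 0 = m" using t s(1) by simp
    fix u assume u: "(\<forall>x. 2 \<le> x \<and> slot_pre x < m \<longrightarrow>
        u 7 x = slot_len x \<and> u 8 x = slot_cap x \<and> u 9 x = slot_lev x) \<and>
      (\<forall>a. a \<notin> {7, 8, 9, 19, 20, 21, 22} \<longrightarrow> u a = t a)"
    show "?Q u" using u t d(1) by simp
  qed simp
  have 3: "run trees t (500 * m + 50) ?R" if t: "?Q t" for t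
  proof (rule run_mono[OF run_trees[of t m d]])
    show "t 0 0 = m" "t 0 (Suc 0) = 0" using t s(1,2) by simp_all
    show "h < d" if "block_fits m (Suc h) x" for h x by (rule d(2)[OF that])
    fix u assume u: "tree_vertices m (u 5) (gates_of u) \<and> sound m d (gates_of u) \<and>
      length (gates_of u) + 2 \<le> m \<and> u 0 0 = m \<and> (\<forall>a. a \<notin> tree_arrays \<longrightarrow> u a = t a)"
    show "?R u" using u t by simp
  qed (simp_all add: m)
  let ?c = "Seq (Set 15 num_inputs) (Set 17 (Const 1))"
  have 4: "run ?c t 10 (\<lambda>s.
    env m (s 5) d s \<and> top_segment s 0 m 0 0 1 0 0 \<and> s 16 0 = 0 \<and> s 1 = input_store ts 1 \<and>
    tree_vertices m (s 5) (gates_of s) \<and> sound m d (gates_of s) \<and> length (gates_of s) + 2 \<le> m)"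
    if t: "?R t" for t
    by (rule run_loop_free) (use t s(3) in \<open>simp_all add: env_def top_segment_def\<close>)
  show ?thesis
    unfolding prepare_def by (rule run_mono[OF run_Seq[OF 1 run_Seq[OF 2 run_Seq[OF 3 4]]]]) simp_all
qed

lemma output_circuit_eq:
  assumes "s 0 0 = length ts" "s 1 = input_store ts 1"
  shows "output_circuit s = \<lparr>inputs = ts, gates = gates_of s, outv = s 0 2\<rparr>"
proof -
  have "map (s 1) [0..<length ts] = ts" unfolding assms(2) input_store_def by (intro nth_equalityI) simp_all
  then show ?thesis using assms(1) by (simp add: output_circuit_def gate_list_def)
qed

lemma run_and_or_program:
  assumes m: "length ts = m" "2 \<le> m"
    and d: "0 < d" "m \<le> room d 0 0 + 1" "\<And>x. 2 \<le> x \<Longrightarrow> x < d \<Longrightarrow> slot_pre x < m"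
      "\<And>h x. block_fits m (Suc h) x \<Longrightarrow> h < d"
    and h: "\<And>i. 2 \<le> i \<Longrightarrow> i < d \<Longrightarrow> slot_lev i \<le> h"
  shows "run and_or_program (input_store ts) (2000 * m * (1 + h)) (\<lambda>s. \<exists>gs w F.
    output_circuit s = \<lparr>inputs = ts, gates = gs, outv = w\<rparr> \<and> sound m d gs \<and>
    realizes m gs w F d \<and> prefix_correct 0 m F \<and> 3 * length gs + 14 \<le> 11 * m)"
proof -
  let ?Q = "\<lambda>s. \<exists>gs w F.
    output_circuit s = \<lparr>inputs = ts, gates = gs, outv = w\<rparr> \<and> sound m d gs \<and>
    realizes m gs w F d \<and> prefix_correct 0 m F \<and> 3 * length gs + 14 \<le> 11 * m"
  let ?B = "300 + 130 * h"
  let ?A = "(?B + (1 + bcost main_guard)) * (3 * m) + (1 + bcost main_guard)"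
  have main: "run (Seq (While main_guard main_step) (Assign 0 (Const 2) (Var 11))) s (?A + 10) ?Q"
    if s: "env m (s 5) d s \<and> top_segment s 0 m 0 0 1 0 0 \<and> s 16 0 = 0 \<and> s 1 = input_store ts 1 \<and>
      tree_vertices m (s 5) (gates_of s) \<and> sound m d (gates_of s) \<and> length (gates_of s) + 2 \<le> m" for s
  proof -
    from s have top: "top_segment s 0 m 0 0 1 0 0" and env: "env m (s 5) d s"
      and sp: "s 16 0 = 0" and one: "s 1 = input_store ts 1" and sound: "sound m d (gates_of s)"
      and len: "length (gates_of s) + 2 \<le> m" and tree: "tree_vertices m (s 5) (gates_of s)" by blast+
    have inp: "realizes m (gates_of s) 0 (\<lambda>x. x 0) 0" by (rule realizes_input) (use m in simp)
    have "chain_inv m (s 5) d d 0 0 (gates_of s) 0 m 0 0 1 0 0"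
      by (rule chain_invI[OF tree sound order_refl _ _ _ _ _ _ _ _ _ inp])
        (use m d(2) prefix_correct_input[of 0] in \<open>simp_all add: absorbing_def\<close>)
    from chain_exists[OF this] obtain gs w k F where
      c: "chain m (s 5) d (gates_of s) 0 m 0 0 1 0 0 gs w k" and gs: "sound m d gs"
      and w: "realizes m gs w F d" and F: "prefix_correct 0 (m - 0) F"
      and size: "length gs \<le> length (gates_of s) + slot_cost 0 (m - 1) 0"
      and k: "k \<le> 3 * (m - 1) + (if 0 < (0 :: nat) then 1 else 0)"
      by blast
    have "\<exists>s' i' r'. iterations main_guard main_step ?B k s s' \<and> env m (s 5) d s' \<and>
        s' 16 0 = s 16 0 \<and> top_segment s' 0 m i' w m 0 r' \<and> gates_of s' = gs \<and>
        same_below (s 16 0) s s'"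
    proof (rule chain_simulation[OF c _ env top refl])
      show "slot_lev i \<le> h" if "2 \<le> i" "i < d" for i by (rule h[OF that])
    qed (use m in simp_all)
    then obtain s' i' r' where
      s': "iterations main_guard main_step ?B k s s'" "env m (s 5) d s'" "s' 16 0 = s 16 0"
        "top_segment s' 0 m i' w m 0 r'" "gates_of s' = gs" "same_below (s 16 0) s s'"
      by blast
    have "s' 17 0 = m" "s' 0 0 = m" "s' 11 0 = w" "s' 1 = input_store ts 1"
      using s'(2,3,4,6) sp one by (simp_all add: top_segment_def env_def same_below_def)
    note t = this
    have "\<not> bval main_guard s'" unfolding bval_main_guard using t s'(3) sp by simp
    from run_iterations[OF s'(1) this]
    have "run (While main_guard main_step) s ?A (\<lambda>t. t = s')"
    proof (rule run_mono)
      have "k \<le> 3 * m" using k by simp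
      then show "(?B + (1 + bcost main_guard)) * k + (1 + bcost main_guard) \<le> ?A"
        by (intro add_mono mult_le_mono) simp_all
    qed
    moreover have "run (Assign 0 (Const 2) (Var 11)) t 10 ?Q" if "t = s'" for t
    proof (rule run_loop_free)
      let ?t = "result (Assign 0 (Const 2) (Var 11)) t"
      have "output_circuit ?t = \<lparr>inputs = ts, gates = gates_of ?t, outv = ?t 0 2\<rparr>"
        by (rule output_circuit_eq) (use that t m in simp_all)
      also have "gates_of ?t = gs" using that s'(5) by simp
      also have "?t 0 2 = w" using that t by simp
      finally have "output_circuit ?t = \<lparr>inputs = ts, gates = gs, outv = w\<rparr>" .
      \<comment> \<open>At most \<open>m - 2\<close> gates for the trees and 8 / 3 for each of the
        \<open>m - 1\<close> positions after the first: 11 / 3 * m - 14 / 3 in total.\<close>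
      moreover have "3 * length gs + 14 \<le> 11 * m"
        using size len slot_cost_le[of "m - 1"] m by linarith
      ultimately show "?Q ?t" using gs w F by auto
    qed simp_all
    ultimately show ?thesis by (rule run_Seq)
  qed
  have prep: "run prepare (input_store ts) (620 * m + 240) (\<lambda>s.
    env m (s 5) d s \<and> top_segment s 0 m 0 0 1 0 0 \<and> s 16 0 = 0 \<and> s 1 = input_store ts 1 \<and>
    tree_vertices m (s 5) (gates_of s) \<and> sound m d (gates_of s) \<and> length (gates_of s) + 2 \<le> m)"
  proof (rule run_prepare[OF m])
    show "slot_pre x < m" if "2 \<le> x" "x < d" for x by (rule d(3)[OF that])
    show "h < d" if "block_fits m (Suc h) x" for h x by (rule d(4)[OF that])
  qed
  have "run and_or_program (input_store ts) ((620 * m + 240) + (?A + 10)) ?Q"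
    unfolding and_or_program_def by (rule run_Seq[OF prep main])
  then show ?thesis
  proof (rule run_mono)
    have guard: "bcost main_guard = 12" by (simp add: main_guard_def)
    show "(620 * m + 240) + (?A + 10) \<le> 2000 * m * (1 + h)"
      unfolding guard using m(2) by (simp add: algebra_simps)
  qed
qed

section \<open>Running time and conclusion\<close>

definition time_bound :: "nat \<Rightarrow> nat" where
  "time_bound m = 2000 * m * (1 + nat \<lfloor>log 2 m\<rfloor>)"

lemma time_bound_bigo: "(\<lambda>m. real (time_bound m)) \<in> O(\<lambda>m. real m * log 2 (real m))"
proof (rule bigoI[where c = 4000])
  show "\<forall>\<^sub>F m in sequentially. norm (real (time_bound m)) \<le> 4000 * norm (real m * log 2 (real m))"
    using eventually_ge_at_top[of 2]
  proof eventually_elim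
    case (elim m)
    have l: "1 \<le> log 2 (real m)" using elim by (simp add: le_log_iff)
    then have "1 + real (nat \<lfloor>log 2 m\<rfloor>) \<le> 2 * log 2 m" by linarith
    then have "2000 * real m * (1 + real (nat \<lfloor>log 2 m\<rfloor>)) \<le> 2000 * real m * (2 * log 2 m)"
      by (intro mult_left_mono) simp_all
    moreover have "norm (real (time_bound m)) = 2000 * real m * (1 + real (nat \<lfloor>log 2 m\<rfloor>))"
      by (simp only: time_bound_def real_norm_def of_nat_mult of_nat_add) simp
    moreover have "2000 * real m * (2 * log 2 m) = 4000 * norm (real m * log 2 (real m))"
      using l by simp
    ultimately show ?case by linarith
  qed
qed

theorem mainTheorem1:
  "\<exists>(P :: com) (T :: nat \<Rightarrow> nat).
     (\<lambda>m. real (T m)) \<in> O(\<lambda>m. real m * log 2 (real m)) \<and>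
     (\<forall>(m :: nat) (t :: nat list). m \<ge> 2 \<and> length t = m \<and> distinct t \<longrightarrow>
       (\<exists>n s. exec P (input_store t) n s \<and> n \<le> T m \<and>
         (let C = output_circuit s in
            is_circuit C \<and>
            set (inputs C) = set t \<and>
            computes C (\<lambda>x. and_or_path (map x t)) \<and>
            real (circuit_depth C) \<le> log 2 (real m) + log 2 (log 2 (real m)) + 0.65 \<and>
            real (circuit_size C) \<le> 3.67 * real m - 2)))"
proof (intro exI[of _ and_or_program] exI[of _ time_bound] conjI allI impI)
  show "(\<lambda>m. real (time_bound m)) \<in> O(\<lambda>m. real m * log 2 (real m))" by (rule time_bound_bigo)
  fix m :: nat and t :: "nat list"
  assume mt: "m \<ge> 2 \<and> length t = m \<and> distinct t"
  then have m: "2 \<le> m" "length t = m" "distinct t" "t \<noteq> []" by auto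
  obtain d where d: "0 < d" "m \<le> room d 0 0 + 1" "real d \<le> log 2 m + log 2 (log 2 m) + 0.65"
    "\<And>x. 2 \<le> x \<Longrightarrow> x < d \<Longrightarrow> slot_pre x < m" "\<And>h x. block_fits m (Suc h) x \<Longrightarrow> h < d"
    using obtain_depth[OF m(1)] by metis
  have h: "slot_lev i \<le> nat \<lfloor>log 2 m\<rfloor>" if i: "2 \<le> i" "i < d" for i
  proof -
    have "2 ^ slot_lev i \<le> m" by (rule slot_lev_upper[OF i(1) d(4)[OF i]])
    then have "real (slot_lev i) \<le> log 2 m" by (rule le_log2_of_power)
    then show ?thesis by linarith
  qed
  have "run and_or_program (input_store t) (2000 * m * (1 + nat \<lfloor>log 2 m\<rfloor>)) (\<lambda>s. \<exists>gs w F.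
      output_circuit s = \<lparr>inputs = t, gates = gs, outv = w\<rparr> \<and> sound m d gs \<and>
      realizes m gs w F d \<and> prefix_correct 0 m F \<and> 3 * length gs + 14 \<le> 11 * m)"
  proof (rule run_and_or_program[OF m(2,1) d(1,2)])
    show "slot_pre x < m" if "2 \<le> x" "x < d" for x by (rule d(4)[OF that])
    show "h < d" if "block_fits m (Suc h) x" for h x by (rule d(5)[OF that])
    show "slot_lev i \<le> nat \<lfloor>log 2 m\<rfloor>" if "2 \<le> i" "i < d" for i by (rule h[OF that])
  qed
  then obtain n s gs w F where
    s: "exec and_or_program (input_store t) n s" "n \<le> time_bound m"
    and C: "output_circuit s = \<lparr>inputs = t, gates = gs, outv = w\<rparr>"
    and sound: "sound m d gs" and w: "realizes m gs w F d" and F: "prefix_correct 0 m F"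
    and size: "3 * length gs + 14 \<le> 11 * m"
    unfolding run_def time_bound_def by blast
  let ?C = "\<lparr>inputs = t, gates = gs, outv = w\<rparr>"
  have top: "topological (length t) gs" using sound m(2) by (simp add: sound_def)
  have "is_circuit ?C"
    by (rule is_circuit_topological[OF m(3) top]) (use w m(2) in \<open>simp add: realizes_def\<close>)
  moreover have "computes ?C (\<lambda>x. and_or_path (map x t))"
  proof -
    have "F (\<lambda>i. x (t ! i)) = and_or_path (map x t)" for x
      using F m(2) unfolding and_or_path_segment[OF m(4)] prefix_correct_def by simp
    then show ?thesis using computes_realizes[OF top w[folded m(2)]] by simp
  qed
  moreover have "real (circuit_depth ?C) \<le> log 2 (real m) + log 2 (log 2 (real m)) + 0.65"
    using circuit_depth_sound[OF sound[folded m(2)] m(4), of w] d(3) by linarith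
  moreover have "real (circuit_size ?C) \<le> 3.67 * real m - 2"
  proof -
    have "real (3 * length gs + 14) \<le> real (11 * m)" using size by (simp only: of_nat_le_iff)
    then show ?thesis by (simp add: circuit_size_def)
  qed
  ultimately show "\<exists>n s. exec and_or_program (input_store t) n s \<and> n \<le> time_bound m \<and>
         (let C = output_circuit s in
            is_circuit C \<and>
            set (inputs C) = set t \<and>
            computes C (\<lambda>x. and_or_path (map x t)) \<and>
            real (circuit_depth C) \<le> log 2 (real m) + log 2 (log 2 (real m)) + 0.65 \<and>
            real (circuit_size C) \<le> 3.67 * real m - 2)"
    using s unfolding C by (intro exI[of _ n] exI[of _ s]) (simp add: C)
qed

end
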